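(* Let $\mathfrak g$ be a complex semisimple Lie algebra of rank $\ell$ with Cartan matrix $(a_{ij})$, and let $m_1,\dots,m_\ell$ be positive integers such that $l_i:=\sum_{j=1}^{\ell}m_ja_{ji}\in\mathbb Z_{\ge0}$ for all $i\in\Gamma=\{1,\dots,\ell\}$. Let $\mathcal M$ be the space of meromorphic functions in the complex variables $\gamma_{i,k}$ ($i\in\Gamma$, $1\le k\le m_i$), fix complex numbers $\nu_{i,s}$ ($i\in\Gamma$, $1\le s\le l_i$) and complex parameters $\omega_1,\omega_2$ with $\omega_2\neq0$ such that $q=e^{2\pi\imath\omega_1/\omega_2}$ is not a root of unity ($\imath=\sqrt{-1}$), and let $${\bf u}_{i,k}=e^{\imath\omega_1d_i\frac{\partial}{\partial\gamma_{i,k}}},\qquad {\bf v}_{i,k}=e^{\frac{2\pi\gamma_{i,k}}{\omega_2}},\qquad {\bf w}_{i,s}=e^{\frac{2\pi\nu_{i,s}}{\omega_2}}$$ act on $\mathcal M$ (${\bf u}_{i,k}$ as the shift $\gamma_{i,k}\mapsto\gamma_{i,k}+\imath\omega_1d_i$, ${\bf v}_{i,k}$ and ${\bf w}_{i,s}$ by multiplication). Let $R_i^{(\pm)}(z)$ be polynomials with $R_i^{(+)}(z)R_i^{(-)}(z)=\prod_{s=1}^{l_i}(z{\bf w}_{i,s}^{-1}-{\bf w}_{i,s})$, and put $c_i=\prod_{j=1}^{\ell}q_j^{m_ja_{ji}/2}$. Let $K_i^+(z)$ and $K_i^-(z)$ be the expansions in powers of $z^{-1}$ and of $z$, respectively,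 of $$K_i(z)=c_i\prod_{j=1}^{\ell}\prod_{p=1}^{m_j}{\bf v}_{j,p}^{a_{ji}}\cdot\prod_{s=1}^{l_i}(z{\bf w}_{i,s}^{-1}-{\bf w}_{i,s})\;\frac{\prod_{j\ne i}\prod_{r=1}^{-a_{ji}}\prod_{p=1}^{m_j}(z-q_j^{a_{ji}+2r}{\bf v}_{j,p}^2)}{\prod_{p=1}^{m_i}(z-{\bf v}_{i,p}^2)(z-q_i^2{\bf v}_{i,p}^2)},$$ and let $$E_i(z)=\frac{c_i}{q_i-q_i^{-1}}\prod_{p=1}^{m_i}{\bf v}_{i,p}\cdot\prod_{j=i+1}^{\ell}\prod_{p=1}^{m_j}{\bf v}_{j,p}^{a_{ji}}\cdot\sum_{k=1}^{m_i}\delta(z/{\bf v}_{i,k}^2)\,{\bf v}_{i,k}^{-2}R_i^{(+)}({\bf v}_{i,k}^2)\frac{\prod_{j=i+1}^{\ell}\prod_{r=1}^{-a_{ji}}\prod_{p=1}^{m_j}({\bf v}_{i,k}^2-q_j^{a_{ji}+2r}{\bf v}_{j,p}^2)}{\prod_{p\ne k}({\bf v}_{i,k}^2-{\bf v}_{i,p}^2)}\,{\bf u}_{i,k}^{-1},$$ $$F_i(z)=-\frac{q_i^{-2m_i}}{q_i-q_i^{-1}}\prod_{p=1}^{m_i}{\bf v}_{i,p}\cdot\prod_{j=1}^{i-1}\prod_{p=1}^{m_j}{\bf v}_{j,p}^{a_{ji}}\cdot\sum_{k=1}^{m_i}\delta(z/q_i^2{\bf v}_{i,k}^2)\,{\bf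 v}_{i,k}^{-2}R_i^{(-)}(q_i^2{\bf v}_{i,k}^2)\frac{\prod_{j=1}^{i-1}\prod_{r=1}^{-a_{ji}}\prod_{p=1}^{m_j}(q_i^2{\bf v}_{i,k}^2-q_j^{a_{ji}+2r}{\bf v}_{j,p}^2)}{\prod_{p\ne k}({\bf v}_{i,k}^2-{\bf v}_{i,p}^2)}\,{\bf u}_{i,k}.$$ Then the coefficients $K_i^{\pm1}$, $H_i^{(n)}$ ($n\in\mathbb Z\setminus\{0\}$), $E_i^{(n)},F_i^{(n)}$ ($n\in\mathbb Z$), $i\in\Gamma$, of these formal series define a representation of $U_q(\hat{\mathfrak g})_{c=0}$ in $\mathcal M$.
   Context: Conventions. $\mathfrak g$ is a complex semisimple Lie algebra of rank $\ell$; $\Gamma=\{1,\dots,\ell\}$ is the (ordered) set of vertices of its Dynkin diagram; $a_{ij}=\alpha_i^\vee(\alpha_j)$ is the Cartan matrix; $d_1,\dots,d_\ell$ are fixed coprime positive integers such that $(d_ia_{ij})$ is symmetric. $q=e^{2\pi\imath\omega_1/\omega_2}$, $q_i=q^{d_i}$, and half-integer powers of $q$ are taken with $q^{1/2}=e^{\pi\imath\omega_1/\omega_2}$. $\delta(z)=\sum_{n\in\mathbb Z}z^n$ is the formal delta function. Empty products, in particular products $\prod_{r=1}^{k}$ with $k<1$, equal $1$. $\genfrac{[}{]}{0pt}{0}{m}{k}_q=\frac{[m]_q!}{[k]_q![m-k]_q!}$, $[k]_q!=\prod_{1\le j\le k}\frac{q^j-q^{-j}}{q-q^{-1}}$. $\mathfrak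 S_m$ is the symmetric group. Quantum affine algebra at level zero. $U_q(\hat{\mathfrak g})_{c=0}$ (for the given complex number $q$) is the associative algebra generated by $K_i^{\pm1}$, $H_i^{(n)}$ ($n\in\mathbb Z\setminus\{0\}$), $E_i^{(n)},F_i^{(n)}$ ($n\in\mathbb Z$), $i\in\Gamma$. With the generating series $$K_i^\pm(z)=K_i^{\pm1}\exp\Big(\pm(q_i-q_i^{-1})\sum_{n\ge1}H_i^{(\pm n)}z^{\mp n}\Big),\quad E_i(z)=\sum_{n\in\mathbb Z}E_i^{(n)}z^{-n},\quad F_i(z)=\sum_{n\in\mathbb Z}F_i^{(n)}z^{-n},$$ the defining relations are, for all $i,j\in\Gamma$: (1) $K_i^\pm(z)K_j^\pm(w)=K_j^\pm(w)K_i^\pm(z)$ and $K_i^+(z)K_j^-(w)=K_j^-(w)K_i^+(z)$; (2) $(z-q_i^{a_{ij}}w)K_i^\pm(z)E_j(w)=(q_i^{a_{ij}}z-w)E_j(w)K_i^\pm(z)$; (3) $(z-q_i^{-a_{ij}}w)K_i^\pm(z)F_j(w)=(q_i^{-a_{ij}}z-w)F_j(w)K_i^\pm(z)$; (4) $[E_i(z),F_j(w)]=\frac{\delta_{i,j}}{q_i-q_i^{-1}}\,\delta(z/w)\big(K_i^+(w)-K_i^-(z)\big)$; (5) $(z-q_i^{a_{ij}}w)E_i(z)E_j(w)=(q_i^{a_{ij}}z-w)E_j(w)E_i(z)$; (6) $(z-q_i^{-a_{ij}}w)F_i(z)F_j(w)=(q_i^{-a_{ij}}z-w)F_j(w)F_i(z)$;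 (7) for $i\ne j$ and $m=1-a_{ij}$: $\sum_{\sigma\in\mathfrak S_m}\sum_{k=0}^m(-1)^k\genfrac{[}{]}{0pt}{0}{m}{k}_{q_i}E_i(z_{\sigma(1)})\cdots E_i(z_{\sigma(k)})E_j(w)E_i(z_{\sigma(k+1)})\cdots E_i(z_{\sigma(m)})=0$; (8) the same relation as (7) with every $E$ replaced by $F$. The condition on the $m_i$ ensures that numerator and denominator of $K_i(z)$ have equal degree in $z$; the operator $K_i$ is the leading coefficient of $K_i^+(z)$, namely $c_i\prod_{s=1}^{l_i}{\bf w}_{i,s}^{-1}\prod_{j=1}^{\ell}\prod_{p=1}^{m_j}{\bf v}_{j,p}^{a_{ji}}$, $K_i^{-1}$ is the leading coefficient of $K_i^-(z)$, and the $H_i^{(n)}$ are read off from the exponential form of $K_i^\pm(z)$. *)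

theory Defs
  imports "HOL-Analysis.Analysis" "HOL-Computational_Algebra.Formal_Laurent_Series"
begin

section \<open>Complex vector spaces, algebras and endomorphism algebras\<close>

class complex_vector = ab_group_add +
  fixes scaleC :: "complex \<Rightarrow> 'a \<Rightarrow> 'a"  (infixr "*\<^sub>C" 75)
  assumes scaleC_add_right: "c *\<^sub>C (x + y) = c *\<^sub>C x + c *\<^sub>C y"
    and scaleC_add_left: "(c + d) *\<^sub>C x = c *\<^sub>C x + d *\<^sub>C x"
    and scaleC_scaleC: "c *\<^sub>C d *\<^sub>C x = (c * d) *\<^sub>C x"
    and scaleC_one: "1 *\<^sub>C x = x"

global_interpretation complex_vector: vector_space "scaleC :: complex \<Rightarrow> 'a \<Rightarrow> 'a::complex_vector"
  by unfold_locales (simp_all add: scaleC_add_right scaleC_add_left scaleC_scaleC scaleC_one)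

class complex_algebra_1 = complex_vector + ring_1 +
  assumes mult_scaleC_left: "(c *\<^sub>C x) * y = c *\<^sub>C (x * y)"
    and mult_scaleC_right: "x * (c *\<^sub>C y) = c *\<^sub>C (x * y)"

typedef (overloaded) ('a::complex_vector) endo =
  "{T :: 'a \<Rightarrow> 'a. (\<forall>x y. T (x + y) = T x + T y) \<and> (\<forall>c x. T (c *\<^sub>C x) = c *\<^sub>C T x)}"
  morphisms endo_apply Endo
  by (rule exI[of _ id]) simp

setup_lifting type_definition_endo

text \<open>The product is composition. The sort \<open>zero_neq_one\<close> makes the space nonzero,
  as \<open>ring_1\<close> requires \<open>0 \<noteq> 1\<close>.\<close>

instantiation endo :: ("{complex_vector, zero_neq_one}") complex_algebra_1
begin

lift_definition zero_endo :: "'a endo" is "\<lambda>x. 0" by simp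
lift_definition one_endo :: "'a endo" is "\<lambda>x. x" by simp
lift_definition plus_endo :: "'a endo \<Rightarrow> 'a endo \<Rightarrow> 'a endo" is "\<lambda>S T x. S x + T x"
  by (simp add: scaleC_add_right algebra_simps)
lift_definition minus_endo :: "'a endo \<Rightarrow> 'a endo \<Rightarrow> 'a endo" is "\<lambda>S T x. S x - T x"
  by (simp add: complex_vector.scale_right_diff_distrib algebra_simps)
lift_definition uminus_endo :: "'a endo \<Rightarrow> 'a endo" is "\<lambda>T x. - T x"
  by simp
lift_definition times_endo :: "'a endo \<Rightarrow> 'a endo \<Rightarrow> 'a endo" is "\<lambda>S T x. S (T x)"
  by simp
lift_definition scaleC_endo :: "complex \<Rightarrow> 'a endo \<Rightarrow> 'a endo" is "\<lambda>c T x. c *\<^sub>C T x"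
  by (simp add: scaleC_add_right scaleC_scaleC mult.commute)

instance
proof
  fix R S T :: "'a endo" and c d :: complex
  show "R + S + T = R + (S + T)" by transfer (simp add: add.assoc)
  show "R + S = S + R" by transfer (simp add: add.commute)
  show "0 + R = R" by transfer simp
  show "- R + R = 0" by transfer simp
  show "R - S = R + - S" by transfer simp
  show "R * S * T = R * (S * T)" by transfer simp
  show "1 * R = R" "R * 1 = R" by (transfer, simp)+
  show "(R + S) * T = R * T + S * T" by transfer simp
  show "R * (S + T) = R * S + R * T" by transfer simp
  show "(0 :: 'a endo) \<noteq> 1" by transfer (metis zero_neq_one)
  show "c *\<^sub>C (R + S) = c *\<^sub>C R + c *\<^sub>C S" by transfer (simp add: scaleC_add_right)
  show "(c + d) *\<^sub>C R = c *\<^sub>C R + d *\<^sub>C R" by transfer (simp add: scaleC_add_left)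
  show "c *\<^sub>C d *\<^sub>C R = (c * d) *\<^sub>C R" by transfer (simp add: scaleC_scaleC)
  show "1 *\<^sub>C R = R" by transfer (simp add: scaleC_one)
  show "c *\<^sub>C R * S = c *\<^sub>C (R * S)" by transfer simp
  show "R * c *\<^sub>C S = c *\<^sub>C (R * S)" by transfer simp
qed

end


section \<open>Semisimple Lie algebras and their Cartan matrices\<close>

definition lie_bracket :: "('g::complex_vector \<Rightarrow> 'g \<Rightarrow> 'g) \<Rightarrow> bool" where
  "lie_bracket br \<longleftrightarrow>
     (\<forall>x y z. br (x + y) z = br x z + br y z) \<and> (\<forall>x y z. br x (y + z) = br x y + br x z) \<and>
     (\<forall>c x y. br (c *\<^sub>C x) y = c *\<^sub>C br x y) \<and> (\<forall>c x y. br x (c *\<^sub>C y) = c *\<^sub>C br x y) \<and>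
     (\<forall>x. br x x = 0) \<and>
     (\<forall>x y z. br x (br y z) + br y (br z x) + br z (br x y) = 0)"

definition bracket_span :: "('g::complex_vector \<Rightarrow> 'g \<Rightarrow> 'g) \<Rightarrow> 'g set \<Rightarrow> 'g set \<Rightarrow> 'g set" where
  "bracket_span br I J = complex_vector.span {br x y | x y. x \<in> I \<and> y \<in> J}"

definition lie_ideal :: "('g::complex_vector \<Rightarrow> 'g \<Rightarrow> 'g) \<Rightarrow> 'g set \<Rightarrow> bool" where
  "lie_ideal br I \<longleftrightarrow> complex_vector.subspace I \<and> (\<forall>x. \<forall>y\<in>I. br x y \<in> I)"

definition lie_solvable :: "('g::complex_vector \<Rightarrow> 'g \<Rightarrow> 'g) \<Rightarrow> 'g set \<Rightarrow> bool" where
  "lie_solvable br I \<longleftrightarrow> (\<exists>n. ((\<lambda>J. bracket_span br J J) ^^ n) I = {0})"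

definition lie_nilpotent :: "('g::complex_vector \<Rightarrow> 'g \<Rightarrow> 'g) \<Rightarrow> 'g set \<Rightarrow> bool" where
  "lie_nilpotent br I \<longleftrightarrow> (\<exists>n. ((\<lambda>J. bracket_span br I J) ^^ n) I = {0})"

definition semisimple_lie_algebra :: "('g::complex_vector \<Rightarrow> 'g \<Rightarrow> 'g) \<Rightarrow> bool" where
  "semisimple_lie_algebra br \<longleftrightarrow>
     lie_bracket br \<and> (\<exists>B :: 'g set. finite B \<and> complex_vector.span B = UNIV) \<and>
     (\<forall>I. lie_ideal br I \<and> lie_solvable br I \<longrightarrow> I = {0})"

definition cartan_subalgebra :: "('g::complex_vector \<Rightarrow> 'g \<Rightarrow> 'g) \<Rightarrow> 'g set \<Rightarrow> bool" where
  "cartan_subalgebra br H \<longleftrightarrow>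
     complex_vector.subspace H \<and> lie_nilpotent br H \<and> {x. \<forall>h\<in>H. br x h \<in> H} = H"

text \<open>Elements of the dual of the Cartan subalgebra \<open>H\<close> are functions of which only the values
  on \<open>H\<close> matter. A function with a nonzero root space is automatically linear on \<open>H\<close>.\<close>

definition root_space ::
  "('g::complex_vector \<Rightarrow> 'g \<Rightarrow> 'g) \<Rightarrow> 'g set \<Rightarrow> ('g \<Rightarrow> complex) \<Rightarrow> 'g set" where
  "root_space br H \<alpha> = {x. \<forall>h\<in>H. br h x = \<alpha> h *\<^sub>C x}"

definition lie_root ::
  "('g::complex_vector \<Rightarrow> 'g \<Rightarrow> 'g) \<Rightarrow> 'g set \<Rightarrow> ('g \<Rightarrow> complex) \<Rightarrow> bool" where
  "lie_root br H \<alpha> \<longleftrightarrow> (\<exists>h\<in>H. \<alpha> h \<noteq> 0) \<and> root_space br H \<alpha> \<noteq> {0}"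

definition simple_roots ::
  "('g::complex_vector \<Rightarrow> 'g \<Rightarrow> 'g) \<Rightarrow> 'g set \<Rightarrow> nat \<Rightarrow> (nat \<Rightarrow> 'g \<Rightarrow> complex) \<Rightarrow> bool" where
  "simple_roots br H l \<alpha> \<longleftrightarrow>
     (\<forall>i\<in>{1..l}. lie_root br H (\<alpha> i)) \<and>
     (\<forall>c :: nat \<Rightarrow> complex. (\<forall>h\<in>H. (\<Sum>i=1..l. c i * \<alpha> i h) = 0) \<longrightarrow> (\<forall>i\<in>{1..l}. c i = 0)) \<and>
     (\<forall>\<beta>. lie_root br H \<beta> \<longrightarrow>
        (\<exists>n :: nat \<Rightarrow> nat. (\<forall>h\<in>H. \<beta> h = (\<Sum>i=1..l. of_nat (n i) * \<alpha> i h)) \<or>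
                           (\<forall>h\<in>H. \<beta> h = - (\<Sum>i=1..l. of_nat (n i) * \<alpha> i h))))"

text \<open>The coroot of \<open>\<alpha>\<close> is the unique element \<open>h\<close> of \<open>[g\<^sub>\<alpha>, g\<^sub>-\<^sub>\<alpha>]\<close> with \<open>\<alpha>(h) = 2\<close>;
  as root spaces are lines, that space consists of brackets.\<close>

definition is_coroot ::
  "('g::complex_vector \<Rightarrow> 'g \<Rightarrow> 'g) \<Rightarrow> 'g set \<Rightarrow> ('g \<Rightarrow> complex) \<Rightarrow> 'g \<Rightarrow> bool" where
  "is_coroot br H \<alpha> h \<longleftrightarrow>
     h \<in> H \<and> \<alpha> h = 2 \<and>
     (\<exists>x\<in>root_space br H \<alpha>. \<exists>y\<in>root_space br H (\<lambda>t. - \<alpha> t). br x y = h)"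

definition cartan_matrix_of ::
  "('g::complex_vector \<Rightarrow> 'g \<Rightarrow> 'g) \<Rightarrow> nat \<Rightarrow> (nat \<Rightarrow> nat \<Rightarrow> int) \<Rightarrow> bool" where
  "cartan_matrix_of br l a \<longleftrightarrow>
     (\<exists>H \<alpha> \<alpha>'. cartan_subalgebra br H \<and> simple_roots br H l \<alpha> \<and>
        (\<forall>i\<in>{1..l}. is_coroot br H (\<alpha> i) (\<alpha>' i)) \<and>
        (\<forall>i\<in>{1..l}. \<forall>j\<in>{1..l}. of_int (a i j) = \<alpha> j (\<alpha>' i)))"


section \<open>The relations of the quantum affine algebra at level zero\<close>

definition qfact :: "complex \<Rightarrow> nat \<Rightarrow> complex" where
  "qfact q k = (\<Prod>j=1..k. (q ^ j - inverse q ^ j) / (q - inverse q))"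

definition qbinom :: "complex \<Rightarrow> nat \<Rightarrow> nat \<Rightarrow> complex" where
  "qbinom q m k = qfact q m / (qfact q k * qfact q (m - k))"

definition fps_alg_exp :: "'a::complex_algebra_1 fps \<Rightarrow> 'a fps" where
  \<comment> \<open>meant for zero constant term, where powers above the \<open>n\<close>-th do not contribute to coefficient \<open>n\<close>\<close>
  "fps_alg_exp S = Abs_fps (\<lambda>n. \<Sum>k\<le>n. (1 / fact k) *\<^sub>C fps_nth (S ^ k) n)"

text \<open>A formal series in \<open>z\<^sup>\<plusminus>\<^sup>1\<close> is the function taking \<open>n\<close> to the coefficient of \<open>z\<^sup>n\<close>, and a
  series in \<open>z\<^sup>\<plusminus>\<^sup>1, w\<^sup>\<plusminus>\<^sup>1\<close> the function taking \<open>n, k\<close> to the coefficient of \<open>z\<^sup>n w\<^sup>k\<close>. In the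
  following two definitions \<open>p\<close> stands for \<open>q\<^sub>i\<close>.\<close>

definition Kplus_series :: "complex \<Rightarrow> 'a::complex_algebra_1 \<Rightarrow> (int \<Rightarrow> 'a) \<Rightarrow> int \<Rightarrow> 'a" where
  "Kplus_series p K H n =
     (if n \<le> 0
      then fps_nth (fps_const K * fps_alg_exp (Abs_fps (\<lambda>r. if r = 0 then 0
             else (p - inverse p) *\<^sub>C H (int r)))) (nat (- n))
      else 0)"

definition Kminus_series :: "complex \<Rightarrow> 'a::complex_algebra_1 \<Rightarrow> (int \<Rightarrow> 'a) \<Rightarrow> int \<Rightarrow> 'a" where
  "Kminus_series p K' H n =
     (if n \<ge> 0
      then fps_nth (fps_const K' * fps_alg_exp (Abs_fps (\<lambda>r. if r = 0 then 0
             else (- (p - inverse p)) *\<^sub>C H (- int r)))) (nat n)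
      else 0)"

definition current :: "(int \<Rightarrow> 'a) \<Rightarrow> int \<Rightarrow> 'a" where
  \<comment> \<open>\<open>\<Sum>\<^sub>n X\<^sup>(\<^sup>n\<^sup>) z\<^sup>-\<^sup>n\<close>\<close>
  "current X n = X (- n)"

definition times_linear ::
  "complex \<Rightarrow> complex \<Rightarrow> (int \<Rightarrow> int \<Rightarrow> 'a::complex_algebra_1) \<Rightarrow> int \<Rightarrow> int \<Rightarrow> 'a" where
  \<comment> \<open>\<open>(b z + c w) X(z, w)\<close>\<close>
  "times_linear b c X n k = b *\<^sub>C X (n - 1) k + c *\<^sub>C X n (k - 1)"

definition exchange_relation ::
  "complex \<Rightarrow> (int \<Rightarrow> 'a::complex_algebra_1) \<Rightarrow> (int \<Rightarrow> 'a) \<Rightarrow> bool" where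
  \<comment> \<open>\<open>(z - A w) X(z) Y(w) = (A z - w) Y(w) X(z)\<close>\<close>
  "exchange_relation A X Y \<longleftrightarrow>
     times_linear 1 (- A) (\<lambda>n k. X n * Y k) = times_linear A (- 1) (\<lambda>n k. Y k * X n)"

definition serre_relation ::
  "complex \<Rightarrow> nat \<Rightarrow> (int \<Rightarrow> 'a::complex_algebra_1) \<Rightarrow> (int \<Rightarrow> 'a) \<Rightarrow> bool" where
  \<comment> \<open>\<open>e t\<close> is the exponent of \<open>z\<^sub>t\<close>, \<open>r\<close> that of \<open>w\<close>\<close>
  "serre_relation p m X Y \<longleftrightarrow>
     (\<forall>(e :: nat \<Rightarrow> int) (r :: int).
        (\<Sum>\<sigma> | \<sigma> permutes {1..m}. \<Sum>k=0..m. ((- 1) ^ k * qbinom p m k) *\<^sub>C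
           (prod_list (map (\<lambda>t. X (e (\<sigma> t))) [1..<k + 1]) * Y r *
            prod_list (map (\<lambda>t. X (e (\<sigma> t))) [k + 1..<m + 1]))) = 0)"

text \<open>Elements \<open>K i\<close>, \<open>K' i\<close> (for \<open>K\<^sub>i\<^sup>-\<^sup>1\<close>), \<open>H i n\<close>, \<open>E i n\<close>, \<open>F i n\<close> of an associative unital
  algebra satisfying the defining relations of the quantum affine algebra at level zero; \<open>H i 0\<close>
  does not occur. In the endomorphism algebra of a vector space \<open>V\<close> these are exactly the images
  of the generators under a representation in \<open>V\<close>.
  In the fourth relation, the coefficient of \<open>z\<^sup>n w\<^sup>k\<close> in \<open>\<delta>(z/w) f(w)\<close> and in \<open>\<delta>(z/w) f(z)\<close>
  is the coefficient of \<open>w\<^sup>n\<^sup>+\<^sup>k\<close> in \<open>f(w)\<close>.\<close>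

definition Uq_relations ::
  "nat \<Rightarrow> (nat \<Rightarrow> nat \<Rightarrow> int) \<Rightarrow> (nat \<Rightarrow> nat) \<Rightarrow> complex \<Rightarrow>
   (nat \<Rightarrow> 'a::complex_algebra_1) \<Rightarrow> (nat \<Rightarrow> 'a) \<Rightarrow> (nat \<Rightarrow> int \<Rightarrow> 'a) \<Rightarrow>
   (nat \<Rightarrow> int \<Rightarrow> 'a) \<Rightarrow> (nat \<Rightarrow> int \<Rightarrow> 'a) \<Rightarrow> bool" where
  "Uq_relations l a d q K K' H E F \<longleftrightarrow>
     (let qi = (\<lambda>i. q ^ d i);
          Kp = (\<lambda>i. Kplus_series (qi i) (K i) (H i));
          Km = (\<lambda>i. Kminus_series (qi i) (K' i) (H i));
          Ez = (\<lambda>i. current (E i));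
          Fz = (\<lambda>i. current (F i))
      in (\<forall>i\<in>{1..l}. K i * K' i = 1 \<and> K' i * K i = 1) \<and>
         (\<forall>i\<in>{1..l}. \<forall>j\<in>{1..l}.
            (\<forall>n k. Kp i n * Kp j k = Kp j k * Kp i n \<and>
                   Km i n * Km j k = Km j k * Km i n \<and>
                   Kp i n * Km j k = Km j k * Kp i n) \<and>
            exchange_relation (qi i powi a i j) (Kp i) (Ez j) \<and>
            exchange_relation (qi i powi a i j) (Km i) (Ez j) \<and>
            exchange_relation (qi i powi (- a i j)) (Kp i) (Fz j) \<and>
            exchange_relation (qi i powi (- a i j)) (Km i) (Fz j) \<and>
            (\<forall>n k. Ez i n * Fz j k - Fz j k * Ez i n =
               (if i = j then (1 / (qi i - inverse (qi i))) *\<^sub>C (Kp i (n + k) - Km i (n + k))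
                else 0)) \<and>
            exchange_relation (qi i powi a i j) (Ez i) (Ez j) \<and>
            exchange_relation (qi i powi (- a i j)) (Fz i) (Fz j) \<and>
            (i \<noteq> j \<longrightarrow> serre_relation (qi i) (nat (1 - a i j)) (Ez i) (Ez j) \<and>
                       serre_relation (qi i) (nat (1 - a i j)) (Fz i) (Fz j))))"


section \<open>Meromorphic functions of several complex variables\<close>

definition holomorphic_sev :: "(complex ^ 'v \<Rightarrow> complex) \<Rightarrow> (complex ^ 'v) set \<Rightarrow> bool" where
  "holomorphic_sev f S \<longleftrightarrow>
     (\<forall>x\<in>S. \<exists>D. (f has_derivative D) (at x) \<and> (\<forall>c y. D (c *s y) = c * D y))"

definition nonvanishing_sev :: "(complex ^ 'v \<Rightarrow> complex) \<Rightarrow> (complex ^ 'v) set \<Rightarrow> bool" where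
  \<comment> \<open>not identically zero on any nonempty open part\<close>
  "nonvanishing_sev h V \<longleftrightarrow> (\<forall>W. open W \<and> W \<noteq> {} \<and> W \<subseteq> V \<longrightarrow> (\<exists>x\<in>W. h x \<noteq> 0))"

text \<open>A meromorphic function is locally a quotient of holomorphic functions. It is represented by
  a total function with arbitrary values where the local denominators vanish, and two
  representatives are identified if they agree on a dense open set.\<close>

definition meromorphic_sev :: "(complex ^ 'v \<Rightarrow> complex) \<Rightarrow> bool" where
  "meromorphic_sev f \<longleftrightarrow>
     (\<forall>p. \<exists>V g h. open V \<and> p \<in> V \<and> holomorphic_sev g V \<and> holomorphic_sev h V \<and>
        nonvanishing_sev h V \<and> (\<forall>x\<in>V. h x \<noteq> 0 \<longrightarrow> f x = g x / h x))"

definition agree_densely :: "(complex ^ 'v \<Rightarrow> complex) \<Rightarrow> (complex ^ 'v \<Rightarrow> complex) \<Rightarrow> bool" where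
  "agree_densely f g \<longleftrightarrow> (\<exists>U. open U \<and> closure U = UNIV \<and> (\<forall>x\<in>U. f x = g x))"

definition mero_rel :: "(complex ^ 'v \<Rightarrow> complex) \<Rightarrow> (complex ^ 'v \<Rightarrow> complex) \<Rightarrow> bool" where
  "mero_rel f g \<longleftrightarrow> meromorphic_sev f \<and> meromorphic_sev g \<and> agree_densely f g"

lemma holomorphic_sev_const: "holomorphic_sev (\<lambda>x. c) S"
  unfolding holomorphic_sev_def
proof
  fix x :: "complex ^ 'a"
  show "\<exists>D. ((\<lambda>x. c) has_derivative D) (at x) \<and> (\<forall>c y. D (c *s y) = c * D y)"
    by (rule exI[of _ "\<lambda>_. 0"]) simp
qed

lemma holomorphic_sev_mono: "holomorphic_sev f S \<Longrightarrow> T \<subseteq> S \<Longrightarrow> holomorphic_sev f T"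
  by (auto simp: holomorphic_sev_def)

lemma holomorphic_sev_add:
  assumes "holomorphic_sev f S" "holomorphic_sev g S"
  shows "holomorphic_sev (\<lambda>x. f x + g x) S"
  unfolding holomorphic_sev_def
proof
  fix x assume "x \<in> S"
  then obtain D D' where "(f has_derivative D) (at x)" "\<forall>c y. D (c *s y) = c * D y"
    "(g has_derivative D') (at x)" "\<forall>c y. D' (c *s y) = c * D' y"
    using assms unfolding holomorphic_sev_def by metis
  then show "\<exists>D. ((\<lambda>x. f x + g x) has_derivative D) (at x) \<and> (\<forall>c y. D (c *s y) = c * D y)"
    by (intro exI[of _ "\<lambda>y. D y + D' y"] conjI has_derivative_add) (auto simp: algebra_simps)
qed

lemma holomorphic_sev_mult:
  assumes "holomorphic_sev f S" "holomorphic_sev g S"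
  shows "holomorphic_sev (\<lambda>x. f x * g x) S"
  unfolding holomorphic_sev_def
proof
  fix x assume "x \<in> S"
  then obtain D D' where "(f has_derivative D) (at x)" "\<forall>c y. D (c *s y) = c * D y"
    "(g has_derivative D') (at x)" "\<forall>c y. D' (c *s y) = c * D' y"
    using assms unfolding holomorphic_sev_def by metis
  then show "\<exists>D. ((\<lambda>x. f x * g x) has_derivative D) (at x) \<and> (\<forall>c y. D (c *s y) = c * D y)"
    by (intro exI[of _ "\<lambda>y. f x * D' y + D y * g x"] conjI has_derivative_mult)
       (auto simp: algebra_simps)
qed

lemma holomorphic_sev_continuous: "holomorphic_sev f S \<Longrightarrow> continuous_on S f"
  unfolding holomorphic_sev_def
  by (meson continuous_at_imp_continuous_on has_derivative_continuous)

lemma nonvanishing_sev_mult: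
  assumes "holomorphic_sev h V" "nonvanishing_sev h V" "nonvanishing_sev k V"
  shows "nonvanishing_sev (\<lambda>x. h x * k x) V"
  unfolding nonvanishing_sev_def
proof (intro allI impI)
  fix W assume W: "open W \<and> W \<noteq> {} \<and> W \<subseteq> V"
  define W' where "W' = W \<inter> h -` (- {0})"
  have "continuous_on W h"
    using W assms(1) holomorphic_sev_continuous holomorphic_sev_mono by blast
  then have "open W'"
    unfolding W'_def using W by (intro continuous_open_preimage) auto
  moreover have "W' \<noteq> {}"
    using W assms(2) unfolding nonvanishing_sev_def W'_def by fastforce
  ultimately obtain x where "x \<in> W'" "k x \<noteq> 0"
    using W assms(3) unfolding nonvanishing_sev_def W'_def by blast
  then show "\<exists>x\<in>W. h x * k x \<noteq> 0"
    unfolding W'_def by auto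
qed

lemma nonvanishing_sev_mono: "nonvanishing_sev h S \<Longrightarrow> T \<subseteq> S \<Longrightarrow> nonvanishing_sev h T"
  unfolding nonvanishing_sev_def by blast

lemma meromorphic_sev_const: "meromorphic_sev (\<lambda>x. c)"
  unfolding meromorphic_sev_def
proof
  fix p :: "complex ^ 'a"
  show "\<exists>V g h. open V \<and> p \<in> V \<and> holomorphic_sev g V \<and> holomorphic_sev h V \<and>
        nonvanishing_sev h V \<and> (\<forall>x\<in>V. h x \<noteq> 0 \<longrightarrow> c = g x / h x)"
    by (rule exI[of _ UNIV], rule exI[of _ "\<lambda>x. c"], rule exI[of _ "\<lambda>x. 1"])
       (auto simp: holomorphic_sev_const nonvanishing_sev_def)
qed

lemma meromorphic_sev_local2:
  assumes "meromorphic_sev f" "meromorphic_sev f'"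
  obtains V g h g' h' where "open V" "p \<in> V" "holomorphic_sev g V" "holomorphic_sev h V"
    "holomorphic_sev g' V" "holomorphic_sev h' V" "nonvanishing_sev h V" "nonvanishing_sev h' V"
    "\<And>x. x \<in> V \<Longrightarrow> h x \<noteq> 0 \<Longrightarrow> f x = g x / h x"
    "\<And>x. x \<in> V \<Longrightarrow> h' x \<noteq> 0 \<Longrightarrow> f' x = g' x / h' x"
proof -
  obtain V g h where 1: "open V" "p \<in> V" "holomorphic_sev g V" "holomorphic_sev h V"
    "nonvanishing_sev h V" "\<forall>x\<in>V. h x \<noteq> 0 \<longrightarrow> f x = g x / h x"
    using assms(1) unfolding meromorphic_sev_def by metis
  obtain V' g' h' where 2: "open V'" "p \<in> V'" "holomorphic_sev g' V'" "holomorphic_sev h' V'"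
    "nonvanishing_sev h' V'" "\<forall>x\<in>V'. h' x \<noteq> 0 \<longrightarrow> f' x = g' x / h' x"
    using assms(2) unfolding meromorphic_sev_def by metis
  show ?thesis
    by (rule that[of "V \<inter> V'" g h g' h'])
       (use 1 2 in \<open>auto intro: holomorphic_sev_mono nonvanishing_sev_mono\<close>)
qed

lemma meromorphic_sev_mult:
  assumes "meromorphic_sev f" "meromorphic_sev f'"
  shows "meromorphic_sev (\<lambda>x. f x * f' x)"
  unfolding meromorphic_sev_def
proof
  fix p
  obtain V g h g' h' where *: "open V" "p \<in> V" "holomorphic_sev g V" "holomorphic_sev h V"
    "holomorphic_sev g' V" "holomorphic_sev h' V" "nonvanishing_sev h V" "nonvanishing_sev h' V"
    "\<And>x. x \<in> V \<Longrightarrow> h x \<noteq> 0 \<Longrightarrow> f x = g x / h x"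
    "\<And>x. x \<in> V \<Longrightarrow> h' x \<noteq> 0 \<Longrightarrow> f' x = g' x / h' x"
    using meromorphic_sev_local2[OF assms, of p] by metis
  show "\<exists>V g h. open V \<and> p \<in> V \<and> holomorphic_sev g V \<and> holomorphic_sev h V \<and>
        nonvanishing_sev h V \<and> (\<forall>x\<in>V. h x \<noteq> 0 \<longrightarrow> f x * f' x = g x / h x)"
    by (rule exI[of _ V], rule exI[of _ "\<lambda>x. g x * g' x"], rule exI[of _ "\<lambda>x. h x * h' x"])
       (use * in \<open>auto intro: holomorphic_sev_mult nonvanishing_sev_mult\<close>)
qed

lemma meromorphic_sev_add:
  assumes "meromorphic_sev f" "meromorphic_sev f'"
  shows "meromorphic_sev (\<lambda>x. f x + f' x)"
  unfolding meromorphic_sev_def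
proof
  fix p
  obtain V g h g' h' where *: "open V" "p \<in> V" "holomorphic_sev g V" "holomorphic_sev h V"
    "holomorphic_sev g' V" "holomorphic_sev h' V" "nonvanishing_sev h V" "nonvanishing_sev h' V"
    "\<And>x. x \<in> V \<Longrightarrow> h x \<noteq> 0 \<Longrightarrow> f x = g x / h x"
    "\<And>x. x \<in> V \<Longrightarrow> h' x \<noteq> 0 \<Longrightarrow> f' x = g' x / h' x"
    using meromorphic_sev_local2[OF assms, of p] by metis
  show "\<exists>V g h. open V \<and> p \<in> V \<and> holomorphic_sev g V \<and> holomorphic_sev h V \<and>
        nonvanishing_sev h V \<and> (\<forall>x\<in>V. h x \<noteq> 0 \<longrightarrow> f x + f' x = g x / h x)"
    by (rule exI[of _ V], rule exI[of _ "\<lambda>x. g x * h' x + g' x * h x"],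
        rule exI[of _ "\<lambda>x. h x * h' x"])
       (use * in \<open>auto intro: holomorphic_sev_mult holomorphic_sev_add nonvanishing_sev_mult
          simp: add_frac_eq\<close>)
qed

lemma meromorphic_sev_uminus: "meromorphic_sev f \<Longrightarrow> meromorphic_sev (\<lambda>x. - f x)"
  using meromorphic_sev_mult[OF meromorphic_sev_const[of "-1"], of f] by simp

lemma holomorphic_sev_shift:
  assumes "holomorphic_sev f S"
  shows "holomorphic_sev (\<lambda>x. f (x + b)) ((\<lambda>x. x + b) -` S)"
  unfolding holomorphic_sev_def
proof
  fix x assume "x \<in> (\<lambda>x. x + b) -` S"
  then obtain D where D: "(f has_derivative D) (at (x + b))" "\<forall>c y. D (c *s y) = c * D y"
    using assms unfolding holomorphic_sev_def by auto
  have "((\<lambda>x. x + b) has_derivative (\<lambda>y. y)) (at x)"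
    by (auto intro!: derivative_eq_intros)
  from has_derivative_compose[OF this D(1)] D(2)
  show "\<exists>D. ((\<lambda>x. f (x + b)) has_derivative D) (at x) \<and> (\<forall>c y. D (c *s y) = c * D y)"
    by auto
qed

lemma open_vimage_shift: "open S \<Longrightarrow> open ((\<lambda>x. x + b) -` S)" for b :: "'a::real_normed_vector"
  by (intro open_vimage continuous_intros)

lemma image_shift_eq: "(\<lambda>x. x + b) ` S = (\<lambda>x. x + (- b)) -` S" for b :: "'a::real_normed_vector"
  by (force simp: image_iff algebra_simps)

lemma nonvanishing_sev_shift:
  assumes "nonvanishing_sev h V"
  shows "nonvanishing_sev (\<lambda>x. h (x + b)) ((\<lambda>x. x + b) -` V)"
  unfolding nonvanishing_sev_def
proof (intro allI impI)
  fix W assume W: "open W \<and> W \<noteq> {} \<and> W \<subseteq> (\<lambda>x. x + b) -` V"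
  then have "open ((\<lambda>x. x + b) ` W)"
    unfolding image_shift_eq by (intro open_vimage_shift) auto
  then show "\<exists>x\<in>W. h (x + b) \<noteq> 0"
    using assms W unfolding nonvanishing_sev_def
    by (metis (no_types, lifting) image_iff image_is_empty image_subset_iff_subset_vimage)
qed

lemma meromorphic_sev_shift:
  assumes "meromorphic_sev f"
  shows "meromorphic_sev (\<lambda>x. f (x + b))"
  unfolding meromorphic_sev_def
proof
  fix p
  obtain V g h where *: "open V" "p + b \<in> V" "holomorphic_sev g V" "holomorphic_sev h V"
    "nonvanishing_sev h V" "\<forall>x\<in>V. h x \<noteq> 0 \<longrightarrow> f x = g x / h x"
    using assms unfolding meromorphic_sev_def by metis
  show "\<exists>V g h. open V \<and> p \<in> V \<and> holomorphic_sev g V \<and> holomorphic_sev h V \<and>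
        nonvanishing_sev h V \<and> (\<forall>x\<in>V. h x \<noteq> 0 \<longrightarrow> f (x + b) = g x / h x)"
    by (rule exI[of _ "(\<lambda>x. x + b) -` V"], rule exI[of _ "\<lambda>x. g (x + b)"],
        rule exI[of _ "\<lambda>x. h (x + b)"])
       (use * in \<open>auto intro: holomorphic_sev_shift nonvanishing_sev_shift open_vimage_shift\<close>)
qed

lemma agree_densely_refl: "agree_densely f f"
  unfolding agree_densely_def by (rule exI[of _ UNIV]) simp

lemma agree_densely_combine:
  assumes "agree_densely f g" "agree_densely f' g'"
    and "\<And>x. f x = g x \<Longrightarrow> f' x = g' x \<Longrightarrow> k x = k' x"
  shows "agree_densely k k'"
proof -
  obtain U V where U: "open U" "closure U = UNIV" "\<forall>x\<in>U. f x = g x"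
    and V: "open V" "closure V = UNIV" "\<forall>x\<in>V. f' x = g' x"
    using assms unfolding agree_densely_def by metis
  have "U \<subseteq> closure (U \<inter> V)"
    using open_Int_closure_subset[OF U(1), of V] V(2) by simp
  then have "closure (U \<inter> V) = UNIV"
    using U(2) closure_minimal[of U "closure (U \<inter> V)"] by auto
  then show ?thesis
    using U V assms(3) unfolding agree_densely_def by (intro exI[of _ "U \<inter> V"]) auto
qed

lemma agree_densely_trans: "agree_densely f g \<Longrightarrow> agree_densely g h \<Longrightarrow> agree_densely f h"
  by (erule (1) agree_densely_combine) simp

lemma agree_densely_add:
  "agree_densely f g \<Longrightarrow> agree_densely f' g' \<Longrightarrow> agree_densely (\<lambda>x. f x + f' x) (\<lambda>x. g x + g' x)"
  by (erule (1) agree_densely_combine) simp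

lemma agree_densely_mult:
  "agree_densely f g \<Longrightarrow> agree_densely f' g' \<Longrightarrow> agree_densely (\<lambda>x. f x * f' x) (\<lambda>x. g x * g' x)"
  by (erule (1) agree_densely_combine) simp

lemma agree_densely_uminus: "agree_densely f g \<Longrightarrow> agree_densely (\<lambda>x. - f x) (\<lambda>x. - g x)"
  unfolding agree_densely_def by metis

lemma agree_densely_shift:
  assumes "agree_densely f g"
  shows "agree_densely (\<lambda>x. f (x + b)) (\<lambda>x. g (x + b))"
proof -
  obtain U where U: "open U" "closure U = UNIV" "\<forall>x\<in>U. f x = g x"
    using assms unfolding agree_densely_def by metis
  have "(\<lambda>x. x + b) -` U = (\<lambda>x. x + (- b)) ` U"
    unfolding image_shift_eq by simp
  also have "\<dots> = (+) (- b) ` U"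
    by (simp add: add.commute)
  finally have "closure ((\<lambda>x. x + b) -` U) = UNIV"
    using U(2) closure_translation[of "- b" U] by (simp add: surj_plus)
  then show ?thesis
    using U unfolding agree_densely_def
    by (intro exI[of _ "(\<lambda>x. x + b) -` U"]) (auto intro: open_vimage_shift)
qed

quotient_type (overloaded) 'v mero = "complex ^ 'v \<Rightarrow> complex" / partial: mero_rel
  morphisms rep_mero mero_of
proof (rule part_equivpI)
  show "\<exists>x. mero_rel x x"
    by (rule exI[of _ "\<lambda>x. 0"]) (simp add: mero_rel_def meromorphic_sev_const agree_densely_refl)
  show "symp mero_rel"
    by (rule sympI) (force simp: mero_rel_def agree_densely_def)
  show "transp mero_rel"
    by (rule transpI) (auto simp: mero_rel_def intro: agree_densely_trans)
qed

instantiation mero :: (finite) comm_ring_1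
begin

lift_definition zero_mero :: "'a mero" is "\<lambda>x. 0"
  by (simp add: mero_rel_def meromorphic_sev_const agree_densely_refl)
lift_definition one_mero :: "'a mero" is "\<lambda>x. 1"
  by (simp add: mero_rel_def meromorphic_sev_const agree_densely_refl)
lift_definition plus_mero :: "'a mero \<Rightarrow> 'a mero \<Rightarrow> 'a mero" is "\<lambda>f g x. f x + g x"
  by (auto simp: mero_rel_def intro: meromorphic_sev_add agree_densely_add)
lift_definition times_mero :: "'a mero \<Rightarrow> 'a mero \<Rightarrow> 'a mero" is "\<lambda>f g x. f x * g x"
  by (auto simp: mero_rel_def intro: meromorphic_sev_mult agree_densely_mult)
lift_definition uminus_mero :: "'a mero \<Rightarrow> 'a mero" is "\<lambda>f x. - f x"
  by (auto simp: mero_rel_def meromorphic_sev_uminus agree_densely_uminus)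
definition minus_mero :: "'a mero \<Rightarrow> 'a mero \<Rightarrow> 'a mero" where "minus_mero f g = f + - g"

lemma mero_rel_of_eq: "mero_rel f f \<Longrightarrow> f = g \<Longrightarrow> mero_rel f g"
  by simp

instance
proof
  fix f g h :: "'a mero"
  show "f + g + h = f + (g + h)"
    by transfer (rule mero_rel_of_eq; auto simp: mero_rel_def agree_densely_refl
      meromorphic_sev_add algebra_simps)
  show "f + g = g + f"
    by transfer (rule mero_rel_of_eq; auto simp: mero_rel_def agree_densely_refl
      meromorphic_sev_add algebra_simps)
  show "0 + f = f"
    by transfer (rule mero_rel_of_eq; auto simp: mero_rel_def agree_densely_refl)
  show "- f + f = 0"
    by transfer (rule mero_rel_of_eq; auto simp: mero_rel_def agree_densely_refl
      meromorphic_sev_const)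
  show "f - g = f + - g" by (rule minus_mero_def)
  show "f * g * h = f * (g * h)"
    by transfer (rule mero_rel_of_eq; auto simp: mero_rel_def agree_densely_refl
      meromorphic_sev_mult algebra_simps)
  show "f * g = g * f"
    by transfer (rule mero_rel_of_eq; auto simp: mero_rel_def agree_densely_refl
      meromorphic_sev_mult algebra_simps)
  show "1 * f = f"
    by transfer (rule mero_rel_of_eq; auto simp: mero_rel_def agree_densely_refl)
  show "(f + g) * h = f * h + g * h"
    by transfer (rule mero_rel_of_eq; auto simp: mero_rel_def agree_densely_refl
      meromorphic_sev_mult meromorphic_sev_add algebra_simps)
  show "(0 :: 'a mero) \<noteq> 1"
    by transfer (auto simp: mero_rel_def agree_densely_def)
qed

end

lift_definition const_mero :: "complex \<Rightarrow> 'v::finite mero" is "\<lambda>c x. c"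
  by (simp add: mero_rel_def meromorphic_sev_const agree_densely_refl)

instantiation mero :: (finite) complex_vector
begin

definition scaleC_mero :: "complex \<Rightarrow> 'a mero \<Rightarrow> 'a mero" where
  "scaleC_mero c f = const_mero c * f"

instance
proof
  fix f g :: "'a mero" and c d :: complex
  have add: "const_mero (c + d) = (const_mero c + const_mero d :: 'a mero)"
    by transfer (simp add: mero_rel_def meromorphic_sev_const agree_densely_refl)
  have mult: "const_mero (c * d) = (const_mero c * const_mero d :: 'a mero)"
    by transfer (simp add: mero_rel_def meromorphic_sev_const agree_densely_refl)
  have one: "const_mero 1 = (1 :: 'a mero)"
    by transfer (simp add: mero_rel_def meromorphic_sev_const agree_densely_refl)
  show "c *\<^sub>C (f + g) = c *\<^sub>C f + c *\<^sub>C g"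
    by (simp add: scaleC_mero_def algebra_simps)
  show "(c + d) *\<^sub>C f = c *\<^sub>C f + d *\<^sub>C f"
    by (simp add: scaleC_mero_def add algebra_simps)
  show "c *\<^sub>C d *\<^sub>C f = (c * d) *\<^sub>C f"
    by (simp add: scaleC_mero_def mult algebra_simps)
  show "1 *\<^sub>C f = f"
    by (simp add: scaleC_mero_def one)
qed

end

lift_definition mero_shift :: "complex ^ 'v::finite \<Rightarrow> 'v mero \<Rightarrow> 'v mero" is "\<lambda>b f x. f (x + b)"
  by (auto simp: mero_rel_def meromorphic_sev_shift agree_densely_shift)

lemma mero_shift_add: "mero_shift b (f + g) = mero_shift b f + mero_shift b g"
  by transfer (auto simp: mero_rel_def agree_densely_refl
    intro!: meromorphic_sev_add meromorphic_sev_shift)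

lemma mero_shift_scaleC: "mero_shift b (c *\<^sub>C f) = c *\<^sub>C mero_shift b f"
  unfolding scaleC_mero_def
  by transfer (auto simp: mero_rel_def agree_densely_refl
    intro!: meromorphic_sev_mult meromorphic_sev_const meromorphic_sev_shift)

text \<open>\<open>mero_of \<phi>\<close> is the class of \<open>\<phi>\<close>, and is meaningful only if \<open>meromorphic_sev \<phi>\<close>.\<close>

definition mult_op :: "(complex ^ 'v \<Rightarrow> complex) \<Rightarrow> 'v mero endo" where
  "mult_op \<phi> = Endo (\<lambda>f. mero_of \<phi> * f)"

definition shift_op :: "complex ^ 'v \<Rightarrow> 'v mero endo" where
  "shift_op b = Endo (mero_shift b)"

lemma endo_apply_mult_op: "endo_apply (mult_op \<phi>) f = mero_of \<phi> * f"
  unfolding mult_op_def by (subst Endo_inverse) (simp_all add: scaleC_mero_def algebra_simps)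

lemma endo_apply_shift_op: "endo_apply (shift_op b) f = mero_shift b f"
  unfolding shift_op_def
  by (subst Endo_inverse) (simp_all add: mero_shift_add mero_shift_scaleC)


section \<open>The operators\<close>

text \<open>Points of \<open>complex ^ 'v\<close> are the values of all the variables, \<open>\<gamma>\<^sub>i\<^sub>,\<^sub>k\<close> being the coordinate
  \<open>x i k :: 'v\<close>.\<close>

definition q_par :: "complex \<Rightarrow> complex \<Rightarrow> complex" where
  "q_par \<omega>1 \<omega>2 = exp (2 * of_real pi * \<i> * \<omega>1 / \<omega>2)"

definition q_half :: "complex \<Rightarrow> complex \<Rightarrow> complex" where
  "q_half \<omega>1 \<omega>2 = exp (of_real pi * \<i> * \<omega>1 / \<omega>2)"

definition q_node :: "(nat \<Rightarrow> nat) \<Rightarrow> complex \<Rightarrow> complex \<Rightarrow> nat \<Rightarrow> complex" where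
  "q_node d \<omega>1 \<omega>2 i = q_par \<omega>1 \<omega>2 ^ d i"

definition l_coeff :: "nat \<Rightarrow> (nat \<Rightarrow> nat \<Rightarrow> int) \<Rightarrow> (nat \<Rightarrow> nat) \<Rightarrow> nat \<Rightarrow> int" where
  "l_coeff l a m i = (\<Sum>j=1..l. int (m j) * a j i)"

definition c_coeff :: "nat \<Rightarrow> (nat \<Rightarrow> nat \<Rightarrow> int) \<Rightarrow> (nat \<Rightarrow> nat) \<Rightarrow> (nat \<Rightarrow> nat) \<Rightarrow>
    complex \<Rightarrow> complex \<Rightarrow> nat \<Rightarrow> complex" where
  "c_coeff l a d m \<omega>1 \<omega>2 i = (\<Prod>j=1..l. q_half \<omega>1 \<omega>2 powi (int (d j) * int (m j) * a j i))"

definition w_par :: "complex \<Rightarrow> (nat \<Rightarrow> nat \<Rightarrow> complex) \<Rightarrow> nat \<Rightarrow> nat \<Rightarrow> complex" where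
  "w_par \<omega>2 \<nu> i s = exp (2 * of_real pi * \<nu> i s / \<omega>2)"

definition v_fun :: "(nat \<Rightarrow> nat \<Rightarrow> 'v::finite) \<Rightarrow> complex \<Rightarrow> complex ^ 'v \<Rightarrow> nat \<Rightarrow> nat \<Rightarrow> complex" where
  "v_fun x \<omega>2 \<gamma> i k = exp (2 * of_real pi * vec_nth \<gamma> (x i k) / \<omega>2)"

definition u_op :: "(nat \<Rightarrow> nat) \<Rightarrow> (nat \<Rightarrow> nat \<Rightarrow> 'v::finite) \<Rightarrow> complex \<Rightarrow> nat \<Rightarrow> nat \<Rightarrow> 'v mero endo" where
  "u_op d x \<omega>1 i k = shift_op (axis (x i k) (\<i> * \<omega>1 * of_nat (d i)))"

definition u_inv_op :: "(nat \<Rightarrow> nat) \<Rightarrow> (nat \<Rightarrow> nat \<Rightarrow> 'v::finite) \<Rightarrow> complex \<Rightarrow> nat \<Rightarrow> nat \<Rightarrow> 'v mero endo" where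
  "u_inv_op d x \<omega>1 i k = shift_op (axis (x i k) (- (\<i> * \<omega>1 * of_nat (d i))))"

text \<open>The rational function \<open>K\<^sub>i(z)\<close> at a point \<open>\<gamma>\<close>, evaluated at an element \<open>z\<close> of the field of
  formal Laurent series. Taking for \<open>z\<close> the series variable gives the expansion in powers of
  \<open>z\<close>; taking the inverse of the series variable gives the expansion in powers of \<open>z\<^sup>-\<^sup>1\<close>.\<close>

definition K_rational ::
  "nat \<Rightarrow> (nat \<Rightarrow> nat \<Rightarrow> int) \<Rightarrow> (nat \<Rightarrow> nat) \<Rightarrow> (nat \<Rightarrow> nat) \<Rightarrow> (nat \<Rightarrow> nat \<Rightarrow> 'v::finite) \<Rightarrow>
   (nat \<Rightarrow> nat \<Rightarrow> complex) \<Rightarrow> complex \<Rightarrow> complex \<Rightarrow> nat \<Rightarrow> complex fls \<Rightarrow> complex ^ 'v \<Rightarrow> complex fls" where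
  "K_rational l a d m x \<nu> \<omega>1 \<omega>2 i z \<gamma> =
     (let v = v_fun x \<omega>2 \<gamma>; w = w_par \<omega>2 \<nu>; qi = q_node d \<omega>1 \<omega>2 in
      fls_const (c_coeff l a d m \<omega>1 \<omega>2 i * (\<Prod>j=1..l. \<Prod>p=1..m j. v j p powi a j i)) *
      (\<Prod>s=1..nat (l_coeff l a m i). z * fls_const (inverse (w i s)) - fls_const (w i s)) *
      ((\<Prod>j\<in>{1..l} - {i}. \<Prod>r=1..nat (- a j i). \<Prod>p=1..m j.
          z - fls_const (qi j powi (a j i + 2 * int r) * v j p ^ 2)) /
       (\<Prod>p=1..m i. (z - fls_const (v i p ^ 2)) * (z - fls_const (qi i ^ 2 * v i p ^ 2)))))"

definition K_plus_op ::
  "nat \<Rightarrow> (nat \<Rightarrow> nat \<Rightarrow> int) \<Rightarrow> (nat \<Rightarrow> nat) \<Rightarrow> (nat \<Rightarrow> nat) \<Rightarrow> (nat \<Rightarrow> nat \<Rightarrow> 'v::finite) \<Rightarrow>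
   (nat \<Rightarrow> nat \<Rightarrow> complex) \<Rightarrow> complex \<Rightarrow> complex \<Rightarrow> nat \<Rightarrow> int \<Rightarrow> 'v mero endo" where
  "K_plus_op l a d m x \<nu> \<omega>1 \<omega>2 i n =
     mult_op (\<lambda>\<gamma>. fls_nth (K_rational l a d m x \<nu> \<omega>1 \<omega>2 i fls_X_inv \<gamma>) (- n))"

definition K_minus_op ::
  "nat \<Rightarrow> (nat \<Rightarrow> nat \<Rightarrow> int) \<Rightarrow> (nat \<Rightarrow> nat) \<Rightarrow> (nat \<Rightarrow> nat) \<Rightarrow> (nat \<Rightarrow> nat \<Rightarrow> 'v::finite) \<Rightarrow>
   (nat \<Rightarrow> nat \<Rightarrow> complex) \<Rightarrow> complex \<Rightarrow> complex \<Rightarrow> nat \<Rightarrow> int \<Rightarrow> 'v mero endo" where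
  "K_minus_op l a d m x \<nu> \<omega>1 \<omega>2 i n =
     mult_op (\<lambda>\<gamma>. fls_nth (K_rational l a d m x \<nu> \<omega>1 \<omega>2 i fls_X \<gamma>) n)"

text \<open>The operators \<open>E\<^sub>i\<^sup>(\<^sup>n\<^sup>)\<close> and \<open>F\<^sub>i\<^sup>(\<^sup>n\<^sup>)\<close> are the coefficients of \<open>z\<^sup>-\<^sup>n\<close> in \<open>E\<^sub>i(z)\<close> and \<open>F\<^sub>i(z)\<close>; the
  coefficient of \<open>z\<^sup>-\<^sup>n\<close> in \<open>\<delta>(z/y)\<close> is \<open>y\<^sup>n\<close>.\<close>

definition delta_coeff :: "complex \<Rightarrow> int \<Rightarrow> complex" where
  "delta_coeff y n = y powi n"

definition E_op ::
  "nat \<Rightarrow> (nat \<Rightarrow> nat \<Rightarrow> int) \<Rightarrow> (nat \<Rightarrow> nat) \<Rightarrow> (nat \<Rightarrow> nat) \<Rightarrow> (nat \<Rightarrow> nat \<Rightarrow> 'v::finite) \<Rightarrow>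
   complex \<Rightarrow> complex \<Rightarrow> (nat \<Rightarrow> complex poly) \<Rightarrow> nat \<Rightarrow> int \<Rightarrow> 'v mero endo" where
  "E_op l a d m x \<omega>1 \<omega>2 Rp i n =
     (let qi = q_node d \<omega>1 \<omega>2 in
      \<Sum>k=1..m i. mult_op (\<lambda>\<gamma>. let v = v_fun x \<omega>2 \<gamma> in
          c_coeff l a d m \<omega>1 \<omega>2 i / (qi i - inverse (qi i)) *
          (\<Prod>p=1..m i. v i p) * (\<Prod>j=i+1..l. \<Prod>p=1..m j. v j p powi a j i) *
          delta_coeff (v i k ^ 2) n * v i k powi (- 2) * poly (Rp i) (v i k ^ 2) *
          (\<Prod>j=i+1..l. \<Prod>r=1..nat (- a j i). \<Prod>p=1..m j.
             v i k ^ 2 - qi j powi (a j i + 2 * int r) * v j p ^ 2) /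
          (\<Prod>p\<in>{1..m i} - {k}. v i k ^ 2 - v i p ^ 2)) * u_inv_op d x \<omega>1 i k)"

definition F_op ::
  "(nat \<Rightarrow> nat \<Rightarrow> int) \<Rightarrow> (nat \<Rightarrow> nat) \<Rightarrow> (nat \<Rightarrow> nat) \<Rightarrow> (nat \<Rightarrow> nat \<Rightarrow> 'v::finite) \<Rightarrow>
   complex \<Rightarrow> complex \<Rightarrow> (nat \<Rightarrow> complex poly) \<Rightarrow> nat \<Rightarrow> int \<Rightarrow> 'v mero endo" where
  "F_op a d m x \<omega>1 \<omega>2 Rm i n =
     (let qi = q_node d \<omega>1 \<omega>2 in
      \<Sum>k=1..m i. mult_op (\<lambda>\<gamma>. let v = v_fun x \<omega>2 \<gamma> in
          - (qi i powi (- 2 * int (m i)) / (qi i - inverse (qi i))) *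
          (\<Prod>p=1..m i. v i p) * (\<Prod>j=1..<i. \<Prod>p=1..m j. v j p powi a j i) *
          delta_coeff (qi i ^ 2 * v i k ^ 2) n * v i k powi (- 2) *
          poly (Rm i) (qi i ^ 2 * v i k ^ 2) *
          (\<Prod>j=1..<i. \<Prod>r=1..nat (- a j i). \<Prod>p=1..m j.
             qi i ^ 2 * v i k ^ 2 - qi j powi (a j i + 2 * int r) * v j p ^ 2) /
          (\<Prod>p\<in>{1..m i} - {k}. v i k ^ 2 - v i p ^ 2)) * u_op d x \<omega>1 i k)"

end

theory Submission
  imports Defs "HOL-Combinatorics.Permutations"
begin

text \<open>
  All coefficients of the currents are finite sums of multiplications by meromorphic functions
  composed with shifts, so each relation is an identity between coefficient functions, to be checked
  at generic points. Of the Cartan matrix only \<open>a i i = 2\<close> and \<open>a i j \<in> - \<nat>\<close> for \<open>i \<noteq> j\<close> matter, and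
  the second property comes from \<open>sl\<^sub>2\<close>-theory. In the quadratic relations the linear factors cancel
  those produced by the shifts. For \<open>[E\<^sub>i(z), F\<^sub>i(w)]\<close> the terms with different shifts cancel and the
  rest is the partial fraction decomposition of \<open>K\<^sub>i(z)\<close>: its expansions at infinity and at zero
  differ by delta functions at the poles. The \<open>H\<^sub>i\<close> are found by taking logarithms coefficientwise.

  For the Serre relations, write \<open>v\<close> for a single term of \<open>E\<^sub>j(w)\<close>, supported at \<open>y\<close>. Dividing the
  coefficients of \<open>E\<^sub>i(z)\<close> by \<open>Q x\<^sub>k - y\<close> makes \<open>E\<^sub>i(z)\<close> to the left and to the right of \<open>v\<close> into
  two affine expressions in the same two operators. After symmetrisation over the \<open>z\<^sub>i\<close> these
  operators \<open>q\<^sup>2\<close>-commute, so all words sort into multiples of the words indexed by the number of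
  factors of one kind, and the coefficient of each is a telescoping \<open>q\<close>-binomial sum.
\<close>

section \<open>Cartan matrices of semisimple Lie algebras\<close>

text \<open>Equality of coefficient functions matters only on a dense open set, so one may divide by
  differences of squares of the \<open>v\<close> and by \<open>Q x_k - y\<close>. That divisor is
  dictated by the exchange with \<open>v\<close>: passing \<open>v\<close> multiplies the
  \<open>k\<close>-th coefficient by \<open>(x_k - Q y) / (Q x_k - y)\<close>. Putting
  \<open>x_k / (Q x_k - y)\<close> into \<open>Y1\<close> and \<open>y / (Q x_k - y)\<close> into
  \<open>Y0\<close> makes a factor on the left \<open>Q Y1 - Y0\<close> and one on the right
  \<open>Y1 - Q Y0\<close>. A direct expansion would have to treat words with repeated shifts
  separately; here they cause no exception, since for equal indices both sides of the commutation
  rule of \<open>Y1\<close> and \<open>Y0\<close> vanish. Sorting gives a word the weight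
  \<open>p^(-2t)\<close> for each position \<open>t\<close> of \<open>Y1\<close>. With a variable
  counting these positions, the weighted sum over words factors into linear terms, and these
  products are what the alternating q-binomial sum combines to zero. Comparing powers of the
  counting variable then separates the words by the number of factors \<open>Y1\<close>.\<close>

lemma lie_bracket_simps:
  assumes "lie_bracket br"
  shows "br (x + y) z = br x z + br y z" "br x (y + z) = br x y + br x z"
    "br (c *\<^sub>C x) y = c *\<^sub>C br x y" "br x (c *\<^sub>C y) = c *\<^sub>C br x y"
  using assms by (auto simp: lie_bracket_def)

lemma lie_bracket_zero:
  assumes "lie_bracket br"
  shows "br 0 x = 0" "br x 0 = 0"
  using lie_bracket_simps(1)[OF assms, of 0 0 x] lie_bracket_simps(2)[OF assms, of x 0 0] by simp_all

lemma lie_bracket_uminus: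
  assumes "lie_bracket br"
  shows "br (- x) y = - br x y" "br x (- y) = - br x y"
  using lie_bracket_simps(3)[OF assms, of "-1" x y] lie_bracket_simps(4)[OF assms, of x "-1" y]
  by simp_all

lemma lie_bracket_skew:
  assumes "lie_bracket br"
  shows "br x y = - br y x"
proof -
  have "br (x + y) (x + y) = 0" "br x x = 0" "br y y = 0"
    using assms by (auto simp: lie_bracket_def)
  then have "br x y + br y x = 0"
    by (simp add: lie_bracket_simps[OF assms] add.commute)
  then show ?thesis by (simp add: eq_neg_iff_add_eq_0)
qed

lemma lie_bracket_derivation:
  assumes "lie_bracket br"
  shows "br x (br y z) = br (br x y) z + br y (br x z)"
proof -
  have "br x (br y z) + br y (br z x) + br z (br x y) = 0"
    using assms by (auto simp: lie_bracket_def)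
  moreover have "br y (br z x) = - br y (br x z)"
    using lie_bracket_skew[OF assms, of z x] lie_bracket_uminus[OF assms] by simp
  moreover have "br z (br x y) = - br (br x y) z"
    by (rule lie_bracket_skew[OF assms])
  ultimately show ?thesis by (simp add: algebra_simps)
qed

text \<open>Nonzero eigenvectors for the distinct eigenvalues \<open>c + 2 n\<close> would be
  linearly independent, which a finite spanning set forbids.\<close>

lemma eigenvectors_bounded:
  fixes br :: "'g::complex_vector \<Rightarrow> 'g \<Rightarrow> 'g" and u :: "nat \<Rightarrow> 'g" and B :: "'g set"
  assumes br: "lie_bracket br" and fin: "finite B" "complex_vector.span B = UNIV"
    and eig: "\<And>n. br h (u n) = (c + 2 * of_nat n) *\<^sub>C u n"
  shows "\<exists>n. u n = 0"
proof (rule ccontr)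
  assume "\<nexists>n. u n = 0"
  then have nz: "u n \<noteq> 0" for n by simp
  \<comment> \<open>\<open>P n\<close> is the product of the operators
    \<open>br h - (c + 2 s)\<close> over \<open>s < n\<close>. It kills
    \<open>u 0, ..., u (n - 1)\<close> and multiplies \<open>u n\<close> by a nonzero number, so
    \<open>u n\<close> lies outside their span.\<close>
  define P where "P = rec_nat (\<lambda>v. v) (\<lambda>n f v. br h (f v) - (c + 2 * of_nat n) *\<^sub>C f v)"
  have P0: "P 0 v = v" and PS: "P (Suc n) v = br h (P n v) - (c + 2 * of_nat n) *\<^sub>C P n v" for n v
    by (simp_all add: P_def)
  have P_add: "P n (v + w) = P n v + P n w" for n v w
    by (induction n) (simp_all add: P0 PS lie_bracket_simps[OF br] scaleC_add_right)
  have P_scale: "P n (a *\<^sub>C v) = a *\<^sub>C P n v" for n a v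
    by (induction n) (simp_all add: P0 PS lie_bracket_simps[OF br] scaleC_scaleC
        complex_vector.scale_right_diff_distrib mult.commute)
  have P_u: "P n (u k) = (\<Prod>s<n. 2 * (of_nat k - of_nat s)) *\<^sub>C u k" for n k
  proof (induction n)
    case (Suc n)
    let ?c = "\<Prod>s<n. 2 * (of_nat k - of_nat s) :: complex"
    have "P (Suc n) (u k) = (?c * (c + 2 * of_nat k)) *\<^sub>C u k - ((c + 2 * of_nat n) * ?c) *\<^sub>C u k"
      by (simp add: PS Suc.IH lie_bracket_simps[OF br] eig scaleC_scaleC)
    also have "\<dots> = (?c * (c + 2 * of_nat k) - (c + 2 * of_nat n) * ?c) *\<^sub>C u k"
      by (rule complex_vector.scale_left_diff_distrib[symmetric])
    also have "?c * (c + 2 * of_nat k) - (c + 2 * of_nat n) * ?c = ?c * (2 * (of_nat k - of_nat n))"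
      by (simp add: algebra_simps)
    finally show ?case by simp
  qed (simp add: P0 scaleC_one)
  have ker: "complex_vector.subspace {v. P n v = 0}" for n
  proof -
    have "P n 0 = 0" using P_scale[of n 0 0] by simp
    then show ?thesis by (auto simp: complex_vector.subspace_def P_add P_scale)
  qed
  have notin: "u n \<notin> complex_vector.span (u ` {..<n})" for n
  proof
    assume "u n \<in> complex_vector.span (u ` {..<n})"
    moreover have "u ` {..<n} \<subseteq> {v. P n v = 0}"
      by (auto simp: P_u)
    ultimately have "P n (u n) = 0"
      using complex_vector.span_minimal[OF _ ker] by blast
    then show False
      using nz[of n] by (auto simp: P_u)
  qed
  have "complex_vector.independent (u ` {..<n}) \<and> card (u ` {..<n}) = n" for n
  proof (induction n)
    case (Suc n)
    have "u n \<notin> u ` {..<n}"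
      using notin[of n] complex_vector.span_base by metis
    then show ?case
      using Suc notin[of n] by (simp add: lessThan_Suc complex_vector.independent_insert)
  qed (simp add: complex_vector.independent_empty)
  then have S: "complex_vector.independent (u ` {..<Suc (card B)})" "card (u ` {..<Suc (card B)}) = Suc (card B)"
    by blast+
  have "u ` {..<Suc (card B)} \<subseteq> complex_vector.span B"
    by (simp add: fin(2))
  from complex_vector.independent_span_bound[OF fin(1) S(1) this] S(2) show False
    by simp
qed

text \<open>The string \<open>v, x v, x x v, ...\<close> must end. Applying \<open>y\<close> to its
  first vanishing term gives back a nonzero multiple of the last nonzero vector \<open>u n\<close>
  unless \<open>c + n = 0\<close>.\<close>

lemma sl2_lowest_weight:
  fixes br :: "'g::complex_vector \<Rightarrow> 'g \<Rightarrow> 'g" and B :: "'g set"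
  assumes br: "lie_bracket br" and fin: "finite B" "complex_vector.span B = UNIV"
    and xyh: "br x y = h" "br h x = 2 *\<^sub>C x"
    and v: "br h v = c *\<^sub>C v" "br y v = 0" "v \<noteq> 0"
  shows "\<exists>n::nat. c = - of_nat n"
proof -
  define u where "u n = ((br x) ^^ n) v" for n
  have u0: "u 0 = v" and uS: "u (Suc n) = br x (u n)" for n
    by (simp_all add: u_def)
  have eig: "br h (u n) = (c + 2 * of_nat n) *\<^sub>C u n" for n
  proof (induction n)
    case (Suc n)
    have "br h (u (Suc n)) = br (br h x) (u n) + br x (br h (u n))"
      unfolding uS by (rule lie_bracket_derivation[OF br])
    also have "\<dots> = 2 *\<^sub>C u (Suc n) + (c + 2 * of_nat n) *\<^sub>C u (Suc n)"
      by (simp add: xyh Suc.IH lie_bracket_simps[OF br] uS)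
    also have "\<dots> = (2 + (c + 2 * of_nat n)) *\<^sub>C u (Suc n)"
      by (rule scaleC_add_left[symmetric])
    also have "2 + (c + 2 * of_nat n) = c + 2 * of_nat (Suc n)"
      by simp
    finally show ?case .
  qed (simp add: u0 v)
  have low: "br y (u (Suc n)) = - ((of_nat (Suc n) * (c + of_nat n)) *\<^sub>C u n)" for n
  proof (induction n)
    case 0
    have "br y (br x v) = br (br y x) v + br x (br y v)"
      by (rule lie_bracket_derivation[OF br])
    also have "\<dots> = - (c *\<^sub>C v)"
      using lie_bracket_skew[OF br, of y x]
      by (simp add: v xyh lie_bracket_uminus[OF br] lie_bracket_zero[OF br])
    finally show ?case by (simp add: u0 uS)
  next
    case (Suc n)
    have "br y (u (Suc (Suc n))) = br (br y x) (u (Suc n)) + br x (br y (u (Suc n)))"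
      unfolding uS[of "Suc n"] by (rule lie_bracket_derivation[OF br])
    also have "br (br y x) (u (Suc n)) = - ((c + 2 * of_nat (Suc n)) *\<^sub>C u (Suc n))"
      using lie_bracket_skew[OF br, of y x] by (simp only: xyh lie_bracket_uminus[OF br] eig)
    also have "br x (br y (u (Suc n))) = - ((of_nat (Suc n) * (c + of_nat n)) *\<^sub>C u (Suc n))"
      by (simp only: Suc.IH lie_bracket_uminus[OF br] lie_bracket_simps[OF br] uS[symmetric])
    also have "- ((c + 2 * of_nat (Suc n)) *\<^sub>C u (Suc n)) + - ((of_nat (Suc n) * (c + of_nat n)) *\<^sub>C u (Suc n))
        = - ((c + 2 * of_nat (Suc n)) *\<^sub>C u (Suc n)) - (of_nat (Suc n) * (c + of_nat n)) *\<^sub>C u (Suc n)"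
      by simp
    also have "\<dots> = - ((c + 2 * of_nat (Suc n) + of_nat (Suc n) * (c + of_nat n)) *\<^sub>C u (Suc n))"
      by (simp only: scaleC_add_left minus_add_distrib) (simp only: diff_conv_add_uminus)
    also have "c + 2 * of_nat (Suc n) + of_nat (Suc n) * (c + of_nat n)
        = of_nat (Suc (Suc n)) * (c + of_nat (Suc n))"
      by (simp add: algebra_simps)
    finally show ?case .
  qed
  have ex: "\<exists>n. u n = 0"
    by (rule eigenvectors_bounded[OF br fin eig])
  define N where "N = (LEAST n. u n = 0)"
  have N: "u N = 0" unfolding N_def by (rule LeastI_ex[OF ex])
  then have "N \<noteq> 0" using u0 v(3) by (metis (full_types))
  then obtain n where n: "N = Suc n" using not0_implies_Suc by blast
  then have "u n \<noteq> 0" unfolding N_def using not_less_Least[of n "\<lambda>n. u n = 0"] by simp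
  then have "of_nat (Suc n) * (c + of_nat n) = 0"
    using low[of n] N n lie_bracket_zero[OF br] by simp
  then have "c + of_nat n = 0"
    using of_nat_neq_0 mult_eq_0_iff by metis
  then show ?thesis by (intro exI[of _ n]) (simp add: eq_neg_iff_add_eq_0)
qed

text \<open>The coordinates 1 at \<open>j\<close> and -1 at \<open>i\<close> have opposite signs,
  while those of a root have one sign; linear independence makes coordinates unique, so the index
  \<open>i\<close> refutes the first case and \<open>j\<close> the second.\<close>

lemma simple_root_diff:
  assumes "simple_roots br H l \<alpha>" "i \<in> {1..l}" "j \<in> {1..l}" "i \<noteq> j"
  shows "root_space br H (\<lambda>t. \<alpha> j t - \<alpha> i t) = {0}"
proof (rule ccontr)
  assume nz: "root_space br H (\<lambda>t. \<alpha> j t - \<alpha> i t) \<noteq> {0}"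
  have ind: "\<And>c :: nat \<Rightarrow> complex. (\<forall>h\<in>H. (\<Sum>k=1..l. c k * \<alpha> k h) = 0) \<Longrightarrow> \<forall>k\<in>{1..l}. c k = 0"
    and dec: "\<And>\<beta>. lie_root br H \<beta> \<Longrightarrow>
        (\<exists>n :: nat \<Rightarrow> nat. (\<forall>h\<in>H. \<beta> h = (\<Sum>i=1..l. of_nat (n i) * \<alpha> i h)) \<or>
                           (\<forall>h\<in>H. \<beta> h = - (\<Sum>i=1..l. of_nat (n i) * \<alpha> i h)))"
    using assms(1) unfolding simple_roots_def by blast+
  define c where "c k = (if k = j then 1 else if k = i then -1 else 0 :: complex)" for k
  have c: "\<alpha> j h - \<alpha> i h = (\<Sum>k=1..l. c k * \<alpha> k h)" for h
  proof -
    have "(\<Sum>k=1..l. c k * \<alpha> k h) = (\<Sum>k=1..l. (if k = j then \<alpha> j h else 0) - (if k = i then \<alpha> i h else 0))"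
      using assms(4) by (intro sum.cong) (auto simp: c_def)
    then show ?thesis using assms(2,3) by (simp add: sum_subtractf)
  qed
  have "\<exists>h\<in>H. \<alpha> j h - \<alpha> i h \<noteq> 0"
  proof (rule ccontr)
    assume "\<not> ?thesis"
    then have "\<forall>k\<in>{1..l}. c k = 0" using ind[of c] c by auto
    then have "c j = 0" using assms(3) by blast
    then show False by (simp add: c_def)
  qed
  then have "lie_root br H (\<lambda>t. \<alpha> j t - \<alpha> i t)"
    using nz by (simp add: lie_root_def)
  from dec[OF this] obtain n :: "nat \<Rightarrow> nat" where
    "(\<forall>h\<in>H. \<alpha> j h - \<alpha> i h = (\<Sum>k=1..l. of_nat (n k) * \<alpha> k h)) \<or>
     (\<forall>h\<in>H. \<alpha> j h - \<alpha> i h = - (\<Sum>k=1..l. of_nat (n k) * \<alpha> k h))" by blast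
  then show False
  proof
    assume "\<forall>h\<in>H. \<alpha> j h - \<alpha> i h = (\<Sum>k=1..l. of_nat (n k) * \<alpha> k h)"
    then have "\<forall>h\<in>H. (\<Sum>k=1..l. (c k - of_nat (n k)) * \<alpha> k h) = 0"
      unfolding c by (simp add: algebra_simps sum_subtractf)
    then have "c i - of_nat (n i) = 0" using ind[of "\<lambda>k. c k - of_nat (n k)"] assms(2) by blast
    then have "(of_nat (n i) :: complex) = -1" using assms(4) by (simp add: c_def)
    then have "(of_nat (Suc (n i)) :: complex) = 0" by simp
    then show False using of_nat_neq_0 by blast
  next
    assume "\<forall>h\<in>H. \<alpha> j h - \<alpha> i h = - (\<Sum>k=1..l. of_nat (n k) * \<alpha> k h)"
    then have "\<forall>h\<in>H. (\<Sum>k=1..l. (c k + of_nat (n k)) * \<alpha> k h) = 0"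
      unfolding c by (simp add: algebra_simps sum.distrib)
    then have "c j + of_nat (n j) = 0" using ind[of "\<lambda>k. c k + of_nat (n k)"] assms(3) by blast
    then have "(of_nat (Suc (n j)) :: complex) = 0" by (simp add: c_def)
    then show False using of_nat_neq_0 by blast
  qed
qed

lemma cartan_matrix_diag:
  assumes "cartan_matrix_of br l a" "i \<in> {1..l}"
  shows "a i i = 2"
proof -
  obtain H \<alpha> \<alpha>' where "is_coroot br H (\<alpha> i) (\<alpha>' i)" "of_int (a i i) = \<alpha> i (\<alpha>' i)"
    using assms unfolding cartan_matrix_of_def by blast
  then have "(of_int (a i i) :: complex) = of_int 2" by (simp add: is_coroot_def)
  then show ?thesis by (simp only: of_int_eq_iff)
qed

text \<open>A root vector for \<open>\<alpha> j\<close> is annihilated by the root vector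
  \<open>y\<close> for the negative of \<open>\<alpha> i\<close>, because
  \<open>\<alpha> j - \<alpha> i\<close> is not a root. It is thus a lowest weight vector for the
  copy of sl_2 belonging to \<open>i\<close>, and its weight is \<open>a i j\<close>.\<close>

lemma cartan_matrix_off_diag:
  fixes br :: "'g::complex_vector \<Rightarrow> 'g \<Rightarrow> 'g"
  assumes "semisimple_lie_algebra br" "cartan_matrix_of br l a"
    and ij: "i \<in> {1..l}" "j \<in> {1..l}" "i \<noteq> j"
  shows "a i j \<le> 0"
proof -
  have br: "lie_bracket br" using assms(1) by (simp add: semisimple_lie_algebra_def)
  obtain B :: "'g set" where B: "finite B" "complex_vector.span B = UNIV"
    using assms(1) by (auto simp: semisimple_lie_algebra_def)
  obtain H \<alpha> \<alpha>' where sr: "simple_roots br H l \<alpha>"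
    and "is_coroot br H (\<alpha> i) (\<alpha>' i)" and aij: "of_int (a i j) = \<alpha> j (\<alpha>' i)"
    using assms unfolding cartan_matrix_of_def by blast
  then obtain x y where h: "\<alpha>' i \<in> H" "\<alpha> i (\<alpha>' i) = 2"
    and x: "x \<in> root_space br H (\<alpha> i)" and y: "y \<in> root_space br H (\<lambda>t. - \<alpha> i t)"
    and xy: "br x y = \<alpha>' i"
    unfolding is_coroot_def by blast
  have "lie_root br H (\<alpha> j)" using sr ij unfolding simple_roots_def by blast
  then have "root_space br H (\<alpha> j) \<noteq> {0}" by (simp add: lie_root_def)
  moreover have "0 \<in> root_space br H (\<alpha> j)"
    by (simp add: root_space_def lie_bracket_zero[OF br])
  ultimately obtain v where v: "v \<in> root_space br H (\<alpha> j)" "v \<noteq> 0" by blast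
  have "br t (br y v) = (\<alpha> j t - \<alpha> i t) *\<^sub>C br y v" if "t \<in> H" for t
  proof -
    have "br t (br y v) = br (br t y) v + br y (br t v)"
      by (rule lie_bracket_derivation[OF br])
    then show ?thesis
      using that v(1) y by (simp add: root_space_def lie_bracket_simps[OF br] lie_bracket_uminus[OF br]
          complex_vector.scale_left_diff_distrib)
  qed
  then have "br y v \<in> root_space br H (\<lambda>t. \<alpha> j t - \<alpha> i t)"
    by (simp add: root_space_def)
  then have yv: "br y v = 0"
    using simple_root_diff[OF sr ij] by blast
  have "\<exists>n::nat. \<alpha> j (\<alpha>' i) = - of_nat n"
    by (rule sl2_lowest_weight[OF br B xy _ _ yv v(2)]) (use h x v(1) in \<open>auto simp: root_space_def\<close>)
  then obtain n :: nat where "(of_int (a i j) :: complex) = of_int (- int n)"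
    using aij by auto
  then have "a i j = - int n" by (simp only: of_int_eq_iff)
  then show ?thesis by simp
qed

section \<open>Exponentials of operator series\<close>

text \<open>In a product of at least two factors without constant term, coefficient \<open>n\<close>
  involves only coefficients of the factors below \<open>n\<close>. This is what lets the logarithm
  be computed recursively.\<close>

lemma fps_power_cong_below:
  fixes S T :: "'a::ring_1 fps"
  assumes "fps_nth S 0 = 0" "fps_nth T 0 = 0" "\<And>r. r < n \<Longrightarrow> fps_nth S r = fps_nth T r" "2 \<le> k"
  shows "fps_nth (S ^ k) n = fps_nth (T ^ k) n"
proof -
  have lt: "r < n \<Longrightarrow> fps_nth (S ^ k) r = fps_nth (T ^ k) r" for k r
  proof (induction k arbitrary: r)
    case (Suc k)
    then show ?case
      unfolding power_Suc fps_mult_nth by (intro sum.cong) (auto simp: assms(3))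
  qed simp
  obtain k' where k: "k = Suc (Suc k')"
    using assms(4) by (auto simp: le_iff_add)
  have "fps_nth (S ^ Suc (Suc k')) n = fps_nth (T ^ Suc (Suc k')) n"
    unfolding power_Suc[of _ "Suc k'"] fps_mult_nth
  proof (intro sum.cong refl)
    fix i assume "i \<in> {0..n}"
    consider "i = 0" | "i = n" "i \<noteq> 0" | "i \<noteq> 0" "i < n"
      using \<open>i \<in> {0..n}\<close> by fastforce
    then show "fps_nth S i * fps_nth (S ^ Suc k') (n - i) = fps_nth T i * fps_nth (T ^ Suc k') (n - i)"
    proof cases
      case 2
      then show ?thesis using assms(1,2) by (simp add: fps_mult_nth)
    next
      case 3
      then show ?thesis using lt[of "n - i" "Suc k'"] assms(3)[of i] by simp
    qed (simp add: assms)
  qed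
  then show ?thesis using k by simp
qed

text \<open>Coefficient \<open>n\<close> of the exponential is coefficient \<open>n\<close> of
  \<open>S\<close> plus terms from the powers \<open>S^k\<close>, \<open>k \<ge> 2\<close>, which
  depend on earlier coefficients; the equation can be solved for the coefficients one after the
  other.\<close>

lemma fps_alg_exp_surj:
  fixes T :: "'a::complex_algebra_1 fps"
  assumes "fps_nth T 0 = 1"
  shows "\<exists>S. fps_nth S 0 = 0 \<and> fps_alg_exp S = T"
proof -
  \<comment> \<open>The truncation below \<open>n\<close> makes the recursive calls visibly well
    founded; by \<open>fps_power_cong_below\<close> it does not alter the value.\<close>
  define s where "s = wfrec less_than (\<lambda>f n. if n = 0 then 0 else
    fps_nth T n - (\<Sum>k=2..n. (1 / fact k) *\<^sub>C fps_nth (Abs_fps (\<lambda>r. if r < n then f r else 0) ^ k) n))"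
  have s_eq: "s n = (if n = 0 then 0 else
    fps_nth T n - (\<Sum>k=2..n. (1 / fact k) *\<^sub>C fps_nth (Abs_fps (\<lambda>r. if r < n then s r else 0) ^ k) n))" for n
    unfolding s_def by (subst wfrec[OF wf_less_than]) (simp add: cut_apply cong: if_cong)
  define S where "S = Abs_fps s"
  have S0: "fps_nth S 0 = 0" by (simp add: S_def s_eq)
  have "fps_nth (fps_alg_exp S) n = fps_nth T n" for n
  proof (cases "n = 0")
    case True
    then show ?thesis by (simp add: fps_alg_exp_def assms scaleC_one)
  next
    case False
    have "fps_nth (fps_alg_exp S) n = (\<Sum>k\<le>n. (1 / fact k) *\<^sub>C fps_nth (S ^ k) n)"
      by (simp add: fps_alg_exp_def)
    also have "{..n} = insert 0 (insert 1 {2..n})" using False by auto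
    also have "(\<Sum>k\<in>\<dots>. (1 / fact k) *\<^sub>C fps_nth (S ^ k) n)
        = s n + (\<Sum>k=2..n. (1 / fact k) *\<^sub>C fps_nth (S ^ k) n)"
      using False by (simp add: S_def scaleC_one)
    also have "(\<Sum>k=2..n. (1 / fact k) *\<^sub>C fps_nth (S ^ k) n)
        = (\<Sum>k=2..n. (1 / fact k) *\<^sub>C fps_nth (Abs_fps (\<lambda>r. if r < n then s r else 0) ^ k) n)"
      using False S0 by (intro sum.cong refl arg_cong[where f = "scaleC _"] fps_power_cong_below)
        (auto simp: S_def)
    finally show ?thesis using s_eq[of n] False by simp
  qed
  then show ?thesis using S0 by (intro exI[of _ S]) (simp add: fps_eq_iff)
qed

text \<open>Divided by their leading coefficients, both currents become power series with constant
  term 1. Their two logarithms provide the positive and the negative modes independently.\<close>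

lemma Kseries_exist:
  fixes Kp Km :: "int \<Rightarrow> 'a::complex_algebra_1"
  assumes p: "p - inverse p \<noteq> 0"
    and inv: "Kp 0 * Km 0 = 1" "Km 0 * Kp 0 = 1"
    and supp: "\<And>n. n > 0 \<Longrightarrow> Kp n = 0" "\<And>n. n < 0 \<Longrightarrow> Km n = 0"
  shows "\<exists>H. Kplus_series p (Kp 0) H = Kp \<and> Kminus_series p (Km 0) H = Km"
proof -
  let ?c = "p - inverse p"
  obtain S where S: "fps_nth S 0 = 0" "fps_alg_exp S = Abs_fps (\<lambda>r. Km 0 * Kp (- int r))"
    using fps_alg_exp_surj[of "Abs_fps (\<lambda>r. Km 0 * Kp (- int r))"] inv by auto
  obtain R where R: "fps_nth R 0 = 0" "fps_alg_exp R = Abs_fps (\<lambda>r. Kp 0 * Km (int r))"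
    using fps_alg_exp_surj[of "Abs_fps (\<lambda>r. Kp 0 * Km (int r))"] inv by auto
  \<comment> \<open>The scalars undo the factors \<open>p - inverse p\<close> and its negative in
    the two exponents. At 0 the second branch gives 0, the constant term of
    \<open>R\<close>.\<close>
  define H where "H n = (if n > 0 then (1 / ?c) *\<^sub>C fps_nth S (nat n)
    else (- (1 / ?c)) *\<^sub>C fps_nth R (nat (- n)))" for n
  have HS: "Abs_fps (\<lambda>r. if r = 0 then 0 else ?c *\<^sub>C H (int r)) = S"
    using p S(1) by (auto simp: fps_eq_iff H_def scaleC_scaleC scaleC_one)
  have HR: "Abs_fps (\<lambda>r. if r = 0 then 0 else (- ?c) *\<^sub>C H (- int r)) = R"
    using p R(1) by (auto simp: fps_eq_iff H_def scaleC_scaleC scaleC_one minus_diff_eq[symmetric, of p]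
        simp del: minus_diff_eq)
  show ?thesis
    by (intro exI[of _ H] conjI ext) (auto simp: Kplus_series_def Kminus_series_def HS HR S(2) R(2)
        supp inv mult.assoc[symmetric])
qed

section \<open>Meromorphic functions and weighted shifts\<close>

text \<open>Validity on a dense open set is packaged as a filter so that finitely many genericity
  conditions can be combined with \<open>eventually_elim\<close>.\<close>

definition generic :: "(complex ^ 'v::finite) filter" where
  "generic = Abs_filter (\<lambda>P. \<exists>U. open U \<and> closure U = UNIV \<and> (\<forall>x\<in>U. P x))"

lemma eventually_generic:
  "eventually P generic \<longleftrightarrow> (\<exists>U. open U \<and> closure U = UNIV \<and> (\<forall>x\<in>U. P x))"
  unfolding generic_def
proof (rule eventually_Abs_filter, rule is_filter.intro)
  show "\<exists>U::(complex ^ 'a) set. open U \<and> closure U = UNIV \<and> (\<forall>x\<in>U. True)"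
    by (rule exI[of _ UNIV]) simp
next
  fix P Q :: "complex ^ 'a \<Rightarrow> bool"
  assume "\<exists>U. open U \<and> closure U = UNIV \<and> (\<forall>x\<in>U. P x)" "\<exists>U. open U \<and> closure U = UNIV \<and> (\<forall>x\<in>U. Q x)"
  then obtain U V where U: "open U" "closure U = UNIV" "\<forall>x\<in>U. P x"
    and V: "open V" "closure V = UNIV" "\<forall>x\<in>V. Q x" by metis
  have "U \<subseteq> closure (U \<inter> V)"
    using open_Int_closure_subset[OF U(1), of V] V(2) by simp
  then have "closure (U \<inter> V) = UNIV"
    using U(2) closure_minimal[of U "closure (U \<inter> V)"] by auto
  then show "\<exists>U. open U \<and> closure U = UNIV \<and> (\<forall>x\<in>U. P x \<and> Q x)"
    using U V by (intro exI[of _ "U \<inter> V"]) auto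
next
  fix P Q :: "complex ^ 'a \<Rightarrow> bool"
  assume "\<forall>x. P x \<longrightarrow> Q x" "\<exists>U. open U \<and> closure U = UNIV \<and> (\<forall>x\<in>U. P x)"
  then show "\<exists>U. open U \<and> closure U = UNIV \<and> (\<forall>x\<in>U. Q x)" by metis
qed

text \<open>If the open set where \<open>h\<close> is nonzero were not dense, \<open>h\<close> would
  vanish on the nonempty open complement of its closure.\<close>

lemma eventually_generic_nonzero:
  assumes "holomorphic_sev h UNIV" "nonvanishing_sev h UNIV"
  shows "eventually (\<lambda>x. h x \<noteq> 0) generic"
  unfolding eventually_generic
proof (intro exI conjI ballI)
  let ?U = "h -` (- {0})"
  show "open ?U"
    using holomorphic_sev_continuous[OF assms(1)] by (intro open_vimage) auto
  show "closure ?U = UNIV"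
  proof (rule ccontr)
    assume "closure ?U \<noteq> UNIV"
    then have "\<exists>x\<in>- closure ?U. h x \<noteq> 0"
      using assms(2) unfolding nonvanishing_sev_def by (metis Compl_empty_eq double_complement closed_closure open_Compl subset_UNIV)
    then show False using closure_subset[of ?U] by auto
  qed
qed auto

lemma nonvanishing_of_generic:
  assumes "eventually (\<lambda>x. h x \<noteq> 0) generic"
  shows "nonvanishing_sev h V"
  unfolding nonvanishing_sev_def
proof (intro allI impI)
  fix W assume W: "open W \<and> W \<noteq> {} \<and> W \<subseteq> V"
  obtain U where U: "open U" "closure U = UNIV" "\<forall>x\<in>U. h x \<noteq> 0"
    using assms unfolding eventually_generic by blast
  then have "W \<inter> U \<noteq> {}" using W open_Int_closure_eq_empty[of W U] by auto
  then show "\<exists>x\<in>W. h x \<noteq> 0" using U by auto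
qed

section \<open>Closure properties of meromorphic functions\<close>

lemma meromorphic_sev_holomorphic: "holomorphic_sev f UNIV \<Longrightarrow> meromorphic_sev f"
  unfolding meromorphic_sev_def
  by (intro allI exI[of _ UNIV] exI[of _ f] exI[of _ "\<lambda>x. 1"])
     (auto simp: holomorphic_sev_const nonvanishing_sev_def)

lemma meromorphic_sev_inverse:
  assumes f: "meromorphic_sev f" and nz: "eventually (\<lambda>x. f x \<noteq> 0) generic"
  shows "meromorphic_sev (\<lambda>x. inverse (f x))"
  unfolding meromorphic_sev_def
proof
  fix p
  obtain V g h where *: "open V" "p \<in> V" "holomorphic_sev g V" "holomorphic_sev h V"
    "nonvanishing_sev h V" "\<forall>x\<in>V. h x \<noteq> 0 \<longrightarrow> f x = g x / h x"
    using f unfolding meromorphic_sev_def by metis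
  \<comment> \<open>Where \<open>h\<close> is nonzero, a zero of the numerator \<open>g\<close> is a
    zero of \<open>f\<close>, so \<open>g\<close> cannot vanish on an open set.\<close>
  have g: "nonvanishing_sev g V"
    unfolding nonvanishing_sev_def
  proof (intro allI impI)
    fix W assume W: "open W \<and> W \<noteq> {} \<and> W \<subseteq> V"
    define W' where "W' = W \<inter> h -` (- {0})"
    have "continuous_on W h"
      using W * holomorphic_sev_continuous holomorphic_sev_mono by blast
    then have "open W'"
      unfolding W'_def using W by (intro continuous_open_preimage) auto
    moreover have "W' \<noteq> {}"
      using W *(5) unfolding nonvanishing_sev_def W'_def by fastforce
    ultimately obtain x where "x \<in> W'" "f x \<noteq> 0"
      using nonvanishing_of_generic[OF nz, of UNIV] unfolding nonvanishing_sev_def by blast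
    then show "\<exists>x\<in>W. g x \<noteq> 0"
      using *(6) W unfolding W'_def by (intro bexI[of _ x]) auto
  qed
  \<comment> \<open>The quotient \<open>h / g\<close> is expanded by \<open>h\<close>: the
    denominator \<open>h * g\<close> is nonzero only at points where \<open>f = g / h\<close> is
    known.\<close>
  show "\<exists>V g h. open V \<and> p \<in> V \<and> holomorphic_sev g V \<and> holomorphic_sev h V \<and>
        nonvanishing_sev h V \<and> (\<forall>x\<in>V. h x \<noteq> 0 \<longrightarrow> inverse (f x) = g x / h x)"
    by (rule exI[of _ V], rule exI[of _ "\<lambda>x. h x * h x"], rule exI[of _ "\<lambda>x. h x * g x"])
       (use * g in \<open>auto intro: holomorphic_sev_mult nonvanishing_sev_mult\<close>)
qed

lemma meromorphic_sev_divide: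
  "meromorphic_sev f \<Longrightarrow> meromorphic_sev g \<Longrightarrow> eventually (\<lambda>x. g x \<noteq> 0) generic \<Longrightarrow>
    meromorphic_sev (\<lambda>x. f x / g x)"
  unfolding divide_inverse by (intro meromorphic_sev_mult meromorphic_sev_inverse)

lemma meromorphic_sev_diff:
  "meromorphic_sev f \<Longrightarrow> meromorphic_sev g \<Longrightarrow> meromorphic_sev (\<lambda>x. f x - g x)"
  using meromorphic_sev_add[of f "\<lambda>x. - g x"] meromorphic_sev_uminus[of g] by simp

lemma meromorphic_sev_sum:
  "(\<And>i. i \<in> I \<Longrightarrow> meromorphic_sev (f i)) \<Longrightarrow> meromorphic_sev (\<lambda>x. \<Sum>i\<in>I. f i x)"
  by (induction I rule: infinite_finite_induct) (auto intro: meromorphic_sev_const meromorphic_sev_add)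

lemma meromorphic_sev_prod:
  "(\<And>i. i \<in> I \<Longrightarrow> meromorphic_sev (f i)) \<Longrightarrow> meromorphic_sev (\<lambda>x. \<Prod>i\<in>I. f i x)"
  by (induction I rule: infinite_finite_induct) (auto intro: meromorphic_sev_const meromorphic_sev_mult)

lemma meromorphic_sev_power: "meromorphic_sev f \<Longrightarrow> meromorphic_sev (\<lambda>x. f x ^ n)"
  by (induction n) (auto intro: meromorphic_sev_const meromorphic_sev_mult)

lemma meromorphic_sev_powi:
  "meromorphic_sev f \<Longrightarrow> eventually (\<lambda>x. f x \<noteq> 0) generic \<Longrightarrow> meromorphic_sev (\<lambda>x. f x powi n)"
  by (cases "n \<ge> 0") (simp_all add: power_int_def meromorphic_sev_power meromorphic_sev_inverse)

lemma meromorphic_sev_poly: "meromorphic_sev f \<Longrightarrow> meromorphic_sev (\<lambda>x. poly p (f x))"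
  by (induction p) (auto intro: meromorphic_sev_const meromorphic_sev_mult meromorphic_sev_add)

section \<open>Multiplication operators, translations and weighted shifts\<close>

lemma mero_of_eqI:
  assumes "meromorphic_sev \<phi>" "meromorphic_sev \<psi>" "eventually (\<lambda>x. \<phi> x = \<psi> x) generic"
  shows "mero_of \<phi> = mero_of \<psi>"
proof -
  have "mero_rel \<phi> \<psi>"
    using assms by (simp add: mero_rel_def eventually_generic agree_densely_def)
  then show ?thesis
    using Quotient_rel_abs[OF Quotient_mero] by blast
qed

lemma mero_rel_refl: "meromorphic_sev \<phi> \<Longrightarrow> mero_rel \<phi> \<phi>"
  by (simp add: mero_rel_def agree_densely_refl)

lemma endo_eqI: "(\<And>f. endo_apply S f = endo_apply T f) \<Longrightarrow> S = T"
  by (metis endo_apply_inject ext)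

lemma mult_op_cong:
  assumes "meromorphic_sev \<phi>" "meromorphic_sev \<psi>" "eventually (\<lambda>x. \<phi> x = \<psi> x) generic"
  shows "mult_op \<phi> = mult_op \<psi>"
  using mero_of_eqI[OF assms] by (simp add: mult_op_def)

lemma mult_op_commute: "mult_op \<phi> * mult_op \<psi> = mult_op \<psi> * mult_op \<phi>"
  by (rule endo_eqI) (simp add: times_endo.rep_eq endo_apply_mult_op mult_ac)

lemma mult_op_mult:
  assumes "meromorphic_sev \<phi>" "meromorphic_sev \<psi>"
  shows "mult_op \<phi> * mult_op \<psi> = mult_op (\<lambda>x. \<phi> x * \<psi> x)"
  using times_mero.abs_eq[OF mero_rel_refl[OF assms(1)] mero_rel_refl[OF assms(2)]]
  by (intro endo_eqI) (simp add: times_endo.rep_eq endo_apply_mult_op mult.assoc[symmetric])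

lemma mult_op_add:
  assumes "meromorphic_sev \<phi>" "meromorphic_sev \<psi>"
  shows "mult_op \<phi> + mult_op \<psi> = mult_op (\<lambda>x. \<phi> x + \<psi> x)"
  using plus_mero.abs_eq[OF mero_rel_refl[OF assms(1)] mero_rel_refl[OF assms(2)]]
  by (intro endo_eqI) (simp add: plus_endo.rep_eq endo_apply_mult_op distrib_right[symmetric])

lemma mult_op_0: "mult_op (\<lambda>x. 0) = 0"
  by (rule endo_eqI) (simp add: zero_endo.rep_eq endo_apply_mult_op zero_mero.abs_eq[symmetric])

lemma mult_op_1: "mult_op (\<lambda>x. 1) = 1"
  by (rule endo_eqI) (simp add: one_endo.rep_eq endo_apply_mult_op one_mero.abs_eq[symmetric])

lemma mult_op_sum:
  "(\<And>i. i \<in> I \<Longrightarrow> meromorphic_sev (f i)) \<Longrightarrow> (\<Sum>i\<in>I. mult_op (f i)) = mult_op (\<lambda>x. \<Sum>i\<in>I. f i x)"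
  by (induction I rule: infinite_finite_induct) (auto simp: mult_op_0 mult_op_add meromorphic_sev_sum)

lemma mult_op_scaleC:
  fixes \<phi> :: "complex ^ 'v::finite \<Rightarrow> complex"
  assumes "meromorphic_sev \<phi>"
  shows "c *\<^sub>C mult_op \<phi> = mult_op (\<lambda>x. c * \<phi> x)"
proof -
  have "const_mero c = (mero_of (\<lambda>x. c) :: 'v mero)" by (rule const_mero.abs_eq)
  then have "const_mero c * mero_of \<phi> = mero_of (\<lambda>x. c * \<phi> x)"
    using times_mero.abs_eq[OF mero_rel_refl[OF meromorphic_sev_const[of c]] mero_rel_refl[OF assms]] by simp
  then show ?thesis
    by (intro endo_eqI) (simp add: scaleC_endo.rep_eq endo_apply_mult_op scaleC_mero_def mult.assoc[symmetric])
qed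

lemma mero_shift_mult: "mero_shift b (f * g) = mero_shift b f * mero_shift b g"
  by transfer (auto simp: mero_rel_def agree_densely_refl intro!: meromorphic_sev_mult meromorphic_sev_shift)

lemma mero_shift_shift: "mero_shift b (mero_shift c f) = mero_shift (b + c) f"
  by transfer (auto simp: mero_rel_def agree_densely_refl add.assoc intro!: meromorphic_sev_shift)

lemma mero_shift_0: "mero_shift 0 f = f"
  by transfer (auto simp: mero_rel_def agree_densely_refl)

lemma shift_op_mult_op:
  assumes "meromorphic_sev \<phi>"
  shows "shift_op b * mult_op \<phi> = mult_op (\<lambda>x. \<phi> (x + b)) * shift_op b"
  using mero_shift.abs_eq[OF mero_rel_refl[OF assms], of b]
  by (intro endo_eqI) (simp add: times_endo.rep_eq endo_apply_mult_op endo_apply_shift_op mero_shift_mult)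

lemma shift_op_shift_op: "shift_op b * shift_op c = shift_op (b + c)"
  by (rule endo_eqI) (simp add: times_endo.rep_eq endo_apply_shift_op mero_shift_shift)

lemma shift_op_0: "shift_op 0 = 1"
  by (rule endo_eqI) (simp add: one_endo.rep_eq endo_apply_shift_op mero_shift_0)

definition weighted_shift :: "(complex ^ 'v::finite \<Rightarrow> complex) \<Rightarrow> complex ^ 'v \<Rightarrow> 'v mero endo" where
  "weighted_shift \<phi> b = mult_op \<phi> * shift_op b"

text \<open>Moving the first translation past the second weight evaluates that weight at the
  translated point. Hence every relation between operators becomes an identity between weights for
  each total translation.\<close>

lemma weighted_shift_mult:
  assumes "meromorphic_sev \<phi>" "meromorphic_sev \<psi>"
  shows "weighted_shift \<phi> b * weighted_shift \<psi> c = weighted_shift (\<lambda>x. \<phi> x * \<psi> (x + b)) (b + c)"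
proof -
  have "weighted_shift \<phi> b * weighted_shift \<psi> c = mult_op \<phi> * (shift_op b * mult_op \<psi>) * shift_op c"
    by (simp add: weighted_shift_def mult.assoc)
  also have "\<dots> = (mult_op \<phi> * mult_op (\<lambda>x. \<psi> (x + b))) * (shift_op b * shift_op c)"
    by (simp add: shift_op_mult_op assms mult.assoc)
  finally show ?thesis
    by (simp add: weighted_shift_def mult_op_mult assms meromorphic_sev_shift shift_op_shift_op)
qed

lemma weighted_shift_cong:
  assumes "meromorphic_sev \<phi>" "meromorphic_sev \<psi>" "eventually (\<lambda>x. \<phi> x = \<psi> x) generic"
  shows "weighted_shift \<phi> b = weighted_shift \<psi> b"
  using mult_op_cong[OF assms] by (simp add: weighted_shift_def)

lemma weighted_shift_add:
  "meromorphic_sev \<phi> \<Longrightarrow> meromorphic_sev \<psi> \<Longrightarrow>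
    weighted_shift \<phi> b + weighted_shift \<psi> b = weighted_shift (\<lambda>x. \<phi> x + \<psi> x) b"
  by (simp add: weighted_shift_def mult_op_add[symmetric] distrib_right)

lemma weighted_shift_scaleC:
  "meromorphic_sev \<phi> \<Longrightarrow> c *\<^sub>C weighted_shift \<phi> b = weighted_shift (\<lambda>x. c * \<phi> x) b"
  by (simp add: weighted_shift_def mult_op_scaleC[symmetric] mult_scaleC_left)

lemma weighted_shift_diff:
  assumes "meromorphic_sev \<phi>" "meromorphic_sev \<psi>"
  shows "weighted_shift \<phi> b - weighted_shift \<psi> b = weighted_shift (\<lambda>x. \<phi> x - \<psi> x) b"
  using weighted_shift_add[OF meromorphic_sev_diff[OF assms] assms(2), of b]
  by (simp add: eq_diff_eq[symmetric])

lemma weighted_shift_0: "weighted_shift \<phi> 0 = mult_op \<phi>"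
  by (simp add: weighted_shift_def shift_op_0)

lemma mult_op_diff:
  "meromorphic_sev \<phi> \<Longrightarrow> meromorphic_sev \<psi> \<Longrightarrow> mult_op \<phi> - mult_op \<psi> = mult_op (\<lambda>x. \<phi> x - \<psi> x)"
  using weighted_shift_diff[of \<phi> \<psi> 0] by (simp only: weighted_shift_0)

section \<open>The exponentials of the coordinates in general position\<close>

lemma holomorphic_sev_v_fun: "holomorphic_sev (\<lambda>\<gamma>. v_fun x \<omega>2 \<gamma> i k) S"
  unfolding holomorphic_sev_def v_fun_def
proof
  fix \<gamma> :: "complex ^ 'a"
  let ?c = "2 * of_real pi / \<omega>2"
  have "((\<lambda>\<gamma>. exp (?c * vec_nth \<gamma> (x i k))) has_derivative
      (\<lambda>y. exp (?c * vec_nth \<gamma> (x i k)) * (?c * vec_nth y (x i k)))) (at \<gamma>)"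
  proof (rule has_derivative_compose[of "\<lambda>\<gamma>. ?c * vec_nth \<gamma> (x i k)", OF _ DERIV_exp[THEN has_field_derivative_imp_has_derivative]])
    show "((\<lambda>\<gamma>. ?c * vec_nth \<gamma> (x i k)) has_derivative (\<lambda>y. ?c * vec_nth y (x i k))) (at \<gamma>)"
      by (intro has_derivative_mult_right bounded_linear_imp_has_derivative bounded_linear_vec_nth)
  qed
  moreover have "exp (?c * vec_nth \<gamma> (x i k)) * (?c * vec_nth (c *s y) (x i k)) =
      c * (exp (?c * vec_nth \<gamma> (x i k)) * (?c * vec_nth y (x i k)))" for c y
    unfolding vector_smult_component by (simp only: mult_ac)
  ultimately show "\<exists>D. ((\<lambda>\<gamma>. exp (2 * of_real pi * vec_nth \<gamma> (x i k) / \<omega>2)) has_derivative D) (at \<gamma>) \<and>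
        (\<forall>c y. D (c *s y) = c * D y)"
    by (intro exI[of _ "\<lambda>y. exp (?c * vec_nth \<gamma> (x i k)) * (?c * vec_nth y (x i k))"] conjI) simp_all
qed

lemma v_fun_nonzero: "v_fun x \<omega>2 \<gamma> i k \<noteq> 0"
  by (simp add: v_fun_def)

lemma v_fun_shift:
  "v_fun x \<omega>2 (\<gamma> + axis (x i k) b) j p =
    (if x j p = x i k then exp (2 * of_real pi * b / \<omega>2) else 1) * v_fun x \<omega>2 \<gamma> j p"
  by (auto simp: v_fun_def exp_add[symmetric] distrib_left add_divide_distrib axis_def add.commute)

lemma meromorphic_v_fun: "meromorphic_sev (\<lambda>\<gamma>. v_fun x \<omega>2 \<gamma> i k)"
  by (intro meromorphic_sev_holomorphic holomorphic_sev_v_fun)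

lemma norm_axis: "norm (axis i z :: complex ^ 'v::finite) = norm z"
proof -
  have "(\<Sum>k\<in>UNIV. (norm ((axis i z :: complex ^ 'v) $ k))\<^sup>2) = (\<Sum>k\<in>UNIV. if k = i then (norm z)\<^sup>2 else 0)"
    by (intro sum.cong) (auto simp: axis_def)
  then show ?thesis by (simp add: norm_vec_def L2_set_def)
qed

text \<open>Translating the coordinate \<open>x i k\<close> by \<open>t * \<omega>2\<close> with
  real \<open>t > 0\<close> multiplies \<open>v i k\<close> by \<open>exp (2 pi t) > 1\<close> and
  fixes \<open>v j p\<close>, so the two sides cannot stay equal throughout an open set.\<close>

lemma generic_v_fun_neq:
  assumes "x i k \<noteq> x j p" "\<omega>2 \<noteq> 0" "c \<noteq> 0"
  shows "eventually (\<lambda>\<gamma>. c * v_fun x \<omega>2 \<gamma> i k ^ 2 \<noteq> c' * v_fun x \<omega>2 \<gamma> j p ^ 2) generic"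
proof -
  define h where "h \<gamma> = c * v_fun x \<omega>2 \<gamma> i k ^ 2 + (- c') * v_fun x \<omega>2 \<gamma> j p ^ 2" for \<gamma>
  have "holomorphic_sev h UNIV"
    unfolding h_def power2_eq_square
    by (intro holomorphic_sev_add holomorphic_sev_mult holomorphic_sev_const holomorphic_sev_v_fun)
  moreover have "nonvanishing_sev h UNIV"
    unfolding nonvanishing_sev_def
  proof (intro allI impI)
    fix W :: "(complex ^ 'a) set" assume W: "open W \<and> W \<noteq> {} \<and> W \<subseteq> UNIV"
    then obtain \<gamma> where \<gamma>: "\<gamma> \<in> W" by blast
    show "\<exists>\<gamma>\<in>W. h \<gamma> \<noteq> 0"
    proof (cases "h \<gamma> = 0")
      case True
      obtain e where e: "e > 0" "ball \<gamma> e \<subseteq> W" using W \<gamma> open_contains_ball by blast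
      \<comment> \<open>The displacement \<open>t * norm \<omega>2\<close> is half the radius of the
        ball.\<close>
      define t where "t = e / (2 * norm \<omega>2)"
      have t: "t > 0" using e(1) assms(2) by (simp add: t_def)
      define \<gamma>' where "\<gamma>' = \<gamma> + axis (x i k) (of_real t * \<omega>2)"
      have "dist \<gamma> \<gamma>' = t * norm \<omega>2"
        using t by (simp add: \<gamma>'_def dist_norm norm_axis norm_mult)
      then have "\<gamma>' \<in> W" using e assms(2) by (auto simp: t_def)
      moreover have "h \<gamma>' \<noteq> 0"
      proof -
        define u where "u = exp (2 * of_real pi * (of_real t * \<omega>2) / \<omega>2 :: complex)"
        have u: "u = of_real (exp (2 * pi * t))"
          using assms(2) by (simp add: u_def exp_of_real[symmetric] mult.assoc)
        have "exp (2 * pi * t) > 1" using t by simp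
        then have "exp (2 * pi * t) ^ 2 > 1" by (rule one_less_power) simp
        then have "exp (2 * pi * t) ^ 2 \<noteq> 1" by simp
        then have "u ^ 2 \<noteq> 1" unfolding u by (metis of_real_eq_1_iff of_real_power)
        moreover have "v_fun x \<omega>2 \<gamma>' i k = u * v_fun x \<omega>2 \<gamma> i k" "v_fun x \<omega>2 \<gamma>' j p = v_fun x \<omega>2 \<gamma> j p"
          unfolding \<gamma>'_def v_fun_shift u_def using assms(1) by auto
        then have "h \<gamma>' = c * v_fun x \<omega>2 \<gamma> i k ^ 2 * (u ^ 2 - 1) + h \<gamma>"
          by (simp add: h_def power_mult_distrib algebra_simps)
        ultimately show ?thesis using True assms(3) v_fun_nonzero[of x \<omega>2 \<gamma> i k] by simp
      qed
      ultimately show ?thesis by blast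
    qed (use \<gamma> in blast)
  qed
  ultimately have "eventually (\<lambda>\<gamma>. h \<gamma> \<noteq> 0) generic"
    by (rule eventually_generic_nonzero)
  then show ?thesis by eventually_elim (auto simp: h_def)
qed

section \<open>The Serre identity\<close>

lemma qfact_Suc: "qfact p (Suc k) = qfact p k * ((p ^ Suc k - inverse p ^ Suc k) / (p - inverse p))"
  by (simp add: qfact_def)

lemma qnumber_nonzero:
  assumes "\<forall>n>0. p ^ n \<noteq> (1::complex)" "p \<noteq> 0"
  shows "p ^ Suc k - inverse p ^ Suc k \<noteq> 0"
proof
  assume "p ^ Suc k - inverse p ^ Suc k = 0"
  then have "p ^ Suc k * p ^ Suc k = 1"
    using assms(2) by (simp add: power_inverse field_simps)
  then have "p ^ (Suc k + Suc k) = 1"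
    by (simp only: power_add)
  then show False using assms(1) by blast
qed

lemma qfact_nonzero:
  assumes "\<forall>n>0. p ^ n \<noteq> (1::complex)" "p \<noteq> 0"
  shows "qfact p k \<noteq> 0"
proof (induction k)
  case (Suc k)
  then show ?case
    using qnumber_nonzero[OF assms, of k] qnumber_nonzero[OF assms, of 0] by (simp add: qfact_Suc)
qed (simp add: qfact_def)

lemma qfact_inverse: "qfact (inverse p) k = qfact p k"
proof -
  have "(inverse p ^ j - p ^ j) / (inverse p - p) = (p ^ j - inverse p ^ j) / (p - inverse p)" for j
    by (metis minus_diff_eq minus_divide_divide)
  then show ?thesis by (simp add: qfact_def)
qed

lemma qbinom_inverse: "qbinom (inverse p) m k = qbinom p m k"
  by (simp add: qbinom_def qfact_inverse)

text \<open>With \<open>u = p^j\<close> and \<open>v = p^(n+1-j)\<close> both rules come from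
  splitting \<open>u v - 1/(u v)\<close>, once as \<open>u (v - 1/v) + (1/v) (u - 1/u)\<close> and
  once with \<open>u\<close>, \<open>v\<close> replaced by their inverses up to sign. The
  telescoping step compares two coefficients and uses one rule for each.\<close>

lemma qbinom_pascal:
  assumes "\<forall>n>0. p ^ n \<noteq> (1::complex)" "p \<noteq> 0" and j: "1 \<le> j" "j \<le> n"
  shows "qbinom p (Suc n) j = p ^ j * qbinom p n j + inverse p ^ (Suc n - j) * qbinom p n (j - 1)"
    and "qbinom p (Suc n) j = inverse p ^ j * qbinom p n j + p ^ (Suc n - j) * qbinom p n (j - 1)"
proof -
  define u v where "u = p ^ j" and "v = p ^ (Suc n - j)"
  have uv0: "u \<noteq> 0" "v \<noteq> 0" using assms(2) by (auto simp: u_def v_def)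
  have pn: "p ^ Suc n = u * v" using j by (simp add: u_def v_def power_add[symmetric] del: power_Suc)
  obtain j' where j': "j = Suc j'" using j(1) by (cases j) auto
  obtain r where r: "n = j + r" using j(2) le_Suc_ex by blast
  have e: "p - inverse p \<noteq> 0" "u - inverse u \<noteq> 0" "v - inverse v \<noteq> 0"
    using qnumber_nonzero[OF assms(1,2), of 0] qnumber_nonzero[OF assms(1,2), of j']
      qnumber_nonzero[OF assms(1,2), of r]
    by (simp_all add: u_def v_def j' r power_inverse Suc_diff_le)
  have f: "qfact p (Suc n) = qfact p n * ((u * v - inverse (u * v)) / (p - inverse p))"
    "qfact p j = qfact p j' * ((u - inverse u) / (p - inverse p))"
    "qfact p (Suc n - j) = qfact p r * ((v - inverse v) / (p - inverse p))"
    "n - j = r" "n - (j - 1) = Suc n - j" "j - 1 = j'"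
    using qfact_Suc[of p n] qfact_Suc[of p j'] qfact_Suc[of p r]
    by (simp_all only: pn power_inverse) (simp_all add: u_def v_def j' r power_inverse Suc_diff_le)
  have nj: "n - j' = Suc n - j" using j j' by simp
  note nz = qfact_nonzero[OF assms(1,2)]
  \<comment> \<open>The common factor of the three binomials: each of them is \<open>w\<close> times
    a single difference.\<close>
  define w where "w = qfact p n * (p - inverse p) / (qfact p j' * qfact p r * (u - inverse u) * (v - inverse v))"
  have frac: "X * (W / D) / (J * (U / D) * (R * (V / D))) = X * D / (J * R * U * V) * W"
    "X / (J * (U / D) * R) = X * D / (J * R * U * V) * V"
    "X / (J * (R * (V / D))) = X * D / (J * R * U * V) * U"
    if "D \<noteq> 0" "U \<noteq> 0" "V \<noteq> 0" for X W D J U R V :: complex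
    using that by (simp_all add: field_simps)
  have g: "qbinom p (Suc n) j = w * (u * v - inverse (u * v))"
    "qbinom p n j = w * (v - inverse v)" "qbinom p n (j - 1) = w * (u - inverse u)"
    unfolding qbinom_def f(6) nj f(1-4) w_def by (rule frac[OF e])+
  have inv: "inverse p ^ j = inverse u" "inverse p ^ (Suc n - j) = inverse v"
    by (simp_all add: u_def v_def power_inverse)
  have "u * v - inverse (u * v) = u * (v - inverse v) + inverse v * (u - inverse u)"
    "u * v - inverse (u * v) = inverse u * (v - inverse v) + v * (u - inverse u)"
    using uv0 by (simp_all add: field_simps)
  then show "qbinom p (Suc n) j = p ^ j * qbinom p n j + inverse p ^ (Suc n - j) * qbinom p n (j - 1)"
    and "qbinom p (Suc n) j = inverse p ^ j * qbinom p n j + p ^ (Suc n - j) * qbinom p n (j - 1)"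
    unfolding g inv u_def[symmetric] v_def[symmetric] by (metis (no_types, lifting) distrib_left mult.left_commute)+
qed

lemma qbinom_self:
  assumes "\<forall>n>0. p ^ n \<noteq> (1::complex)" "p \<noteq> 0"
  shows "qbinom p n n = 1" "qbinom p n 0 = 1"
  using qfact_nonzero[OF assms, of n] by (simp_all add: qbinom_def qfact_def[of _ 0])

text \<open>The alternating sum telescopes: its partial sums are single products.\<close>

lemma serre_sum_partial:
  fixes p Y :: complex
  assumes p: "\<forall>n>0. p ^ n \<noteq> 1" "p \<noteq> 0" and "j \<le> n"
  shows "(\<Sum>k\<le>j. (- 1) ^ k * qbinom p (Suc n) k * p ^ (n * k) *
      (\<Prod>s<k. inverse p ^ (2 * s) * Y - 1) * (\<Prod>s<Suc n - k. p ^ (2 * s) * Y - 1)) =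
    (- 1) ^ j * p ^ (Suc n * j) * qbinom p n j *
      (\<Prod>s<Suc j. inverse p ^ (2 * s) * Y - 1) * (\<Prod>s=1..<Suc n - j. p ^ (2 * s) * Y - 1)"
  using \<open>j \<le> n\<close>
proof (induction j)
  case 0
  have "{..<Suc n} = insert 0 {1..<Suc n}" by auto
  then have "(\<Prod>s<Suc n. p ^ (2 * s) * Y - 1) = (Y - 1) * (\<Prod>s=1..<Suc n. p ^ (2 * s) * Y - 1)"
    by (simp del: prod.lessThan_Suc)
  then show ?case by (simp add: qbinom_self[OF p] del: prod.lessThan_Suc)
next
  case (Suc j)
  define A where "A k = (\<Prod>s<k. inverse p ^ (2 * s) * Y - 1)" for k
  define B where "B k = (\<Prod>s=1..<k. p ^ (2 * s) * Y - 1)" for k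
  define r where "r = n - Suc j"
  have n: "n = Suc j + r" using Suc.prems by (simp add: r_def)
  have B1: "(\<Prod>s<k. p ^ (2 * s) * Y - 1) = (Y - 1) * B k" if "k > 0" for k
  proof -
    have "{..<k} = insert 0 {1..<k}" using that by auto
    then show ?thesis by (simp add: B_def)
  qed
  have AS: "A (Suc (Suc j)) = A (Suc j) * (inverse p ^ (2 * Suc j) * Y - 1)"
    by (simp add: A_def)
  have BS: "B (Suc n - j) = B (Suc n - Suc j) * (p ^ (2 * (Suc n - Suc j)) * Y - 1)"
  proof -
    have "Suc n - j = Suc (Suc n - Suc j)" "1 \<le> Suc n - Suc j" using Suc.prems by auto
    then show ?thesis by (simp add: B_def)
  qed
  \<comment> \<open>The two q-Pascal rules, scaled so that they give the constant term and the
    coefficient of \<open>Y\<close> in the induction step.\<close>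
  have pas: "p ^ (n * Suc j) * qbinom p (Suc n) (Suc j)
        = p ^ (Suc n * Suc j) * qbinom p n (Suc j) + p ^ (Suc n * j) * qbinom p n j"
    "p ^ (n * Suc j) * qbinom p (Suc n) (Suc j) = p ^ (Suc n * Suc j) * inverse p ^ (2 * Suc j) * qbinom p n (Suc j)
       + p ^ (Suc n * j) * p ^ (2 * (Suc n - Suc j)) * qbinom p n j"
  proof -
    have e: "p ^ (n * Suc j) * p ^ Suc j = p ^ (Suc n * Suc j)"
      "p ^ (n * Suc j) = p ^ (Suc n * j) * p ^ (Suc n - Suc j)"
      by (simp_all only: power_add[symmetric]) (simp_all add: n algebra_simps)
    have e2: "p ^ (n * Suc j) * inverse p ^ Suc j = p ^ (Suc n * Suc j) * inverse p ^ (2 * Suc j)"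
    proof -
      have "p ^ (Suc n * Suc j) * inverse p ^ (2 * Suc j)
          = p ^ (n * Suc j) * (p ^ Suc j * inverse p ^ Suc j) * inverse p ^ Suc j"
        unfolding e(1)[symmetric] mult_2 power_add by (simp only: mult_ac)
      also have "p ^ Suc j * inverse p ^ Suc j = 1"
        using p(2) by (simp add: power_mult_distrib[symmetric] del: power_Suc)
      finally show ?thesis by (simp only: mult_1_right)
    qed
    have e3: "p ^ (n * Suc j) * inverse p ^ (Suc n - Suc j) = p ^ (Suc n * j)"
    proof -
      have "p ^ (Suc n - Suc j) * inverse p ^ (Suc n - Suc j) = 1"
        using p(2) by (simp add: power_mult_distrib[symmetric] del: power_Suc)
      then show ?thesis unfolding e(2) by (simp only: mult.assoc mult_1_right)
    qed
    have e4: "p ^ (n * Suc j) * p ^ (Suc n - Suc j) = p ^ (Suc n * j) * p ^ (2 * (Suc n - Suc j))"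
      unfolding e(2) mult_2 power_add by (simp only: mult_ac)
    note q = qbinom_pascal[OF p, of "Suc j" n, simplified diff_Suc_1]
    have j1: "1 \<le> Suc j" by simp
    show "p ^ (n * Suc j) * qbinom p (Suc n) (Suc j)
        = p ^ (Suc n * Suc j) * qbinom p n (Suc j) + p ^ (Suc n * j) * qbinom p n j"
      using q(1)[OF j1 Suc.prems] e(1) e3 by (metis (no_types, lifting) distrib_left mult.assoc)
    show "p ^ (n * Suc j) * qbinom p (Suc n) (Suc j) = p ^ (Suc n * Suc j) * inverse p ^ (2 * Suc j) * qbinom p n (Suc j)
       + p ^ (Suc n * j) * p ^ (2 * (Suc n - Suc j)) * qbinom p n j"
      using q(2)[OF j1 Suc.prems] e2 e4 by (metis (no_types, lifting) distrib_left mult.assoc)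
  qed
  \<comment> \<open>Once the common products \<open>a\<close> and \<open>b\<close> are taken out,
    the claim is affine in \<open>Y\<close>; the two equations \<open>h\<close> are its two
    coefficients.\<close>
  have main: "(c * P2) * x2 * a * (b * (p2 * Y - 1)) + (- c) * x3 * Z * a * ((Y - 1) * b)
      = (- c) * P1 * x1 * (a * (i2 * Y - 1)) * b"
    if h: "Z * x3 = P1 * x1 + P2 * x2" "Z * x3 = P1 * i2 * x1 + P2 * p2 * x2"
    for c P1 P2 x1 x2 x3 a b p2 i2 Z :: complex
  proof -
    have "(c * P2) * x2 * a * (b * (p2 * Y - 1)) + (- c) * x3 * Z * a * ((Y - 1) * b)
        = c * a * b * (P2 * x2 * (p2 * Y - 1) - (Z * x3) * Y + (Z * x3))"
      by (simp add: algebra_simps)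
    also have "\<dots> = c * a * b * (P2 * x2 * (p2 * Y - 1) - (P1 * i2 * x1 + P2 * p2 * x2) * Y + (P1 * x1 + P2 * x2))"
      by (metis h)
    also have "\<dots> = (- c) * P1 * x1 * (a * (i2 * Y - 1)) * b"
      by (simp add: algebra_simps)
    finally show ?thesis .
  qed
  have "(\<Sum>k\<le>Suc j. (- 1) ^ k * qbinom p (Suc n) k * p ^ (n * k) * A k * (\<Prod>s<Suc n - k. p ^ (2 * s) * Y - 1))
      = (- 1) ^ j * p ^ (Suc n * j) * qbinom p n j * A (Suc j) * (B (Suc n - Suc j) * (p ^ (2 * (Suc n - Suc j)) * Y - 1))
        + (- ((- 1) ^ j)) * qbinom p (Suc n) (Suc j) * p ^ (n * Suc j) * A (Suc j) * ((Y - 1) * B (Suc n - Suc j))"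
    using Suc.IH Suc.prems unfolding A_def[symmetric] B_def[symmetric] BS[symmetric]
    by (simp add: B1 del: mult_Suc_right mult_Suc)
  also have "\<dots> = (- ((- 1) ^ j)) * p ^ (Suc n * Suc j) * qbinom p n (Suc j) *
      (A (Suc j) * (inverse p ^ (2 * Suc j) * Y - 1)) * B (Suc n - Suc j)"
    by (rule main[OF pas])
  finally show ?case
    unfolding A_def[symmetric] B_def[symmetric] AS by (simp del: mult_Suc_right mult_Suc)
qed

text \<open>The partial sum up to \<open>n\<close> has collapsed to one product with binomial factor
  1, and the last summand is its negative.\<close>

lemma serre_sum_zero:
  fixes p Y :: complex
  assumes p: "\<forall>n>0. p ^ n \<noteq> 1" "p \<noteq> 0"
  shows "(\<Sum>k\<le>Suc n. (- 1) ^ k * qbinom p (Suc n) k * p ^ (n * k) *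
      (\<Prod>s<k. inverse p ^ (2 * s) * Y - 1) * (\<Prod>s<Suc n - k. p ^ (2 * s) * Y - 1)) = 0"
proof -
  have "p ^ (Suc n * n) = p ^ (n * Suc n)" by (simp only: mult.commute)
  then show ?thesis
    using serre_sum_partial[OF p order_refl, of n Y]
    by (simp only: sum.atMost_Suc) (simp add: qbinom_self[OF p] del: prod.lessThan_Suc mult_Suc mult_Suc_right)
qed

text \<open>The substitution \<open>Y = Q p^(-2) y\<close> turns both products into those of
  \<open>serre_sum_zero\<close>. Taking \<open>Q\<close> out of the second one leaves
  \<open>Q^(n+1-k) = Q^(n+1) p^(n k)\<close>, which is where the power \<open>p ^ (n * k)\<close> in
  that sum comes from.\<close>

lemma serre_polynomial:
  fixes p y :: complex and n :: nat
  assumes p: "\<forall>n>0. p ^ n \<noteq> 1" "p \<noteq> 0"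
  defines "Q \<equiv> inverse p ^ n"
  shows "(\<Sum>k=0..Suc n. (- 1) ^ k * qbinom p (Suc n) k *
      ((\<Prod>t=1..k. Q * (inverse p ^ (2 * t) * y) - 1) * (\<Prod>t=k+1..Suc n. inverse p ^ (2 * t) * y - Q))) = 0"
proof -
  define Y where "Y = Q * inverse p ^ 2 * y"
  have ip: "p ^ k * inverse p ^ k = 1" for k
    using p(2) by (simp add: power_mult_distrib[symmetric] del: power_Suc)
  have 1: "(\<Prod>t=1..k. Q * (inverse p ^ (2 * t) * y) - 1) = (\<Prod>s<k. inverse p ^ (2 * s) * Y - 1)" for k
    by (simp add: prod.atLeast1_atMost_eq Y_def power_add mult_ac power2_eq_square)
  have 2: "(\<Prod>t=k+1..Suc n. inverse p ^ (2 * t) * y - Q) = Q ^ (Suc n - k) * (\<Prod>s<Suc n - k. p ^ (2 * s) * Y - 1)"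
    if "k \<le> Suc n" for k
  proof -
    have "(\<Prod>t=k+1..Suc n. inverse p ^ (2 * t) * y - Q) = (\<Prod>s<Suc n - k. Q * (p ^ (2 * s) * Y - 1))"
    proof (rule prod.reindex_bij_witness[of _ "\<lambda>s. Suc n - s" "\<lambda>t. Suc n - t"])
      fix t assume t: "t \<in> {k+1..Suc n}"
      then obtain s where s: "Suc n = t + s" using le_Suc_ex by auto
      have "Q * (p ^ (2 * s) * Y) = Q * Q * p ^ (2 * s) * inverse p ^ 2 * y"
        by (simp add: Y_def mult_ac)
      also have "Q * Q * p ^ (2 * s) * inverse p ^ 2 = inverse p ^ (2 * (Suc n)) * p ^ (2 * s)"
        unfolding Q_def by (simp only: power_add[symmetric] mult_ac) (simp add: power_add[symmetric] mult_2_right power2_eq_square)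
      also have "\<dots> = inverse p ^ (2 * t)"
        unfolding s distrib_left power_add using ip[of "2 * s"] by (simp add: mult_ac)
      finally show "Q * (p ^ (2 * (Suc n - t)) * Y - 1) = inverse p ^ (2 * t) * y - Q"
        using s by (simp add: right_diff_distrib)
    qed auto
    then show ?thesis by (simp add: prod.distrib)
  qed
  have Q: "Q ^ (Suc n - k) = Q ^ Suc n * p ^ (n * k)" if "k \<le> Suc n" for k
  proof -
    have "Q ^ Suc n = Q ^ (Suc n - k) * Q ^ k" using that by (simp add: power_add[symmetric] del: power_Suc)
    moreover have "Q ^ k * p ^ (n * k) = 1"
      using ip[of "n * k"] by (simp add: Q_def power_mult[symmetric] mult_ac)
    ultimately show ?thesis by (simp add: mult.assoc del: power_Suc)
  qed
  have "(\<Sum>k=0..Suc n. (- 1) ^ k * qbinom p (Suc n) k *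
      ((\<Prod>t=1..k. Q * (inverse p ^ (2 * t) * y) - 1) * (\<Prod>t=k+1..Suc n. inverse p ^ (2 * t) * y - Q)))
    = (\<Sum>k=0..Suc n. Q ^ Suc n * ((- 1) ^ k * qbinom p (Suc n) k * p ^ (n * k) *
      (\<Prod>s<k. inverse p ^ (2 * s) * Y - 1) * (\<Prod>s<Suc n - k. p ^ (2 * s) * Y - 1)))"
  proof (rule sum.cong[OF refl])
    fix k assume "k \<in> {0..Suc n}"
    then have k: "k \<le> Suc n" by simp
    show "(- 1) ^ k * qbinom p (Suc n) k *
      ((\<Prod>t=1..k. Q * (inverse p ^ (2 * t) * y) - 1) * (\<Prod>t=k+1..Suc n. inverse p ^ (2 * t) * y - Q))
    = Q ^ Suc n * ((- 1) ^ k * qbinom p (Suc n) k * p ^ (n * k) *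
      (\<Prod>s<k. inverse p ^ (2 * s) * Y - 1) * (\<Prod>s<Suc n - k. p ^ (2 * s) * Y - 1))"
      unfolding 1 2[OF k] Q[OF k] by (simp only: mult_ac)
  qed
  then show ?thesis
    using serre_sum_zero[OF p, of n Y] by (simp add: sum_distrib_left[symmetric] atLeast0AtMost del: sum.atMost_Suc)
qed

section \<open>Sorting symmetrised words in two operators\<close>

lemma complex_vector_double_zero:
  fixes x :: "'a::complex_vector"
  assumes "x + x = 0"
  shows "x = 0"
proof -
  have "(2::complex) *\<^sub>C x = 0"
    using assms scaleC_add_left[of 1 1 x] by (simp add: scaleC_one)
  then show ?thesis by (simp add: complex_vector.scale_eq_0_iff)
qed

lemma scaleC_sum_right: "c *\<^sub>C (\<Sum>x\<in>A. f x) = (\<Sum>x\<in>A. c *\<^sub>C f x)"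
  by (rule complex_vector.scale_sum_right)

lemma scaleC_sum_left: "(\<Sum>x\<in>A. f x) *\<^sub>C c = (\<Sum>x\<in>A. f x *\<^sub>C c)"
  by (rule complex_vector.scale_sum_left)

definition affine_word :: "(nat \<Rightarrow> 'a::ring_1) \<Rightarrow> (nat \<Rightarrow> 'a) \<Rightarrow> nat set \<Rightarrow> nat \<Rightarrow> 'a" where
  "affine_word Y1 Y0 S m = prod_list (map (\<lambda>t. if t \<in> S then Y1 t else Y0 t) [1..<Suc m])"

text \<open>The noncommutative counterpart of \<open>prod_add\<close>: scalars are collected over
  the subset of positions where \<open>Y1\<close> is chosen, while the order of the operators is
  kept.\<close>

lemma affine_word_expand:
  fixes Y1 Y0 :: "nat \<Rightarrow> 'a::complex_algebra_1"
  shows "prod_list (map (\<lambda>t. \<alpha> t *\<^sub>C Y1 t + \<beta> t *\<^sub>C Y0 t) [1..<Suc m]) =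
    (\<Sum>S\<in>Pow {1..m}. ((\<Prod>t\<in>S. \<alpha> t) * (\<Prod>t\<in>{1..m} - S. \<beta> t)) *\<^sub>C affine_word Y1 Y0 S m)"
proof (induction m)
  case 0
  then show ?case by (simp add: affine_word_def scaleC_one)
next
  case (Suc m)
  let ?c = "\<lambda>m S. (\<Prod>t\<in>S. \<alpha> t) * (\<Prod>t\<in>{1..m} - S. \<beta> t)"
  have ins: "{1..Suc m} = insert (Suc m) {1..m}" by auto
  have W: "affine_word Y1 Y0 S (Suc m) = affine_word Y1 Y0 S m * Y0 (Suc m)"
    "affine_word Y1 Y0 (insert (Suc m) S) (Suc m) = affine_word Y1 Y0 S m * Y1 (Suc m)"
    if "S \<in> Pow {1..m}" for S
  proof -
    have S: "t \<in> S \<Longrightarrow> t \<noteq> Suc m" for t using that by auto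
    have l: "[1..<Suc (Suc m)] = [1..<Suc m] @ [Suc m]" by simp
    have e: "map (\<lambda>t. if t \<in> insert (Suc m) S then Y1 t else Y0 t) [1..<Suc m]
        = map (\<lambda>t. if t \<in> S then Y1 t else Y0 t) [1..<Suc m]"
      by (rule map_cong) auto
    show "affine_word Y1 Y0 (insert (Suc m) S) (Suc m) = affine_word Y1 Y0 S m * Y1 (Suc m)"
      unfolding affine_word_def l map_append prod_list.append e by simp
    show "affine_word Y1 Y0 S (Suc m) = affine_word Y1 Y0 S m * Y0 (Suc m)"
      unfolding affine_word_def l map_append prod_list.append using S by auto
  qed
  have C: "?c (Suc m) S = ?c m S * \<beta> (Suc m)" "?c (Suc m) (insert (Suc m) S) = ?c m S * \<alpha> (Suc m)"
    if "S \<in> Pow {1..m}" for S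
  proof -
    have "Suc m \<notin> S" "finite S" using that finite_subset[of S "{1..m}"] by auto
    moreover have "{1..Suc m} - S = insert (Suc m) ({1..m} - S)" "{1..Suc m} - insert (Suc m) S = {1..m} - S"
      using \<open>Suc m \<notin> S\<close> by auto
    ultimately show "?c (Suc m) S = ?c m S * \<beta> (Suc m)" "?c (Suc m) (insert (Suc m) S) = ?c m S * \<alpha> (Suc m)"
      by simp_all
  qed
  have inj: "inj_on (insert (Suc m)) (Pow {1..m})"
  proof (rule inj_onI)
    fix S T assume "S \<in> Pow {1..m}" "T \<in> Pow {1..m}" "insert (Suc m) S = insert (Suc m) T"
    moreover have "Suc m \<notin> S" "Suc m \<notin> T" using calculation(1,2) by auto
    ultimately show "S = T" by (simp add: insert_ident)
  qed
  have "prod_list (map (\<lambda>t. \<alpha> t *\<^sub>C Y1 t + \<beta> t *\<^sub>C Y0 t) [1..<Suc (Suc m)])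
      = (\<Sum>S\<in>Pow {1..m}. ?c m S *\<^sub>C affine_word Y1 Y0 S m) * (\<alpha> (Suc m) *\<^sub>C Y1 (Suc m) + \<beta> (Suc m) *\<^sub>C Y0 (Suc m))"
    using Suc.IH by (simp add: upt_Suc_append del: upt_Suc)
  also have "\<dots> = (\<Sum>S\<in>Pow {1..m}. ?c (Suc m) S *\<^sub>C affine_word Y1 Y0 S (Suc m))
      + (\<Sum>S\<in>Pow {1..m}. ?c (Suc m) (insert (Suc m) S) *\<^sub>C affine_word Y1 Y0 (insert (Suc m) S) (Suc m))"
    unfolding sum.distrib[symmetric] sum_distrib_right
    by (intro sum.cong refl) (simp only: W C distrib_left mult_scaleC_left mult_scaleC_right scaleC_scaleC add.commute mult.commute mult.left_commute mult.assoc)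
  also have "\<dots> = (\<Sum>S\<in>Pow {1..Suc m}. ?c (Suc m) S *\<^sub>C affine_word Y1 Y0 S (Suc m))"
    unfolding ins Pow_insert using inj
    by (subst sum.union_disjoint) (auto simp: sum.reindex ins[symmetric])
  finally show ?case .
qed

text \<open>Sorting by adjacent moves: an element with a free place on its right moves there, and
  the only sets that admit no move are the final segments of \<open>{1..m}\<close>.\<close>

lemma set_shift_induct:
  fixes S :: "nat set"
  assumes "S \<subseteq> {1..m}"
    and step: "\<And>S t. S \<subseteq> {1..m} \<Longrightarrow> t \<in> S \<Longrightarrow> t + 1 \<notin> S \<Longrightarrow> t < m \<Longrightarrow> P (insert (t + 1) (S - {t})) \<Longrightarrow> P S"
    and base: "\<And>j. j \<le> m \<Longrightarrow> card S = j \<Longrightarrow> P {m - j + 1..m}"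
  shows "P S"
  using assms(1) base
\<comment> \<open>A move keeps the cardinality and raises the sum by one, and the sum never exceeds
  \<open>m * card S\<close>.\<close>
proof (induction "m * card S - \<Sum>S" arbitrary: S rule: less_induct)
  case less
  have fin: "finite S" using less.prems(1) finite_subset by blast
  show ?case
  proof (cases "\<exists>t\<in>S. t + 1 \<notin> S \<and> t < m")
    case True
    then obtain t where t: "t \<in> S" "t + 1 \<notin> S" "t < m" by blast
    let ?S = "insert (t + 1) (S - {t})"
    have sub: "?S \<subseteq> {1..m}" using less.prems(1) t by auto
    have card: "card ?S = card S" using card.remove[OF fin t(1)] fin t by (simp del: card_Diff_insert)
    have sum: "\<Sum>?S = \<Sum>S + 1" using fin t sum.remove[OF fin t(1), of "\<lambda>x. x"] by simp
    have "\<Sum>?S \<le> m * card ?S"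
      using sum_bounded_above[of ?S "\<lambda>x. x" m] subsetD[OF sub] by (simp only: atLeastAtMost_iff of_nat_id mult.commute)
    then have "m * card ?S - \<Sum>?S < m * card S - \<Sum>S" using card sum by simp
    then have "P ?S" by (rule less.hyps) (use sub less.prems(2) card in auto)
    then show ?thesis by (rule step[OF less.prems(1) t])
  next
    case False
    have up: "t + k \<le> m \<Longrightarrow> t + k \<in> S" if "t \<in> S" for t k
      by (induction k) (use that False in auto)
    have "S = {m - card S + 1..m}"
    proof (cases "S = {}")
      case False
      let ?a = "Min S"
      have a: "?a \<in> S" "\<And>t. t \<in> S \<Longrightarrow> ?a \<le> t" using Min_in[OF fin False] fin by auto
      have "t \<in> S" if "?a \<le> t" "t \<le> m" for t
        using up[OF a(1), of "t - ?a"] that by simp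
      then have S: "S = {?a..m}" using a(2) less.prems(1) by fastforce
      moreover have "1 \<le> ?a" "?a \<le> m" using less.prems(1) a(1) by auto
      moreover have "card S = Suc m - ?a" using arg_cong[OF S, of card] by simp
      ultimately show ?thesis by simp
    qed simp
    moreover have "card S \<le> m" using card_mono[OF _ less.prems(1)] by simp
    ultimately show ?thesis using less.prems(2)[of "card S"] by simp
  qed
qed

definition sym_word :: "(nat \<Rightarrow> 'a::complex_algebra_1) \<Rightarrow> (nat \<Rightarrow> 'a) \<Rightarrow> nat \<Rightarrow> nat set \<Rightarrow> 'a" where
  "sym_word Y1 Y0 m S = (\<Sum>\<sigma> | \<sigma> permutes {1..m}. affine_word (\<lambda>t. Y1 (\<sigma> t)) (\<lambda>t. Y0 (\<sigma> t)) S m)"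

text \<open>\<open>rel\<close> is a commutation rule only after symmetrisation in \<open>a\<close>
  and \<open>b\<close>. Pairing each permutation with its composite with the transposition of
  \<open>t\<close> and \<open>t + 1\<close> makes the defects cancel in pairs, so twice their sum is
  zero.\<close>

lemma sym_word_step:
  fixes Y1 Y0 :: "nat \<Rightarrow> 'a::complex_algebra_1"
  assumes rel: "\<And>a b. a \<in> {1..m} \<Longrightarrow> b \<in> {1..m} \<Longrightarrow> a \<noteq> b \<Longrightarrow>
      Y1 a * Y0 b - c *\<^sub>C (Y0 a * Y1 b) = c *\<^sub>C (Y0 b * Y1 a) - Y1 b * Y0 a"
    and S: "S \<subseteq> {1..m}" "t \<in> S" "t + 1 \<notin> S" "t < m"
  shows "sym_word Y1 Y0 m S = c *\<^sub>C sym_word Y1 Y0 m (insert (t + 1) (S - {t}))"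
proof -
  let ?T = "insert (t + 1) (S - {t})"
  let ?\<tau> = "Transposition.transpose t (t + 1)"
  define U where "U \<sigma> = prod_list (map (\<lambda>t. if t \<in> S then Y1 (\<sigma> t) else Y0 (\<sigma> t)) [1..<t])" for \<sigma>
  define V where "V \<sigma> = prod_list (map (\<lambda>t. if t \<in> S then Y1 (\<sigma> t) else Y0 (\<sigma> t)) [t+2..<Suc m])" for \<sigma>
  define W where "W \<sigma> S = affine_word (\<lambda>t. Y1 (\<sigma> t)) (\<lambda>t. Y0 (\<sigma> t)) S m" for \<sigma> S
  have t1: "1 \<le> t" using S(1,2) by auto
  have l: "[1..<Suc m] = [1..<t] @ [t, t + 1] @ [t+2..<Suc m]"
  proof -
    have "[1..<Suc m] = [1..<t] @ [t..<Suc m]"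
      using t1 S(4) by (metis le_add_diff_inverse less_imp_le_nat less_SucI upt_add_eq_append)
    also have "[t..<Suc m] = [t, t + 1] @ [t+2..<Suc m]"
      using S(4) by (simp add: upt_conv_Cons del: upt_Suc)
    finally show ?thesis .
  qed
  have WS: "W \<sigma> S = U \<sigma> * (Y1 (\<sigma> t) * Y0 (\<sigma> (t + 1))) * V \<sigma>" for \<sigma>
    unfolding W_def affine_word_def l U_def V_def using S(2,3) by (simp add: mult.assoc)
  have WT: "W \<sigma> ?T = U \<sigma> * (Y0 (\<sigma> t) * Y1 (\<sigma> (t + 1))) * V \<sigma>" for \<sigma>
  proof -
    have e: "map (\<lambda>s. if s \<in> ?T then Y1 (\<sigma> s) else Y0 (\<sigma> s)) [1..<t] = map (\<lambda>s. if s \<in> S then Y1 (\<sigma> s) else Y0 (\<sigma> s)) [1..<t]"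
      "map (\<lambda>s. if s \<in> ?T then Y1 (\<sigma> s) else Y0 (\<sigma> s)) [t+2..<Suc m] = map (\<lambda>s. if s \<in> S then Y1 (\<sigma> s) else Y0 (\<sigma> s)) [t+2..<Suc m]"
      by (rule map_cong; auto)+
    show ?thesis
      unfolding W_def affine_word_def l U_def V_def map_append prod_list.append e by (simp add: mult.assoc)
  qed
  have UV: "U (\<sigma> \<circ> ?\<tau>) = U \<sigma>" "V (\<sigma> \<circ> ?\<tau>) = V \<sigma>" for \<sigma>
    unfolding U_def V_def by (rule arg_cong[where f = prod_list], rule map_cong; auto simp: Transposition.transpose_def)+
  define F where "F \<sigma> = W \<sigma> S - c *\<^sub>C W \<sigma> ?T" for \<sigma>
  have zero: "F \<sigma> + F (\<sigma> \<circ> ?\<tau>) = 0" if "\<sigma> permutes {1..m}" for \<sigma>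
  proof -
    let ?a = "\<sigma> t" and ?b = "\<sigma> (t + 1)"
    have ab: "?a \<in> {1..m}" "?b \<in> {1..m}" "?a \<noteq> ?b"
      using permutes_in_image[OF that] permutes_inj[OF that] t1 S(4) by (auto simp: inj_eq)
    have F1: "F \<sigma> = U \<sigma> * (Y1 ?a * Y0 ?b - c *\<^sub>C (Y0 ?a * Y1 ?b)) * V \<sigma>"
      unfolding F_def WS WT by (simp add: right_diff_distrib left_diff_distrib mult_scaleC_left mult_scaleC_right)
    have F2: "F (\<sigma> \<circ> ?\<tau>) = U \<sigma> * (Y1 ?b * Y0 ?a - c *\<^sub>C (Y0 ?b * Y1 ?a)) * V \<sigma>"
      unfolding F_def WS WT UV by (simp add: right_diff_distrib left_diff_distrib mult_scaleC_left mult_scaleC_right)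
    show ?thesis
      unfolding F1 F2 rel[OF ab] by (simp add: right_diff_distrib left_diff_distrib)
  qed
  have "sum F {\<sigma>. \<sigma> permutes {1..m}} = (\<Sum>\<sigma> | \<sigma> permutes {1..m}. F (\<sigma> \<circ> ?\<tau>))"
    by (rule sum_permutations_compose_right) (use t1 S(4) in \<open>auto intro: permutes_swap_id\<close>)
  moreover have "sum F {\<sigma>. \<sigma> permutes {1..m}} + (\<Sum>\<sigma> | \<sigma> permutes {1..m}. F (\<sigma> \<circ> ?\<tau>)) = 0"
    unfolding sum.distrib[symmetric] by (rule sum.neutral) (use zero in auto)
  ultimately have "sum F {\<sigma>. \<sigma> permutes {1..m}} + sum F {\<sigma>. \<sigma> permutes {1..m}} = 0"
    by simp
  then have "sum F {\<sigma>. \<sigma> permutes {1..m}} = 0"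
    by (rule complex_vector_double_zero)
  then show ?thesis
    by (simp add: F_def sum_subtractf W_def sym_word_def scaleC_sum_right)
qed

text \<open>A move to the right divides the weight \<open>p^(-2t)\<close> of the moved position by
  \<open>p^2\<close>, and the symmetrised word before the move is \<open>p^2\<close> times the one
  after it. The quotient of word and weight is therefore unchanged by sorting and depends on
  \<open>card S\<close> alone; the positive power of \<open>p\<close> is the inverse weight of the
  sorted set.\<close>

lemma sym_word_eq:
  fixes Y1 Y0 :: "nat \<Rightarrow> 'a::complex_algebra_1"
  assumes rel: "\<And>a b. a \<in> {1..m} \<Longrightarrow> b \<in> {1..m} \<Longrightarrow> a \<noteq> b \<Longrightarrow>
      Y1 a * Y0 b - p\<^sup>2 *\<^sub>C (Y0 a * Y1 b) = p\<^sup>2 *\<^sub>C (Y0 b * Y1 a) - Y1 b * Y0 a"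
    and p: "p \<noteq> 0" and S: "S \<subseteq> {1..m}"
  shows "sym_word Y1 Y0 m S = (\<Prod>t\<in>S. inverse p ^ (2 * t)) *\<^sub>C
    (p ^ (2 * \<Sum>{m - card S + 1..m}) *\<^sub>C sym_word Y1 Y0 m {m - card S + 1..m})"
    (is "?L S = ?R S")
proof (rule set_shift_induct[OF S, where P = "\<lambda>S. ?L S = ?R S"])
  fix S t assume S: "S \<subseteq> {1..m}" "t \<in> S" "t + 1 \<notin> S" "t < m"
    and IH: "?L (insert (t + 1) (S - {t})) = ?R (insert (t + 1) (S - {t}))"
  have fin: "finite S" using S(1) finite_subset by blast
  let ?T = "insert (t + 1) (S - {t})"
  have card: "card ?T = card S" using card.remove[OF fin S(2)] fin S(2,3) by (simp del: card_Diff_insert)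
  have "(\<Prod>s\<in>?T. inverse p ^ (2 * s)) = inverse p ^ (2 * (t + 1)) * (\<Prod>s\<in>S - {t}. inverse p ^ (2 * s))"
    using fin S(3) by (subst prod.insert) auto
  moreover have "p\<^sup>2 * inverse p ^ (2 * (t + 1)) = inverse p ^ (2 * t)"
  proof -
    have "p\<^sup>2 * inverse p ^ 2 = 1" using p by (simp add: power_mult_distrib[symmetric])
    then show ?thesis
      by (simp only: distrib_left power_add mult_1_right mult.left_commute[of _ "inverse p ^ (2 * t)"])
  qed
  ultimately have "p\<^sup>2 * (\<Prod>s\<in>?T. inverse p ^ (2 * s)) = inverse p ^ (2 * t) * (\<Prod>s\<in>S - {t}. inverse p ^ (2 * s))"
    by (simp only: mult.assoc[symmetric])
  also have "\<dots> = (\<Prod>s\<in>S. inverse p ^ (2 * s))"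
    by (rule prod.remove[symmetric, OF fin S(2)])
  finally have pr: "p\<^sup>2 * (\<Prod>s\<in>?T. inverse p ^ (2 * s)) = (\<Prod>s\<in>S. inverse p ^ (2 * s))" .
  show "?L S = ?R S"
  proof -
    have "?L S = p\<^sup>2 *\<^sub>C ?L ?T" by (rule sym_word_step[OF rel S])
    also have "\<dots> = ?R S" unfolding IH card scaleC_scaleC pr[symmetric] by (simp only: mult.assoc)
    finally show ?thesis .
  qed
next
  fix j assume j: "j \<le> m"
  let ?S = "{m - j + 1..m}"
  have "card ?S = j" using j by simp
  moreover have "(\<Prod>t\<in>?S. inverse p ^ (2 * t)) * p ^ (2 * \<Sum>?S) = 1"
    using p by (simp add: power_sum[symmetric] sum_distrib_left[symmetric] power_mult_distrib[symmetric])
  ultimately show "?L ?S = ?R ?S" by (simp only: scaleC_scaleC scaleC_one)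
qed


text \<open>After expansion and sorting only one operator \<open>\<kappa> j\<close> remains for each
  number \<open>j\<close> of factors \<open>Y1\<close>. The scalars multiplying the
  \<open>\<kappa> j\<close> are the coefficients of a polynomial that
  \<open>serre_polynomial\<close> evaluates to zero everywhere.\<close>

lemma serre_symmetrized:
  fixes Y1 Y0 :: "nat \<Rightarrow> 'a::complex_algebra_1" and n :: nat and p :: complex
  assumes p: "\<forall>n>0. p ^ n \<noteq> 1" "p \<noteq> 0" and m: "m = Suc n"
    and rel: "\<And>a b. a \<in> {1..m} \<Longrightarrow> b \<in> {1..m} \<Longrightarrow> a \<noteq> b \<Longrightarrow>
      Y1 a * Y0 b - p\<^sup>2 *\<^sub>C (Y0 a * Y1 b) = p\<^sup>2 *\<^sub>C (Y0 b * Y1 a) - Y1 b * Y0 a"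
  defines "Q \<equiv> inverse p ^ n"
  shows "(\<Sum>\<sigma> | \<sigma> permutes {1..m}. \<Sum>k=0..m. ((- 1) ^ k * qbinom p m k) *\<^sub>C
           (prod_list (map (\<lambda>t. Q *\<^sub>C Y1 (\<sigma> t) - Y0 (\<sigma> t)) [1..<k + 1]) *
            prod_list (map (\<lambda>t. Y1 (\<sigma> t) - Q *\<^sub>C Y0 (\<sigma> t)) [k + 1..<m + 1]))) = 0"
proof -
  define c where "c k = (- 1) ^ k * qbinom p m k" for k
  \<comment> \<open>\<open>\<alpha> k t\<close> and \<open>\<beta> k t\<close> are the scalars of
    \<open>Y1\<close> and \<open>Y0\<close> at position \<open>t\<close>; they change after position
    \<open>k\<close>, where the operator of the other node stood.\<close>
  define \<alpha> where "\<alpha> k t = (if t \<le> k then Q else 1)" for k t :: nat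
  define \<beta> where "\<beta> k t = (if t \<le> k then - 1 else - Q)" for k t :: nat
  define C where "C k S = (\<Prod>t\<in>S. \<alpha> k t) * (\<Prod>t\<in>{1..m} - S. \<beta> k t)" for k S
  define \<kappa> where "\<kappa> j = p ^ (2 * \<Sum>{m - j + 1..m}) *\<^sub>C sym_word Y1 Y0 m {m - j + 1..m}" for j
  define e where "e S = (\<Prod>t\<in>S. inverse p ^ (2 * t))" for S
  have word: "prod_list (map (\<lambda>t. Q *\<^sub>C Y1 (\<sigma> t) - Y0 (\<sigma> t)) [1..<k + 1]) *
            prod_list (map (\<lambda>t. Y1 (\<sigma> t) - Q *\<^sub>C Y0 (\<sigma> t)) [k + 1..<m + 1])
      = (\<Sum>S\<in>Pow {1..m}. C k S *\<^sub>C affine_word (\<lambda>t. Y1 (\<sigma> t)) (\<lambda>t. Y0 (\<sigma> t)) S m)"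
    if "k \<le> m" for k \<sigma>
  proof -
    have l: "[1..<Suc m] = [1..<k + 1] @ [k + 1..<m + 1]"
      using that upt_add_eq_append[of 1 "k + 1" "m - k"] by simp
    have e: "map (\<lambda>t. \<alpha> k t *\<^sub>C Y1 (\<sigma> t) + \<beta> k t *\<^sub>C Y0 (\<sigma> t)) [1..<k + 1] = map (\<lambda>t. Q *\<^sub>C Y1 (\<sigma> t) - Y0 (\<sigma> t)) [1..<k + 1]"
      "map (\<lambda>t. \<alpha> k t *\<^sub>C Y1 (\<sigma> t) + \<beta> k t *\<^sub>C Y0 (\<sigma> t)) [k + 1..<m + 1] = map (\<lambda>t. Y1 (\<sigma> t) - Q *\<^sub>C Y0 (\<sigma> t)) [k + 1..<m + 1]"
      by (rule map_cong; auto simp: \<alpha>_def \<beta>_def scaleC_one)+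
    show ?thesis
      unfolding C_def affine_word_expand[of "\<alpha> k" "\<lambda>t. Y1 (\<sigma> t)" "\<beta> k" "\<lambda>t. Y0 (\<sigma> t)", symmetric]
      unfolding l map_append prod_list.append e ..
  qed
  \<comment> \<open>Replacing \<open>Y1\<close> at position \<open>t\<close> by the number
    \<open>p^(-2t) y\<close> and \<open>Y0\<close> by 1 mimics sorted words: the sum over subsets
    becomes a product over positions, and \<open>y\<close> records the cardinality.\<close>
  have poly: "(\<Sum>S\<in>Pow {1..m}. (\<Sum>k=0..m. c k * C k S) * e S * y ^ card S) = 0" for y
  proof -
    have C: "C k S * e S * y ^ card S = (\<Prod>t\<in>S. \<alpha> k t * (inverse p ^ (2 * t) * y)) * (\<Prod>t\<in>{1..m} - S. \<beta> k t)" for k S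
      by (simp add: C_def e_def prod.distrib mult_ac)
    have pr: "(\<Sum>S\<in>Pow {1..m}. C k S * e S * y ^ card S)
        = (\<Prod>t=1..k. Q * (inverse p ^ (2 * t) * y) - 1) * (\<Prod>t=k+1..Suc n. inverse p ^ (2 * t) * y - Q)"
      if "k \<le> m" for k
    proof -
      have "(\<Sum>S\<in>Pow {1..m}. C k S * e S * y ^ card S) = (\<Prod>t=1..m. \<alpha> k t * (inverse p ^ (2 * t) * y) + \<beta> k t)"
        unfolding C by (rule prod_add[symmetric]) simp
      also have "\<dots> = (\<Prod>t=1..k. \<alpha> k t * (inverse p ^ (2 * t) * y) + \<beta> k t) * (\<Prod>t=k+1..m. \<alpha> k t * (inverse p ^ (2 * t) * y) + \<beta> k t)"
      proof -
        have iv: "{1..m} = {1..k} \<union> {k+1..m}" using that by auto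
        show ?thesis unfolding iv by (rule prod.union_disjoint) auto
      qed
      also have "(\<Prod>t=1..k. \<alpha> k t * (inverse p ^ (2 * t) * y) + \<beta> k t) = (\<Prod>t=1..k. Q * (inverse p ^ (2 * t) * y) - 1)"
        by (rule prod.cong) (auto simp: \<alpha>_def \<beta>_def)
      also have "(\<Prod>t=k+1..m. \<alpha> k t * (inverse p ^ (2 * t) * y) + \<beta> k t) = (\<Prod>t=k+1..Suc n. inverse p ^ (2 * t) * y - Q)"
        unfolding m by (rule prod.cong) (auto simp: \<alpha>_def \<beta>_def)
      finally show ?thesis .
    qed
    have "(\<Sum>S\<in>Pow {1..m}. (\<Sum>k=0..m. c k * C k S) * e S * y ^ card S)
        = (\<Sum>S\<in>Pow {1..m}. \<Sum>k=0..m. c k * (C k S * e S * y ^ card S))"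
      by (simp only: sum_distrib_right mult.assoc)
    also have "\<dots> = (\<Sum>k=0..m. c k * (\<Sum>S\<in>Pow {1..m}. C k S * e S * y ^ card S))"
      by (subst sum.swap) (simp only: sum_distrib_left)
    also have "\<dots> = (\<Sum>k=0..Suc n. c k * ((\<Prod>t=1..k. Q * (inverse p ^ (2 * t) * y) - 1) * (\<Prod>t=k+1..Suc n. inverse p ^ (2 * t) * y - Q)))"
    proof (rule sum.cong)
      fix k assume "k \<in> {0..Suc n}"
      then have "k \<le> m" by (simp add: m)
      from pr[OF this] show "c k * (\<Sum>S\<in>Pow {1..m}. C k S * e S * y ^ card S) = c k *
          ((\<Prod>t=1..k. Q * (inverse p ^ (2 * t) * y) - 1) * (\<Prod>t=k+1..Suc n. inverse p ^ (2 * t) * y - Q))"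
        by (simp only:)
    qed (simp only: m)
    also have "\<dots> = 0"
      unfolding c_def m Q_def by (rule serre_polynomial[OF p])
    finally show ?thesis .
  qed
  have fin: "finite (Pow {1..m})" by simp
  have card_le: "card S \<le> m" if "S \<in> Pow {1..m}" for S
    using that card_mono[of "{1..m}" S] by simp
  define G where "G S = (\<Sum>k=0..m. c k * C k S) * e S" for S
  have "(\<Sum>j\<le>m. (\<Sum>S | S \<in> Pow {1..m} \<and> card S = j. G S) * y ^ j) = 0" for y
  proof -
    have "(\<Sum>j\<le>m. (\<Sum>S | S \<in> Pow {1..m} \<and> card S = j. G S) * y ^ j)
        = (\<Sum>j\<le>m. (\<Sum>S | S \<in> Pow {1..m} \<and> card S = j. G S * y ^ card S))"
      by (simp add: sum_distrib_right)
    also have "\<dots> = (\<Sum>S\<in>Pow {1..m}. G S * y ^ card S)"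
      by (rule sum.group[OF fin]) (use card_le in auto)
    finally show ?thesis using poly[of y] by (simp add: G_def)
  qed
  then have coeff: "(\<Sum>S | S \<in> Pow {1..m} \<and> card S = j. G S) = 0" if "j \<le> m" for j
    using polyfun_eq_0[of "\<lambda>j. \<Sum>S | S \<in> Pow {1..m} \<and> card S = j. G S" m] that by simp
  have "(\<Sum>\<sigma> | \<sigma> permutes {1..m}. \<Sum>k=0..m. c k *\<^sub>C
           (prod_list (map (\<lambda>t. Q *\<^sub>C Y1 (\<sigma> t) - Y0 (\<sigma> t)) [1..<k + 1]) *
            prod_list (map (\<lambda>t. Y1 (\<sigma> t) - Q *\<^sub>C Y0 (\<sigma> t)) [k + 1..<m + 1])))
      = (\<Sum>\<sigma> | \<sigma> permutes {1..m}. \<Sum>k=0..m. \<Sum>S\<in>Pow {1..m}. (c k * C k S) *\<^sub>C affine_word (\<lambda>t. Y1 (\<sigma> t)) (\<lambda>t. Y0 (\<sigma> t)) S m)"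
    by (intro sum.cong refl) (simp only: word scaleC_sum_right scaleC_scaleC atLeastAtMost_iff)
  also have "\<dots> = (\<Sum>\<sigma> | \<sigma> permutes {1..m}. \<Sum>S\<in>Pow {1..m}. (\<Sum>k=0..m. c k * C k S) *\<^sub>C affine_word (\<lambda>t. Y1 (\<sigma> t)) (\<lambda>t. Y0 (\<sigma> t)) S m)"
    unfolding scaleC_sum_left by (intro sum.cong refl sum.swap)
  also have "\<dots> = (\<Sum>S\<in>Pow {1..m}. (\<Sum>k=0..m. c k * C k S) *\<^sub>C sym_word Y1 Y0 m S)"
    by (subst sum.swap) (simp only: sym_word_def scaleC_sum_right)
  also have "\<dots> = (\<Sum>S\<in>Pow {1..m}. G S *\<^sub>C \<kappa> (card S))"
  proof (rule sum.cong[OF refl])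
    fix S assume "S \<in> Pow {1..m}"
    then have S: "S \<subseteq> {1..m}" by simp
    have eq: "sym_word Y1 Y0 m S = e S *\<^sub>C \<kappa> (card S)"
      unfolding e_def \<kappa>_def by (rule sym_word_eq[OF rel p(2) S])
    show "(\<Sum>k=0..m. c k * C k S) *\<^sub>C sym_word Y1 Y0 m S = G S *\<^sub>C \<kappa> (card S)"
      unfolding eq G_def scaleC_scaleC ..
  qed
  also have "\<dots> = (\<Sum>j\<le>m. \<Sum>S | S \<in> Pow {1..m} \<and> card S = j. G S *\<^sub>C \<kappa> (card S))"
    by (rule sum.group[symmetric, OF fin]) (use card_le in auto)
  also have "\<dots> = (\<Sum>j\<le>m. (\<Sum>S | S \<in> Pow {1..m} \<and> card S = j. G S) *\<^sub>C \<kappa> j)"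
    unfolding scaleC_sum_left by (intro sum.cong refl) simp
  also have "\<dots> = 0" by (rule sum.neutral) (use coeff in simp)
  finally show ?thesis unfolding c_def .
qed

section \<open>Relations between series of weighted shifts\<close>

lemma meromorphic_sev_powi_nonzero:
  "meromorphic_sev f \<Longrightarrow> (\<And>x. f x \<noteq> 0) \<Longrightarrow> meromorphic_sev (\<lambda>x. f x powi n)"
  by (intro meromorphic_sev_powi) auto

text \<open>All four products carry the translation \<open>b + c\<close>, so one identity between
  weights suffices. Relations with fewer terms are obtained by taking scalars equal to 0.\<close>

lemma weighted_shift_exchange:
  assumes mero: "meromorphic_sev \<phi>1" "meromorphic_sev \<psi>1" "meromorphic_sev \<phi>2" "meromorphic_sev \<psi>2"
      "meromorphic_sev \<phi>3" "meromorphic_sev \<psi>3" "meromorphic_sev \<phi>4" "meromorphic_sev \<psi>4"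
    and eq: "eventually (\<lambda>\<gamma>. \<alpha> * (\<phi>1 \<gamma> * \<psi>1 (\<gamma> + b)) + \<beta> * (\<phi>2 \<gamma> * \<psi>2 (\<gamma> + b)) =
      \<alpha>' * (\<phi>3 \<gamma> * \<psi>3 (\<gamma> + c)) + \<beta>' * (\<phi>4 \<gamma> * \<psi>4 (\<gamma> + c))) generic"
  shows "\<alpha> *\<^sub>C (weighted_shift \<phi>1 b * weighted_shift \<psi>1 c) + \<beta> *\<^sub>C (weighted_shift \<phi>2 b * weighted_shift \<psi>2 c)
    = \<alpha>' *\<^sub>C (weighted_shift \<phi>3 c * weighted_shift \<psi>3 b) + \<beta>' *\<^sub>C (weighted_shift \<phi>4 c * weighted_shift \<psi>4 b)"
proof -
  have s: "meromorphic_sev (\<lambda>\<gamma>. \<psi>1 (\<gamma> + b))" "meromorphic_sev (\<lambda>\<gamma>. \<psi>2 (\<gamma> + b))"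
    "meromorphic_sev (\<lambda>\<gamma>. \<psi>3 (\<gamma> + c))" "meromorphic_sev (\<lambda>\<gamma>. \<psi>4 (\<gamma> + c))"
    using mero by (auto intro: meromorphic_sev_shift)
  note intros = meromorphic_sev_mult meromorphic_sev_const meromorphic_sev_add mero s
  have cb: "c + b = b + c" by (rule add.commute)
  have m: "meromorphic_sev (\<lambda>\<gamma>. \<phi>1 \<gamma> * \<psi>1 (\<gamma> + b))" "meromorphic_sev (\<lambda>\<gamma>. \<phi>2 \<gamma> * \<psi>2 (\<gamma> + b))"
    "meromorphic_sev (\<lambda>\<gamma>. \<phi>3 \<gamma> * \<psi>3 (\<gamma> + c))" "meromorphic_sev (\<lambda>\<gamma>. \<phi>4 \<gamma> * \<psi>4 (\<gamma> + c))"
    by (rule meromorphic_sev_mult; rule mero s)+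
  have m': "meromorphic_sev (\<lambda>\<gamma>. a * f \<gamma>)" if "meromorphic_sev f" for a f
    by (rule meromorphic_sev_mult[OF meromorphic_sev_const that])
  show ?thesis
    unfolding weighted_shift_mult[OF mero(1,2)] weighted_shift_mult[OF mero(3,4)]
      weighted_shift_mult[OF mero(5,6)] weighted_shift_mult[OF mero(7,8)] cb
      weighted_shift_scaleC[OF m(1)] weighted_shift_scaleC[OF m(2)]
      weighted_shift_scaleC[OF m(3)] weighted_shift_scaleC[OF m(4)]
      weighted_shift_add[OF m'[OF m(1)] m'[OF m(2)]] weighted_shift_add[OF m'[OF m(3)] m'[OF m(4)]]
    by (rule weighted_shift_cong[OF _ _ eq]) (intro meromorphic_sev_add m' m)+
qed

text \<open>The coefficient of \<open>z\<^sup>e\<close> in the sum over \<open>k\<close> of \<open>\<delta>(z / X k) \<phi> k\<close> times the shift by \<open>b k\<close>.\<close>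

definition shift_series :: "nat \<Rightarrow> (nat \<Rightarrow> complex ^ 'v::finite \<Rightarrow> complex) \<Rightarrow>
    (nat \<Rightarrow> complex ^ 'v \<Rightarrow> complex) \<Rightarrow> (nat \<Rightarrow> complex ^ 'v) \<Rightarrow> int \<Rightarrow> 'v mero endo" where
  "shift_series N \<phi> X b e = (\<Sum>k=1..N. weighted_shift (\<lambda>\<gamma>. X k \<gamma> powi (- e) * \<phi> k \<gamma>) (b k))"

text \<open>On the support of the delta functions \<open>z\<close> and \<open>w\<close> may be
  replaced by their support points, the second one translated by the shift standing to its left. The
  factors \<open>z - A w\<close> and \<open>A z - w\<close> thus become the linear factors in
  \<open>eq\<close>.\<close>

lemma exchange_shift_series:
  assumes mero: "\<And>k. k \<in> {1..N} \<Longrightarrow> meromorphic_sev (\<phi> k)" "\<And>k. k \<in> {1..N} \<Longrightarrow> meromorphic_sev (X k)"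
      "\<And>k. k \<in> {1..M} \<Longrightarrow> meromorphic_sev (\<psi> k)" "\<And>k. k \<in> {1..M} \<Longrightarrow> meromorphic_sev (Y k)"
    and nz: "\<And>k \<gamma>. X k \<gamma> \<noteq> 0" "\<And>k \<gamma>. Y k \<gamma> \<noteq> 0"
    and eq: "\<And>k j e r. k \<in> {1..N} \<Longrightarrow> j \<in> {1..M} \<Longrightarrow> eventually (\<lambda>\<gamma>.
      \<phi> k \<gamma> * \<psi> j (\<gamma> + b k) * (X k \<gamma> powi e * Y j (\<gamma> + b k) powi r) * (X k \<gamma> - A * Y j (\<gamma> + b k)) =
      \<psi> j \<gamma> * \<phi> k (\<gamma> + c j) * (X k (\<gamma> + c j) powi e * Y j \<gamma> powi r) * (A * X k (\<gamma> + c j) - Y j \<gamma>)) generic"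
  shows "exchange_relation A (shift_series N \<phi> X b) (shift_series M \<psi> Y c)"
  unfolding exchange_relation_def times_linear_def
proof (intro ext)
  fix n r :: int
  define F where "F e k = weighted_shift (\<lambda>\<gamma>. X k \<gamma> powi (- e) * \<phi> k \<gamma>) (b k)" for e k
  define G where "G e k = weighted_shift (\<lambda>\<gamma>. Y k \<gamma> powi (- e) * \<psi> k \<gamma>) (c k)" for e k
  have S: "shift_series N \<phi> X b e = (\<Sum>k=1..N. F e k)" "shift_series M \<psi> Y c e = (\<Sum>j=1..M. G e j)" for e
    by (simp_all add: shift_series_def F_def G_def)
  have trm: "1 *\<^sub>C (F (n - 1) k * G r j) + (- A) *\<^sub>C (F n k * G (r - 1) j) = A *\<^sub>C (G r j * F (n - 1) k) + (- 1) *\<^sub>C (G (r - 1) j * F n k)"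
    if kj: "k \<in> {1..N}" "j \<in> {1..M}" for k j
    unfolding F_def G_def
  proof (rule weighted_shift_exchange)
    have p1: "x powi (- (n - 1)) = x powi (- n) * x" if "x \<noteq> 0" for x :: complex and n
      using that power_int_add_1[of x "- n"] by simp
    show "\<forall>\<^sub>F \<gamma> in generic. 1 * (X k \<gamma> powi (- (n - 1)) * \<phi> k \<gamma> * (Y j (\<gamma> + b k) powi (- r) * \<psi> j (\<gamma> + b k))) +
         (- A) * (X k \<gamma> powi (- n) * \<phi> k \<gamma> * (Y j (\<gamma> + b k) powi (- (r - 1)) * \<psi> j (\<gamma> + b k))) =
         A * (Y j \<gamma> powi (- r) * \<psi> j \<gamma> * (X k (\<gamma> + c j) powi (- (n - 1)) * \<phi> k (\<gamma> + c j))) +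
         (- 1) * (Y j \<gamma> powi (- (r - 1)) * \<psi> j \<gamma> * (X k (\<gamma> + c j) powi (- n) * \<phi> k (\<gamma> + c j)))"
      using eq[OF kj, of "- n" "- r"]
      by eventually_elim (simp only: p1[OF nz(1)] p1[OF nz(2)], simp add: algebra_simps)
  qed (use kj in \<open>auto intro!: meromorphic_sev_mult meromorphic_sev_powi_nonzero mero nz\<close>)
  have "1 *\<^sub>C (shift_series N \<phi> X b (n - 1) * shift_series M \<psi> Y c r) + (- A) *\<^sub>C (shift_series N \<phi> X b n * shift_series M \<psi> Y c (r - 1))
    = (\<Sum>k=1..N. \<Sum>j=1..M. 1 *\<^sub>C (F (n - 1) k * G r j) + (- A) *\<^sub>C (F n k * G (r - 1) j))"
    unfolding S sum_product scaleC_sum_right sum.distrib ..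
  also have "\<dots> = (\<Sum>k=1..N. \<Sum>j=1..M. A *\<^sub>C (G r j * F (n - 1) k) + (- 1) *\<^sub>C (G (r - 1) j * F n k))"
    by (intro sum.cong refl trm)
  also have "\<dots> = A *\<^sub>C (shift_series M \<psi> Y c r * shift_series N \<phi> X b (n - 1)) + (- 1) *\<^sub>C (shift_series M \<psi> Y c (r - 1) * shift_series N \<phi> X b n)"
    unfolding S sum_product scaleC_sum_right sum.distrib
    by (intro arg_cong2[where f = "(+)"] sum.swap)
  finally show "1 *\<^sub>C (shift_series N \<phi> X b (n - 1) * shift_series M \<psi> Y c r) + (- A) *\<^sub>C (shift_series N \<phi> X b n * shift_series M \<psi> Y c (r - 1))
    = A *\<^sub>C (shift_series M \<psi> Y c r * shift_series N \<phi> X b (n - 1)) + (- 1) *\<^sub>C (shift_series M \<psi> Y c (r - 1) * shift_series N \<phi> X b n)" .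
qed

lemma prod_list_commute_past:
  fixes f :: "'a::ring_1"
  assumes "\<And>t. t \<in> set ts \<Longrightarrow> f * S t = T t * f"
  shows "f * prod_list (map S ts) = prod_list (map T ts) * f"
  using assms
proof (induction ts)
  case (Cons t ts)
  have "f * prod_list (map S (t # ts)) = T t * (f * prod_list (map S ts))"
    using Cons.prems[of t] by (simp add: mult.assoc[symmetric])
  also have "\<dots> = T t * (prod_list (map T ts) * f)"
    using Cons by simp
  finally show ?case by (simp add: mult.assoc)
qed simp

text \<open>Dividing \<open>\<phi> k\<close> by \<open>Q X k - Y j\<close> turns the exchange with the \<open>j\<close>-th term of the second series
  into one of two affine expressions in the same pair of operators.\<close>

lemma serre_shift_series:
  fixes p Q :: complex and n :: nat
  assumes p: "\<forall>n>0. p ^ n \<noteq> 1" "p \<noteq> 0" and m: "m = Suc n" and Q: "Q = inverse p ^ n"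
    and qb: "\<And>k. qbinom q m k = qbinom p m k"
    and mero: "\<And>k. k \<in> {1..N} \<Longrightarrow> meromorphic_sev (\<phi> k)" "\<And>k. k \<in> {1..N} \<Longrightarrow> meromorphic_sev (X k)"
      "\<And>k. k \<in> {1..M} \<Longrightarrow> meromorphic_sev (\<psi> k)" "\<And>k. k \<in> {1..M} \<Longrightarrow> meromorphic_sev (Y k)"
    and nz: "\<And>k \<gamma>. X k \<gamma> \<noteq> 0" "\<And>k \<gamma>. Y k \<gamma> \<noteq> 0"
    and Xb: "\<And>k l \<gamma>. k \<in> {1..N} \<Longrightarrow> l \<in> {1..N} \<Longrightarrow> k \<noteq> l \<Longrightarrow> X k (\<gamma> + b l) = X k \<gamma>"
      "\<And>k \<gamma>. k \<in> {1..N} \<Longrightarrow> p\<^sup>2 * X k (\<gamma> + b k) = X k \<gamma>"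
    and Xc: "\<And>k j \<gamma>. k \<in> {1..N} \<Longrightarrow> j \<in> {1..M} \<Longrightarrow> X k (\<gamma> + c j) = X k \<gamma>"
    and Yb: "\<And>k j \<gamma>. k \<in> {1..N} \<Longrightarrow> j \<in> {1..M} \<Longrightarrow> Y j (\<gamma> + b k) = Y j \<gamma>"
    and self: "\<And>k l. k \<in> {1..N} \<Longrightarrow> l \<in> {1..N} \<Longrightarrow> k \<noteq> l \<Longrightarrow> eventually (\<lambda>\<gamma>.
      \<phi> k \<gamma> * \<phi> l (\<gamma> + b k) * (X k \<gamma> - p\<^sup>2 * X l \<gamma>) = \<phi> l \<gamma> * \<phi> k (\<gamma> + b l) * (p\<^sup>2 * X k \<gamma> - X l \<gamma>)) generic"
    and other: "\<And>k j. k \<in> {1..N} \<Longrightarrow> j \<in> {1..M} \<Longrightarrow> eventually (\<lambda>\<gamma>.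
      \<phi> k \<gamma> * \<psi> j (\<gamma> + b k) * (X k \<gamma> - Q * Y j \<gamma>) = \<psi> j \<gamma> * \<phi> k (\<gamma> + c j) * (Q * X k \<gamma> - Y j \<gamma>)) generic"
    and nz': "\<And>k j. k \<in> {1..N} \<Longrightarrow> j \<in> {1..M} \<Longrightarrow> eventually (\<lambda>\<gamma>. Q * X k \<gamma> - Y j \<gamma> \<noteq> 0) generic"
  shows "serre_relation q m (shift_series N \<phi> X b) (shift_series M \<psi> Y c)"
  unfolding serre_relation_def
proof (intro allI)
  fix e :: "nat \<Rightarrow> int" and r :: int
  define S where "S t = shift_series N \<phi> X b (e t)" for t
  define f where "f j = weighted_shift (\<lambda>\<gamma>. Y j \<gamma> powi (- r) * \<psi> j \<gamma>) (c j)" for j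
  \<comment> \<open>The poles of \<open>\<theta> j k\<close> are avoided generically by
    \<open>nz'\<close>.\<close>
  define \<theta> where "\<theta> j k \<gamma> = inverse (Q * X k \<gamma> - Y j \<gamma>)" for j k \<gamma>
  define \<eta>1 where "\<eta>1 j t k \<gamma> = X k \<gamma> powi (- e t) * X k \<gamma> * \<theta> j k \<gamma> * \<phi> k \<gamma>" for j t k \<gamma>
  define \<eta>0 where "\<eta>0 j t k \<gamma> = Y j \<gamma> * X k \<gamma> powi (- e t) * \<theta> j k \<gamma> * \<phi> k \<gamma>" for j t k \<gamma>
  define Y1 where "Y1 j t = (\<Sum>k=1..N. weighted_shift (\<eta>1 j t k) (b k))" for j t
  define Y0 where "Y0 j t = (\<Sum>k=1..N. weighted_shift (\<eta>0 j t k) (b k))" for j t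
  have m\<theta>: "meromorphic_sev (\<theta> j k)" if "k \<in> {1..N}" "j \<in> {1..M}" for k j
    unfolding \<theta>_def using that
    by (intro meromorphic_sev_inverse meromorphic_sev_diff meromorphic_sev_mult meromorphic_sev_const mero nz')
  have m\<eta>: "meromorphic_sev (\<eta>1 j t k)" "meromorphic_sev (\<eta>0 j t k)" if "k \<in> {1..N}" "j \<in> {1..M}" for k j t
    unfolding \<eta>1_def \<eta>0_def using that
    by (auto intro!: meromorphic_sev_mult meromorphic_sev_powi_nonzero m\<theta> mero nz)
  have mX: "meromorphic_sev (\<lambda>\<gamma>. X k \<gamma> powi i * \<phi> k \<gamma>)" if "k \<in> {1..N}" for k i
    using that by (auto intro!: meromorphic_sev_mult meromorphic_sev_powi_nonzero mero nz)
  have mY: "meromorphic_sev (\<lambda>\<gamma>. Y k \<gamma> powi i * \<psi> k \<gamma>)" if "k \<in> {1..M}" for k i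
    using that by (auto intro!: meromorphic_sev_mult meromorphic_sev_powi_nonzero mero nz)
  \<comment> \<open>\<open>Q X k - Y j\<close> cancels against \<open>\<theta> j k\<close>, so the
    original coefficient reappears.\<close>
  have S_eq: "S t = Q *\<^sub>C Y1 j t - Y0 j t" if j: "j \<in> {1..M}" for j t
  proof -
    have "Q *\<^sub>C Y1 j t - Y0 j t = (\<Sum>k=1..N. weighted_shift (\<lambda>\<gamma>. Q * \<eta>1 j t k \<gamma> - \<eta>0 j t k \<gamma>) (b k))"
      unfolding Y1_def Y0_def scaleC_sum_right sum_subtractf[symmetric]
    proof (intro sum.cong refl)
      fix k assume k: "k \<in> {1..N}"
      show "Q *\<^sub>C weighted_shift (\<eta>1 j t k) (b k) - weighted_shift (\<eta>0 j t k) (b k) =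
          weighted_shift (\<lambda>\<gamma>. Q * \<eta>1 j t k \<gamma> - \<eta>0 j t k \<gamma>) (b k)"
        unfolding weighted_shift_scaleC[OF m\<eta>(1)[OF k j]]
        by (intro weighted_shift_diff meromorphic_sev_mult meromorphic_sev_const m\<eta>[OF k j])
    qed
    also have "\<dots> = S t"
      unfolding S_def shift_series_def
    proof (intro sum.cong refl weighted_shift_cong)
      fix k assume k: "k \<in> {1..N}"
      show "\<forall>\<^sub>F \<gamma> in generic. Q * \<eta>1 j t k \<gamma> - \<eta>0 j t k \<gamma> = X k \<gamma> powi (- e t) * \<phi> k \<gamma>"
        using nz'[OF k j]
      proof eventually_elim
        case (elim \<gamma>)
        have "Q * \<eta>1 j t k \<gamma> - \<eta>0 j t k \<gamma> = X k \<gamma> powi (- e t) * \<phi> k \<gamma> * ((Q * X k \<gamma> - Y j \<gamma>) * \<theta> j k \<gamma>)"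
          by (simp add: \<eta>1_def \<eta>0_def algebra_simps)
        then show ?case using elim by (simp add: \<theta>_def)
      qed
    qed (use j in \<open>auto intro!: mX meromorphic_sev_diff meromorphic_sev_mult meromorphic_sev_const m\<eta>\<close>)
    finally show ?thesis by simp
  qed
  \<comment> \<open>By \<open>other\<close> the exchange replaces the numerator
    \<open>Q X k - Y j\<close> by \<open>X k - Q Y j\<close> over the same denominator; this moves
    the scalar \<open>Q\<close> from \<open>Y1\<close> to \<open>Y0\<close>.\<close>
  have past: "f j * S t = (Y1 j t - Q *\<^sub>C Y0 j t) * f j" if j: "j \<in> {1..M}" for j t
  proof -
    have "f j * weighted_shift (\<lambda>\<gamma>. X k \<gamma> powi (- e t) * \<phi> k \<gamma>) (b k) =
        weighted_shift (\<eta>1 j t k) (b k) * f j - Q *\<^sub>C (weighted_shift (\<eta>0 j t k) (b k) * f j)"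
      if k: "k \<in> {1..N}" for k
    proof -
      have "1 *\<^sub>C (f j * weighted_shift (\<lambda>\<gamma>. X k \<gamma> powi (- e t) * \<phi> k \<gamma>) (b k)) +
          0 *\<^sub>C (f j * weighted_shift (\<lambda>\<gamma>. X k \<gamma> powi (- e t) * \<phi> k \<gamma>) (b k)) =
        1 *\<^sub>C (weighted_shift (\<eta>1 j t k) (b k) * f j) + (- Q) *\<^sub>C (weighted_shift (\<eta>0 j t k) (b k) * f j)"
        unfolding f_def
      proof (rule weighted_shift_exchange)
        show "\<forall>\<^sub>F \<gamma> in generic. 1 * (Y j \<gamma> powi (- r) * \<psi> j \<gamma> * (X k (\<gamma> + c j) powi (- e t) * \<phi> k (\<gamma> + c j))) +
            0 * (Y j \<gamma> powi (- r) * \<psi> j \<gamma> * (X k (\<gamma> + c j) powi (- e t) * \<phi> k (\<gamma> + c j))) =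
            1 * (\<eta>1 j t k \<gamma> * (Y j (\<gamma> + b k) powi (- r) * \<psi> j (\<gamma> + b k))) +
            (- Q) * (\<eta>0 j t k \<gamma> * (Y j (\<gamma> + b k) powi (- r) * \<psi> j (\<gamma> + b k)))"
          using other[OF k j] nz'[OF k j]
        proof eventually_elim
          case (elim \<gamma>)
          have "1 * (\<eta>1 j t k \<gamma> * (Y j (\<gamma> + b k) powi (- r) * \<psi> j (\<gamma> + b k))) +
              (- Q) * (\<eta>0 j t k \<gamma> * (Y j (\<gamma> + b k) powi (- r) * \<psi> j (\<gamma> + b k)))
            = Y j \<gamma> powi (- r) * X k \<gamma> powi (- e t) * \<theta> j k \<gamma> * (\<phi> k \<gamma> * \<psi> j (\<gamma> + b k) * (X k \<gamma> - Q * Y j \<gamma>))"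
            by (simp add: \<eta>1_def \<eta>0_def Yb[OF k j] algebra_simps)
          also have "\<dots> = Y j \<gamma> powi (- r) * X k \<gamma> powi (- e t) * \<psi> j \<gamma> * \<phi> k (\<gamma> + c j) * ((Q * X k \<gamma> - Y j \<gamma>) * \<theta> j k \<gamma>)"
            unfolding elim(1) by (simp only: mult_ac)
          finally show ?case using elim(2) by (simp add: \<theta>_def Xc[OF k j] mult_ac)
        qed
      qed (use k j in \<open>auto intro!: mX mY m\<eta>\<close>)
      then show ?thesis by (simp add: scaleC_one)
    qed
    then have "f j * S t = (\<Sum>k=1..N. weighted_shift (\<eta>1 j t k) (b k) * f j - Q *\<^sub>C (weighted_shift (\<eta>0 j t k) (b k) * f j))"
      unfolding S_def shift_series_def sum_distrib_left by (intro sum.cong refl) auto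
    then show ?thesis
      by (simp add: Y1_def Y0_def left_diff_distrib mult_scaleC_left sum_distrib_right scaleC_sum_right sum_subtractf)
  qed
  \<comment> \<open>For different indices this is \<open>self\<close> times a weight that neither
    translation changes.\<close>
  have rel: "Y1 j s * Y0 j t - p\<^sup>2 *\<^sub>C (Y0 j s * Y1 j t) = p\<^sup>2 *\<^sub>C (Y0 j t * Y1 j s) - Y1 j t * Y0 j s"
    if j: "j \<in> {1..M}" for j s t
  proof -
    let ?w = "weighted_shift"
    have trm: "1 *\<^sub>C (?w (\<eta>1 j s k) (b k) * ?w (\<eta>0 j t l) (b l)) + (- p\<^sup>2) *\<^sub>C (?w (\<eta>0 j s k) (b k) * ?w (\<eta>1 j t l) (b l)) =
        p\<^sup>2 *\<^sub>C (?w (\<eta>0 j t l) (b l) * ?w (\<eta>1 j s k) (b k)) + (- 1) *\<^sub>C (?w (\<eta>1 j t l) (b l) * ?w (\<eta>0 j s k) (b k))"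
      if k: "k \<in> {1..N}" and l: "l \<in> {1..N}" for k l
    proof (rule weighted_shift_exchange)
      show "\<forall>\<^sub>F \<gamma> in generic. 1 * (\<eta>1 j s k \<gamma> * \<eta>0 j t l (\<gamma> + b k)) + (- p\<^sup>2) * (\<eta>0 j s k \<gamma> * \<eta>1 j t l (\<gamma> + b k)) =
        p\<^sup>2 * (\<eta>0 j t l \<gamma> * \<eta>1 j s k (\<gamma> + b l)) + (- 1) * (\<eta>1 j t l \<gamma> * \<eta>0 j s k (\<gamma> + b l))"
      proof (cases "k = l")
        \<comment> \<open>For equal indices \<open>p^2 X k\<close> at the translated point is
          \<open>X k\<close>, and each side vanishes by itself.\<close>
        case True
        have a: "p\<^sup>2 * (u * X k (\<gamma> + b k)) = u * X k \<gamma>" for u \<gamma>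
          using Xb(2)[OF k, of \<gamma>] by (simp add: mult.left_commute)
        have "1 * (\<eta>1 j s k \<gamma> * \<eta>0 j t k (\<gamma> + b k)) + (- p\<^sup>2) * (\<eta>0 j s k \<gamma> * \<eta>1 j t k (\<gamma> + b k)) = 0" for \<gamma>
        proof -
          have "p\<^sup>2 * (\<eta>0 j s k \<gamma> * \<eta>1 j t k (\<gamma> + b k)) =
              p\<^sup>2 * ((\<eta>0 j s k \<gamma> * (X k (\<gamma> + b k) powi (- e t) * \<theta> j k (\<gamma> + b k) * \<phi> k (\<gamma> + b k))) * X k (\<gamma> + b k))"
            by (simp add: \<eta>1_def mult_ac)
          also have "\<dots> = \<eta>1 j s k \<gamma> * \<eta>0 j t k (\<gamma> + b k)"
            unfolding a by (simp add: \<eta>1_def \<eta>0_def Yb[OF k j] mult_ac)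
          finally show ?thesis by simp
        qed
        moreover have "p\<^sup>2 * (\<eta>0 j t k \<gamma> * \<eta>1 j s k (\<gamma> + b k)) + (- 1) * (\<eta>1 j t k \<gamma> * \<eta>0 j s k (\<gamma> + b k)) = 0" for \<gamma>
        proof -
          have "p\<^sup>2 * (\<eta>0 j t k \<gamma> * \<eta>1 j s k (\<gamma> + b k)) =
              p\<^sup>2 * ((\<eta>0 j t k \<gamma> * (X k (\<gamma> + b k) powi (- e s) * \<theta> j k (\<gamma> + b k) * \<phi> k (\<gamma> + b k))) * X k (\<gamma> + b k))"
            by (simp add: \<eta>1_def mult_ac)
          also have "\<dots> = \<eta>1 j t k \<gamma> * \<eta>0 j s k (\<gamma> + b k)"
            unfolding a by (simp add: \<eta>1_def \<eta>0_def Yb[OF k j] mult_ac)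
          finally show ?thesis by simp
        qed
        ultimately show ?thesis unfolding True[symmetric] by simp
      next
        case False
        show ?thesis
          using self[OF k l False]
        proof eventually_elim
          case (elim \<gamma>)
          let ?u = "Y j \<gamma> * X k \<gamma> powi (- e s) * X l \<gamma> powi (- e t) * \<theta> j k \<gamma> * \<theta> j l \<gamma>"
          note X = Xb(1)[OF k l False] Xb(1)[OF l k False[symmetric]] Yb[OF k j] Yb[OF l j]
          have \<theta>: "\<theta> j l (\<gamma> + b k) = \<theta> j l \<gamma>" "\<theta> j k (\<gamma> + b l) = \<theta> j k \<gamma>"
            by (simp_all add: \<theta>_def X)
          have "1 * (\<eta>1 j s k \<gamma> * \<eta>0 j t l (\<gamma> + b k)) + (- p\<^sup>2) * (\<eta>0 j s k \<gamma> * \<eta>1 j t l (\<gamma> + b k))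
            = ?u * (\<phi> k \<gamma> * \<phi> l (\<gamma> + b k) * (X k \<gamma> - p\<^sup>2 * X l \<gamma>))"
            by (simp add: \<eta>1_def \<eta>0_def X \<theta> algebra_simps)
          also have "\<dots> = p\<^sup>2 * (\<eta>0 j t l \<gamma> * \<eta>1 j s k (\<gamma> + b l)) + (- 1) * (\<eta>1 j t l \<gamma> * \<eta>0 j s k (\<gamma> + b l))"
            unfolding elim by (simp add: \<eta>1_def \<eta>0_def X \<theta> algebra_simps)
          finally show ?case .
        qed
      qed
    qed (use k l j in \<open>auto intro!: m\<eta>\<close>)
    have "Y1 j s * Y0 j t - p\<^sup>2 *\<^sub>C (Y0 j s * Y1 j t) = 1 *\<^sub>C (Y1 j s * Y0 j t) + (- p\<^sup>2) *\<^sub>C (Y0 j s * Y1 j t)"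
      by (simp add: scaleC_one)
    also have "\<dots> = (\<Sum>k=1..N. \<Sum>l=1..N. 1 *\<^sub>C (?w (\<eta>1 j s k) (b k) * ?w (\<eta>0 j t l) (b l)) + (- p\<^sup>2) *\<^sub>C (?w (\<eta>0 j s k) (b k) * ?w (\<eta>1 j t l) (b l)))"
      unfolding Y1_def Y0_def sum_product scaleC_sum_right sum.distrib ..
    also have "\<dots> = (\<Sum>k=1..N. \<Sum>l=1..N. p\<^sup>2 *\<^sub>C (?w (\<eta>0 j t l) (b l) * ?w (\<eta>1 j s k) (b k)) + (- 1) *\<^sub>C (?w (\<eta>1 j t l) (b l) * ?w (\<eta>0 j s k) (b k)))"
      by (intro sum.cong refl trm)
    also have "\<dots> = p\<^sup>2 *\<^sub>C (Y0 j t * Y1 j s) + (- 1) *\<^sub>C (Y1 j t * Y0 j s)"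
      unfolding Y1_def Y0_def sum_product scaleC_sum_right sum.distrib
      by (intro arg_cong2[where f = "(+)"] sum.swap)
    finally show ?thesis by (simp add: scaleC_one)
  qed
  \<comment> \<open>The second series occurs once in each word, so its terms are treated separately;
    each \<open>f j\<close> is carried to the right end, turning the factors behind it into the
    second affine expression.\<close>
  have trm: "prod_list (map (\<lambda>t. S (\<sigma> t)) ts) * (\<Sum>j=1..M. f j) * prod_list (map (\<lambda>t. S (\<sigma> t)) us) =
      (\<Sum>j=1..M. (prod_list (map (\<lambda>t. Q *\<^sub>C Y1 j (\<sigma> t) - Y0 j (\<sigma> t)) ts) *
        prod_list (map (\<lambda>t. Y1 j (\<sigma> t) - Q *\<^sub>C Y0 j (\<sigma> t)) us)) * f j)" for \<sigma> ts us
  proof -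
    have "f j * prod_list (map (\<lambda>t. S (\<sigma> t)) us) = prod_list (map (\<lambda>t. Y1 j (\<sigma> t) - Q *\<^sub>C Y0 j (\<sigma> t)) us) * f j"
      if "j \<in> {1..M}" for j
      by (rule prod_list_commute_past) (rule past[OF that])
    then show ?thesis
      unfolding sum_distrib_left sum_distrib_right
      by (intro sum.cong refl) (simp add: mult.assoc S_eq[symmetric])
  qed
  have "(\<Sum>\<sigma> | \<sigma> permutes {1..m}. \<Sum>k=0..m. ((- 1) ^ k * qbinom q m k) *\<^sub>C
           (prod_list (map (\<lambda>t. S (\<sigma> t)) [1..<k + 1]) * (\<Sum>j=1..M. f j) * prod_list (map (\<lambda>t. S (\<sigma> t)) [k + 1..<m + 1])))
    = (\<Sum>j=1..M. (\<Sum>\<sigma> | \<sigma> permutes {1..m}. \<Sum>k=0..m. ((- 1) ^ k * qbinom p m k) *\<^sub>C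
           (prod_list (map (\<lambda>t. Q *\<^sub>C Y1 j (\<sigma> t) - Y0 j (\<sigma> t)) [1..<k + 1]) *
            prod_list (map (\<lambda>t. Y1 j (\<sigma> t) - Q *\<^sub>C Y0 j (\<sigma> t)) [k + 1..<m + 1]))) * f j)"
    unfolding trm qb scaleC_sum_right sum_distrib_right mult_scaleC_left[symmetric]
    by (rule trans[OF sum.cong[OF refl sum.swap] sum.swap])
  also have "\<dots> = 0"
  proof (rule sum.neutral, rule ballI)
    fix j assume j: "j \<in> {1..M}"
    have "(\<Sum>\<sigma> | \<sigma> permutes {1..m}. \<Sum>k=0..m. ((- 1) ^ k * qbinom p m k) *\<^sub>C
           (prod_list (map (\<lambda>t. Q *\<^sub>C Y1 j (\<sigma> t) - Y0 j (\<sigma> t)) [1..<k + 1]) *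
            prod_list (map (\<lambda>t. Y1 j (\<sigma> t) - Q *\<^sub>C Y0 j (\<sigma> t)) [k + 1..<m + 1]))) = 0"
      unfolding Q by (rule serre_symmetrized[OF p m]) (rule rel[OF j])
    then show "(\<Sum>\<sigma> | \<sigma> permutes {1..m}. \<Sum>k=0..m. ((- 1) ^ k * qbinom p m k) *\<^sub>C
           (prod_list (map (\<lambda>t. Q *\<^sub>C Y1 j (\<sigma> t) - Y0 j (\<sigma> t)) [1..<k + 1]) *
            prod_list (map (\<lambda>t. Y1 j (\<sigma> t) - Q *\<^sub>C Y0 j (\<sigma> t)) [k + 1..<m + 1]))) * f j = 0"
      by simp
  qed
  finally show "(\<Sum>\<sigma> | \<sigma> permutes {1..m}. \<Sum>k=0..m. ((- 1) ^ k * qbinom q m k) *\<^sub>C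
           (prod_list (map (\<lambda>t. shift_series N \<phi> X b (e (\<sigma> t))) [1..<k + 1]) * shift_series M \<psi> Y c r *
            prod_list (map (\<lambda>t. shift_series N \<phi> X b (e (\<sigma> t))) [k + 1..<m + 1]))) = 0"
    unfolding S_def shift_series_def[of M] f_def .
qed

section \<open>Coefficients of the currents\<close>

lemma prod_telescope:
  fixes g :: "nat \<Rightarrow> 'a::comm_monoid_mult"
  shows "(\<Prod>r=1..n. g r) * g 0 = (\<Prod>r=1..n. g (r - 1)) * g n"
proof (induction n)
  case (Suc n)
  have "(\<Prod>r=1..Suc n. g r) * g 0 = ((\<Prod>r=1..n. g r) * g 0) * g (Suc n)"
    by (simp add: mult_ac)
  also have "\<dots> = (\<Prod>r=1..Suc n. g (r - 1)) * g (Suc n)"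
    unfolding Suc.IH by (simp add: mult_ac)
  finally show ?case .
qed simp

text \<open>The whole contribution of one variable \<open>v_{j,p}\<close> to \<open>K_i(z)\<close>
  and to the coefficients of node \<open>i\<close>. The power of \<open>v\<close> is kept together
  with the product because only the combination has a clean transformation under
  \<open>v \<mapsto> q v\<close>.\<close>

definition node_factor :: "'a::field \<Rightarrow> int \<Rightarrow> 'a \<Rightarrow> 'a \<Rightarrow> 'a" where
  "node_factor q a X v = v powi a * (\<Prod>r=1..nat (- a). X - q powi (a + 2 * int r) * v ^ 2)"

text \<open>The exponents \<open>a + 2, a + 4, ..., -a\<close> form a progression with step 2, and
  scaling \<open>v\<close> by \<open>1/q\<close> moves it down by one step. Only the two end factors
  survive, and the power \<open>v^a\<close> supplies the scalar that turns
  \<open>X - q^(-a) v^2\<close> into \<open>q^a X - v^2\<close>.\<close>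

lemma node_factor_shift_down:
  fixes q v X :: "'a::field"
  assumes "q \<noteq> 0" "v \<noteq> 0" "a \<le> 0"
  shows "node_factor q a X v * (X - q powi a * v ^ 2) =
    node_factor q a X (inverse q * v) * (q powi a * X - v ^ 2)"
proof -
  define g where "g r = X - q powi (a + 2 * int r) * v ^ 2" for r
  have e: "a + 2 * int (nat (- a)) = - a" using assms(3) by simp
  have g1: "X - q powi (a + 2 * int r) * (inverse q * v) ^ 2 = g (r - 1)" if "r \<in> {1..nat (- a)}" for r
  proof -
    have "a + 2 * int r = a + 2 * int (r - 1) + 2" using that by auto
    then have "q powi (a + 2 * int r) = q powi (a + 2 * int (r - 1)) * q powi 2"
      using assms(1) by (simp only: power_int_add simp_thms)
    then show ?thesis using assms(1) by (simp add: g_def power_mult_distrib power_inverse field_simps)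
  qed
  have "node_factor q a X v * (X - q powi a * v ^ 2) = v powi a * ((\<Prod>r=1..nat (- a). g r) * g 0)"
    by (simp add: node_factor_def g_def)
  also have "\<dots> = v powi a * ((\<Prod>r=1..nat (- a). g (r - 1)) * g (nat (- a)))"
    by (simp only: prod_telescope)
  also have "g (nat (- a)) = q powi (- a) * (q powi a * X - v ^ 2)"
    using assms(1) unfolding g_def e by (simp add: right_diff_distrib mult.assoc[symmetric] power_int_add[symmetric])
  also have "v powi a * ((\<Prod>r=1..nat (- a). g (r - 1)) * (q powi (- a) * (q powi a * X - v ^ 2)))
      = node_factor q a X (inverse q * v) * (q powi a * X - v ^ 2)"
  proof -
    have "(\<Prod>r=1..nat (- a). X - q powi (a + 2 * int r) * (inverse q * v) ^ 2) = (\<Prod>r=1..nat (- a). g (r - 1))"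
      by (rule prod.cong[OF refl g1])
    moreover have "(inverse q * v) powi a = q powi (- a) * v powi a"
      by (simp add: power_int_mult_distrib power_int_inverse power_int_minus)
    ultimately show ?thesis unfolding node_factor_def by (simp only: mult_ac)
  qed
  finally show ?thesis .
qed

text \<open>The previous rule at \<open>q v\<close>, read backwards and multiplied by
  \<open>q^(-a)\<close>.\<close>

lemma node_factor_shift_up:
  fixes q v X :: "'a::field"
  assumes "q \<noteq> 0" "v \<noteq> 0" "a \<le> 0"
  shows "node_factor q a X v * (X - q powi (- a) * (q ^ 2 * v ^ 2)) =
    node_factor q a X (q * v) * (q powi (- a) * X - q ^ 2 * v ^ 2)"
proof -
  have i: "q powi (- a) * q powi a = 1" using assms(1) by (simp add: power_int_add[symmetric])
  have iv: "inverse q * (q * v) = v" using assms(1) by simp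
  have "node_factor q a X (q * v) * (X - q powi a * (q * v) ^ 2) =
      node_factor q a X v * (q powi a * X - (q * v) ^ 2)"
    using node_factor_shift_down[of q "q * v" a X, unfolded iv] assms by simp
  then have e0: "q powi (- a) * (node_factor q a X (q * v) * (X - q powi a * (q * v) ^ 2)) =
      q powi (- a) * (node_factor q a X v * (q powi a * X - (q * v) ^ 2))" by simp
  have e1: "q powi (- a) * (node_factor q a X (q * v) * (X - q powi a * (q * v) ^ 2))
      = node_factor q a X (q * v) * (q powi (- a) * X - (q powi (- a) * q powi a) * (q * v) ^ 2)"
    by (simp only: right_diff_distrib mult_ac)
  have e2: "q powi (- a) * (node_factor q a X v * (q powi a * X - (q * v) ^ 2))
      = node_factor q a X v * ((q powi (- a) * q powi a) * X - q powi (- a) * (q * v) ^ 2)"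
    by (simp only: right_diff_distrib mult_ac)
  show ?thesis using e0[unfolded e1 e2 i mult_1] unfolding power_mult_distrib by (rule sym)
qed

lemma prod_node_factor:
  "(\<Prod>j\<in>A. \<Prod>p=1..m j. node_factor (q j) (a j i) X (V j p)) =
    (\<Prod>j\<in>A. \<Prod>p=1..m j. V j p powi a j i) *
    (\<Prod>j\<in>A. \<Prod>r=1..nat (- a j i). \<Prod>p=1..m j. X - q j powi (a j i + 2 * int r) * V j p ^ 2)"
  unfolding prod.distrib[symmetric]
proof (intro prod.cong refl)
  fix j
  have "(\<Prod>p=1..m j. node_factor (q j) (a j i) X (V j p)) = (\<Prod>p=1..m j. V j p powi a j i) *
    (\<Prod>p=1..m j. \<Prod>r=1..nat (- a j i). X - q j powi (a j i + 2 * int r) * V j p ^ 2)"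
    by (simp add: node_factor_def prod.distrib)
  then show "(\<Prod>p=1..m j. node_factor (q j) (a j i) X (V j p)) = (\<Prod>p=1..m j. V j p powi a j i) *
    (\<Prod>r=1..nat (- a j i). \<Prod>p=1..m j. X - q j powi (a j i + 2 * int r) * V j p ^ 2)"
    by (simp only: prod.swap[of _ "{1..m j}"])
qed

section \<open>The effect of a single shift on the coefficients\<close>

definition upd :: "(nat \<Rightarrow> nat \<Rightarrow> 'a::times) \<Rightarrow> nat \<Rightarrow> nat \<Rightarrow> 'a \<Rightarrow> nat \<Rightarrow> nat \<Rightarrow> 'a" where
  "upd V i k s j p = (if j = i \<and> p = k then s * V j p else V j p)"

text \<open>The common shape of the coefficients of \<open>E\<^sub>i\<close> (with \<open>J = {i+1..l}\<close>, \<open>\<kappa> = 1\<close>) and of \<open>F\<^sub>i\<close>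
  (with \<open>J = {1..<i}\<close>, \<open>\<kappa> = q\<^sub>i\<^sup>2\<close>), up to a scalar; \<open>V j p\<close> is the value of \<open>v\<^sub>j\<^sub>,\<^sub>p\<close>.\<close>

definition coef :: "(nat \<Rightarrow> nat) \<Rightarrow> (nat \<Rightarrow> nat \<Rightarrow> int) \<Rightarrow> (nat \<Rightarrow> complex) \<Rightarrow> nat set \<Rightarrow>
    complex poly \<Rightarrow> complex \<Rightarrow> nat \<Rightarrow> nat \<Rightarrow> (nat \<Rightarrow> nat \<Rightarrow> complex) \<Rightarrow> complex" where
  "coef m a q J R \<kappa> i k V =
     (\<Prod>p=1..m i. V i p) *
     (\<Prod>j\<in>J. \<Prod>p=1..m j. node_factor (q j) (a j i) (\<kappa> * V i k ^ 2) (V j p)) *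
     V i k powi (- 2) * poly R (\<kappa> * V i k ^ 2) / (\<Prod>p\<in>{1..m i} - {k}. V i k ^ 2 - V i p ^ 2)"

lemma coef_upd_unrelated:
  assumes "j \<noteq> i" "j \<notin> J"
  shows "coef m a q J R \<kappa> i k (upd V j p s) = coef m a q J R \<kappa> i k V"
proof -
  have "upd V j p s j' p' = V j' p'" if "j' \<in> J" for j' p'
    using that assms(2) by (auto simp: upd_def)
  moreover have "upd V j p s i p' = V i p'" for p'
    using assms(1) by (auto simp: upd_def)
  ultimately show ?thesis by (simp add: coef_def)
qed

lemma prod_upd:
  fixes f :: "nat \<Rightarrow> 'b \<Rightarrow> 'a::comm_monoid_mult"
  assumes "finite A" "p \<in> A" "f p v * \<alpha> = f p w * \<beta>" and that: "V p = v"
  shows "(\<Prod>p'\<in>A. f p' (V p')) * \<alpha> = (\<Prod>p'\<in>A. f p' ((V(p := w)) p')) * \<beta>"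
proof -
  have "(\<Prod>p'\<in>A. f p' (V p')) * \<alpha> = (f p v * \<alpha>) * (\<Prod>p'\<in>A - {p}. f p' (V p'))"
    using that by (simp add: prod.remove[OF assms(1,2)] mult_ac)
  also have "\<dots> = (f p w * (\<Prod>p'\<in>A - {p}. f p' ((V(p := w)) p'))) * \<beta>"
    unfolding assms(3) by (simp add: mult_ac)
  also have "f p w * (\<Prod>p'\<in>A - {p}. f p' ((V(p := w)) p')) = (\<Prod>p'\<in>A. f p' ((V(p := w)) p'))"
    using prod.remove[OF assms(1,2), of "\<lambda>p'. f p' ((V(p := w)) p')"] by simp
  finally show ?thesis .
qed

lemma prod_prod_upd:
  fixes f :: "nat \<Rightarrow> 'b::times \<Rightarrow> 'a::comm_monoid_mult"
  assumes J: "finite J" "j \<in> J" and p: "p \<in> {1..m j}"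
    and eq: "f j (V j p) * \<alpha> = f j (s * V j p) * \<beta>"
  shows "(\<Prod>j'\<in>J. \<Prod>p'=1..m j'. f j' (V j' p')) * \<alpha> = (\<Prod>j'\<in>J. \<Prod>p'=1..m j'. f j' (upd V j p s j' p')) * \<beta>"
proof -
  define G where "G W j' = (\<Prod>p'=1..m j'. f j' (W j' p'))" for W :: "nat \<Rightarrow> nat \<Rightarrow> 'b" and j'
  have u: "upd V j p s j = (V j)(p := s * V j p)" by (auto simp: upd_def)
  have o: "G (upd V j p s) j' = G V j'" if "j' \<noteq> j" for j'
    using that by (simp add: G_def upd_def)
  have d: "G V j * \<alpha> = G (upd V j p s) j * \<beta>"
    unfolding G_def u by (rule prod_upd[where f = "\<lambda>_. f j"]) (use p eq in auto)
  have "(\<Prod>j'\<in>J. G V j') * \<alpha> = (G V j * \<alpha>) * (\<Prod>j'\<in>J - {j}. G V j')"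
    by (simp add: prod.remove[OF J] mult_ac)
  also have "(\<Prod>j'\<in>J - {j}. G V j') = (\<Prod>j'\<in>J - {j}. G (upd V j p s) j')"
    by (intro prod.cong refl) (auto simp: o)
  also have "(G V j * \<alpha>) * \<dots> = (\<Prod>j'\<in>J. G (upd V j p s) j') * \<beta>"
    unfolding d by (simp add: prod.remove[OF J] mult_ac)
  finally show ?thesis by (simp add: G_def)
qed

lemma coef_upd_other:
  assumes "j \<noteq> i" "finite J" "j \<in> J" "p \<in> {1..m j}"
    and "node_factor (q j) (a j i) (\<kappa> * V i k ^ 2) (V j p) * \<alpha> =
      node_factor (q j) (a j i) (\<kappa> * V i k ^ 2) (s * V j p) * \<beta>"
  shows "coef m a q J R \<kappa> i k V * \<alpha> = coef m a q J R \<kappa> i k (upd V j p s) * \<beta>"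
proof -
  have u: "upd V j p s i = V i" using assms(1) by (auto simp: upd_def)
  define P where "P W = (\<Prod>j\<in>J. \<Prod>p=1..m j. node_factor (q j) (a j i) (\<kappa> * V i k ^ 2) (W j p))" for W
  have "P V * \<alpha> = P (upd V j p s) * \<beta>"
    unfolding P_def by (rule prod_prod_upd[where f = "\<lambda>j. node_factor (q j) (a j i) (\<kappa> * V i k ^ 2)"]) (use assms in auto)
  then have "b * P V * c * d / e * \<alpha> = b * P (upd V j p s) * c * d / e * \<beta>" for b c d e
    by (metis (no_types, opaque_lifting) mult.assoc mult.commute times_divide_eq_left)
  then show ?thesis unfolding coef_def u P_def .
qed

text \<open>Another variable of the same node enters only through the product of all
  \<open>V i p\<close> and through one factor of the denominator.\<close>

lemma coef_upd_same:
  assumes i: "i \<notin> J" and kn: "k \<in> {1..m i}" "n \<in> {1..m i}" "k \<noteq> n"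
    and nz: "V i n ^ 2 \<noteq> V i k ^ 2" "V i n ^ 2 \<noteq> s ^ 2 * V i k ^ 2"
  shows "coef m a q J R \<kappa> i n (upd V i k s) =
    coef m a q J R \<kappa> i n V * (s * (V i n ^ 2 - V i k ^ 2) / (V i n ^ 2 - s ^ 2 * V i k ^ 2))"
proof -
  let ?W = "upd V i k s"
  have un: "?W i n = V i n" and uk: "?W i k = s * V i k" using kn by (auto simp: upd_def)
  have uJ: "?W j p = V j p" if "j \<in> J" for j p using that i by (auto simp: upd_def)
  have N: "(\<Prod>p=1..m i. ?W i p) = s * (\<Prod>p=1..m i. V i p)"
    using kn(1) by (subst (1 2) prod.remove[of _ k]) (auto simp: upd_def intro!: prod.cong)
  define D where "D = (\<Prod>p\<in>{1..m i} - {n} - {k}. V i n ^ 2 - V i p ^ 2)"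
  have k: "k \<in> {1..m i} - {n}" "finite ({1..m i} - {n})" using kn by auto
  have D1: "(\<Prod>p\<in>{1..m i} - {n}. V i n ^ 2 - V i p ^ 2) = (V i n ^ 2 - V i k ^ 2) * D"
    unfolding D_def by (rule prod.remove[OF k(2,1)])
  have D2: "(\<Prod>p\<in>{1..m i} - {n}. V i n ^ 2 - ?W i p ^ 2) = (V i n ^ 2 - s ^ 2 * V i k ^ 2) * D"
    unfolding D_def by (subst prod.remove[OF k(2,1)]) (auto simp: uk power_mult_distrib, auto simp: upd_def intro!: prod.cong)
  have P: "(\<Prod>j\<in>J. \<Prod>p=1..m j. node_factor (q j) (a j i) (\<kappa> * V i n ^ 2) (?W j p)) =
      (\<Prod>j\<in>J. \<Prod>p=1..m j. node_factor (q j) (a j i) (\<kappa> * V i n ^ 2) (V j p))"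
    by (intro prod.cong refl) (simp add: uJ)
  have fr: "s * A * B * C * R' / (x * D) = A * B * C * R' / (y * D) * (s * y / x)" if "x \<noteq> 0" "y \<noteq> 0" for A B C R' x y
    using that by (simp add: field_simps)
  show ?thesis
    unfolding coef_def un P D2 D1 N by (rule fr) (use nz in auto)
qed

text \<open>With \<open>X\<close>, \<open>Y\<close> for the two squares, the denominators of the
  correction factors from \<open>coef_upd_same\<close> are, up to scalars, the linear factors of the
  relation. After cancellation both sides carry the same factor \<open>s t (X - Y)\<close>.\<close>

lemma coef_exchange_self:
  assumes i: "i \<notin> J" and kn: "k \<in> {1..m i}" "n \<in> {1..m i}" "k \<noteq> n"
    and t: "t * s ^ 2 = 1"
    and nz: "V i n ^ 2 \<noteq> V i k ^ 2" "t * V i n ^ 2 \<noteq> V i k ^ 2" "t * V i k ^ 2 \<noteq> V i n ^ 2"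
  shows "coef m a q J R \<kappa> i k V * coef m a q J R \<kappa> i n (upd V i k s) * (V i k ^ 2 - t * V i n ^ 2) =
    coef m a q J R \<kappa> i n V * coef m a q J R \<kappa> i k (upd V i n s) * (t * V i k ^ 2 - V i n ^ 2)"
proof -
  define X Y where "X = V i k ^ 2" and "Y = V i n ^ 2"
  have t0: "t \<noteq> 0" and s: "s ^ 2 = inverse t" using t inverse_unique[OF t] by auto
  have ne: "Y \<noteq> X" "Y \<noteq> s ^ 2 * X" "X \<noteq> s ^ 2 * Y"
    using nz t0 unfolding s X_def Y_def by (auto simp: field_simps)
  have 1: "coef m a q J R \<kappa> i n (upd V i k s) = coef m a q J R \<kappa> i n V * (s * (Y - X) / (Y - s ^ 2 * X))"
    unfolding X_def Y_def by (rule coef_upd_same) (use assms ne in \<open>auto simp: X_def Y_def\<close>)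
  have 2: "coef m a q J R \<kappa> i k (upd V i n s) = coef m a q J R \<kappa> i k V * (s * (X - Y) / (X - s ^ 2 * Y))"
    unfolding X_def Y_def by (rule coef_upd_same) (use assms ne in \<open>auto simp: X_def Y_def\<close>)
  have a1: "(s * (Y - X) / (Y - s ^ 2 * X)) * (X - t * Y) = - (s * t * (Y - X))"
  proof -
    have "X - t * Y = - t * (Y - s ^ 2 * X)" unfolding s using t0 by (simp add: field_simps)
    then show ?thesis using ne by simp
  qed
  have a2: "(s * (X - Y) / (X - s ^ 2 * Y)) * (t * X - Y) = s * t * (X - Y)"
  proof -
    have "t * X - Y = t * (X - s ^ 2 * Y)" unfolding s using t0 by (simp add: field_simps)
    then show ?thesis using ne by simp
  qed
  have 3: "(s * (Y - X) / (Y - s ^ 2 * X)) * (X - t * Y) = (s * (X - Y) / (X - s ^ 2 * Y)) * (t * X - Y)"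
    unfolding a1 a2 by (simp add: algebra_simps)
  have fin: "A * (B * u) * x = B * (A * w) * y" if "u * x = w * y" for A B u w x y :: complex
  proof -
    have "A * (B * u) * x = A * B * (u * x)" by (simp only: mult_ac)
    also have "\<dots> = B * (A * w) * y" unfolding that by (simp only: mult_ac)
    finally show ?thesis .
  qed
  from fin[OF 3] show ?thesis unfolding 1 2 X_def[symmetric] Y_def[symmetric] .
qed

text \<open>For opposite shifts the two correction factors coincide: replacing \<open>s\<close> by
  \<open>1/s\<close> and exchanging the two squares leaves \<open>s (Y - X) / (Y - s^2 X)\<close>
  unchanged.\<close>

lemma coef_commute_self:
  assumes i: "i \<notin> J" "i \<notin> J'" and kn: "k \<in> {1..m i}" "n \<in> {1..m i}" "k \<noteq> n"
    and s: "s \<noteq> 0"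
    and nz: "V i n ^ 2 \<noteq> V i k ^ 2" "V i n ^ 2 \<noteq> s ^ 2 * V i k ^ 2"
  shows "coef m a q J R \<kappa> i k V * coef m a q J' R' \<kappa>' i n (upd V i k s) =
    coef m a q J' R' \<kappa>' i n V * coef m a q J R \<kappa> i k (upd V i n (inverse s))"
proof -
  define X Y where "X = V i k ^ 2" and "Y = V i n ^ 2"
  have ne: "Y \<noteq> X" "Y \<noteq> s ^ 2 * X" "X \<noteq> inverse s ^ 2 * Y"
    using nz s unfolding X_def Y_def by (auto simp: field_simps)
  have 1: "coef m a q J' R' \<kappa>' i n (upd V i k s) = coef m a q J' R' \<kappa>' i n V * (s * (Y - X) / (Y - s ^ 2 * X))"
    unfolding X_def Y_def by (rule coef_upd_same) (use assms ne in \<open>auto simp: X_def Y_def\<close>)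
  have 2: "coef m a q J R \<kappa> i k (upd V i n (inverse s)) =
      coef m a q J R \<kappa> i k V * (inverse s * (X - Y) / (X - inverse s ^ 2 * Y))"
    unfolding X_def Y_def by (rule coef_upd_same) (use assms ne in \<open>auto simp: X_def Y_def\<close>)
  have "X - inverse s ^ 2 * Y = - (inverse s ^ 2 * (Y - s ^ 2 * X))"
    using s by (simp add: field_simps)
  then have "inverse s * (X - Y) / (X - inverse s ^ 2 * Y) = s * (Y - X) / (Y - s ^ 2 * X)"
    using s ne by (simp add: field_simps power2_eq_square)
  then show ?thesis unfolding 1 2 by (simp add: mult_ac)
qed

section \<open>Expansions of rational functions\<close>

text \<open>The argument may be the series variable or its inverse, so one algebraic computation
  serves both expansions.\<close>

definition fls_poly :: "complex poly \<Rightarrow> complex fls \<Rightarrow> complex fls" where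
  "fls_poly p Z = poly (map_poly fls_const p) Z"

lemma fls_poly_0: "fls_poly 0 Z = 0"
  by (simp add: fls_poly_def)

lemma fls_poly_pCons: "fls_poly (pCons a p) Z = fls_const a + Z * fls_poly p Z"
  by (simp add: fls_poly_def map_poly_pCons)

lemma fls_poly_add: "fls_poly (p + r) Z = fls_poly p Z + fls_poly r Z"
proof (induction p arbitrary: r)
  case (pCons a p)
  then show ?case
    by (cases r) (simp add: fls_poly_pCons fls_plus_const[symmetric] algebra_simps)
qed (simp add: fls_poly_0)

lemma fls_poly_smult: "fls_poly (smult c p) Z = fls_const c * fls_poly p Z"
  by (induction p) (simp_all add: fls_poly_0 fls_poly_pCons fls_const_mult_const[symmetric] algebra_simps
      del: fls_const_mult_const)

lemma fls_poly_mult: "fls_poly (p * r) Z = fls_poly p Z * fls_poly r Z"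
proof (induction p)
  case (pCons a p)
  have "fls_poly (pCons 0 (p * r)) Z = Z * fls_poly (p * r) Z"
    by (simp add: fls_poly_pCons)
  then show ?case
    by (simp add: mult_pCons_left fls_poly_add fls_poly_smult fls_poly_pCons pCons.IH algebra_simps)
qed (simp add: fls_poly_0)

lemma fls_poly_1: "fls_poly 1 Z = 1"
  by (simp add: fls_poly_def)

lemma fls_poly_prod: "fls_poly (\<Prod>i\<in>I. f i) Z = (\<Prod>i\<in>I. fls_poly (f i) Z)"
  by (induction I rule: infinite_finite_induct) (simp_all add: fls_poly_1 fls_poly_mult)

lemma fls_poly_sum: "fls_poly (\<Sum>i\<in>I. f i) Z = (\<Sum>i\<in>I. fls_poly (f i) Z)"
  by (induction I rule: infinite_finite_induct) (simp_all add: fls_poly_0 fls_poly_add)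

lemma fls_poly_linear: "fls_poly [:a, b:] Z = Z * fls_const b + fls_const a"
  by (simp add: fls_poly_pCons fls_poly_0)

lemma fls_poly_X: "fls_poly p fls_X = fps_to_fls (fps_of_poly p)"
proof (induction p)
  case (pCons a p)
  then show ?case
    by (simp add: fls_poly_pCons fps_of_poly_pCons fls_times_fps_to_fls)
qed (simp add: fls_poly_0)

text \<open>The reciprocal polynomial \<open>t^N p(1/t)\<close> when \<open>N\<close> bounds the
  degree.\<close>

definition fps_reflect :: "nat \<Rightarrow> complex poly \<Rightarrow> complex fps" where
  "fps_reflect N p = Abs_fps (\<lambda>n. if n \<le> N then coeff p (N - n) else 0)"

lemma fls_X_inv_power_X_power: "fls_X_inv ^ n * fls_X ^ n = (1 :: complex fls)"
proof -
  have "fls_X_inv * fls_X = (1 :: complex fls)"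
    by (metis fls_X_nonzero fls_inverse_X left_inverse)
  then show ?thesis by (metis power_mult_distrib power_one)
qed

lemma fls_poly_X_inv:
  "degree p \<le> N \<Longrightarrow> fls_poly p fls_X_inv = fls_X_inv ^ N * fps_to_fls (fps_reflect N p)"
proof (induction N arbitrary: p)
  case 0
  then obtain a where "p = [:a:]" by (metis degree_eq_zeroE le_zero_eq)
  moreover have "fps_reflect 0 [:a:] = fps_const a"
    by (auto simp: fps_reflect_def fps_eq_iff)
  ultimately show ?case by (simp add: fls_poly_pCons fls_poly_0)
next
  case (Suc N)
  obtain a r where p: "p = pCons a r" by (cases p)
  have r: "degree r \<le> N" using Suc.prems by (cases "r = 0") (auto simp: p)
  have refl: "fps_reflect (Suc N) p = fps_reflect N r + fps_const a * fps_X ^ Suc N"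
  proof (rule fps_ext)
    fix n
    have "fps_nth (fps_const a * fps_X ^ Suc N) n = (if n = Suc N then a else 0)"
      by (simp del: power_Suc)
    then show "fps_nth (fps_reflect (Suc N) p) n = fps_nth (fps_reflect N r + fps_const a * fps_X ^ Suc N) n"
      by (cases "n = Suc N") (auto simp: fps_reflect_def p Suc_diff_le le_Suc_eq simp del: power_Suc)
  qed
  have "fls_X_inv ^ Suc N * fps_to_fls (fps_reflect (Suc N) p)
      = fls_X_inv ^ Suc N * fps_to_fls (fps_reflect N r) + fls_const a * (fls_X_inv ^ Suc N * fls_X ^ Suc N)"
    unfolding refl
    by (simp add: fls_times_fps_to_fls fps_to_fls_power distrib_left mult_ac del: power_Suc)
  also have "\<dots> = fls_poly p fls_X_inv"
    unfolding fls_X_inv_power_X_power p fls_poly_pCons Suc.IH[OF r] by (simp add: mult_ac)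
  finally show ?case ..
qed

section \<open>Geometric expansions and partial fractions\<close>

definition geo_inf :: "complex \<Rightarrow> complex fps" where
  "geo_inf y = Abs_fps (\<lambda>n. y ^ n)"

definition geo_zero :: "complex \<Rightarrow> complex fps" where
  "geo_zero y = Abs_fps (\<lambda>n. - (inverse y ^ Suc n))"

text \<open>With \<open>t = 1/z\<close> one has \<open>1/(z - y) = t / (1 - y t)\<close>;
  \<open>geo_inf y\<close> is the series of \<open>1 / (1 - y t)\<close>.\<close>

lemma geo_inf: "(fls_X_inv - fls_const y) * (fls_X * fps_to_fls (geo_inf y)) = 1"
proof -
  have "(1 - fps_const y * fps_X) * geo_inf y = 1"
    by (rule fps_ext) (auto simp: geo_inf_def left_diff_distrib mult.assoc fps_X_mult_nth gr0_conv_Suc)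
  then have "fps_to_fls ((1 - fps_const y * fps_X) * geo_inf y) = 1"
    by simp
  then have *: "(1 - fls_const y * fls_X) * fps_to_fls (geo_inf y) = 1"
    by (simp add: fls_times_fps_to_fls del: fps_to_fls_eq_1_iff)
  have "(fls_X_inv - fls_const y) * fls_X = 1 - fls_const y * fls_X"
    using fls_X_inv_power_X_power[of 1] by (simp add: left_diff_distrib)
  then show ?thesis using * by (simp add: mult.assoc[symmetric])
qed

lemma geo_zero: "y \<noteq> 0 \<Longrightarrow> (fls_X - fls_const y) * fps_to_fls (geo_zero y) = 1"
proof -
  assume y: "y \<noteq> 0"
  have "(fps_X - fps_const y) * geo_zero y = 1"
    using y by (intro fps_ext) (auto simp: geo_zero_def left_diff_distrib fps_X_mult_nth gr0_conv_Suc)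
  then have "fps_to_fls ((fps_X - fps_const y) * geo_zero y) = 1"
    by simp
  then show ?thesis
    by (simp add: fls_times_fps_to_fls del: fps_to_fls_eq_1_iff)
qed

lemma fls_pole_nonzero:
  fixes y :: complex
  shows "fls_X_inv - fls_const y \<noteq> 0" "y \<noteq> 0 \<Longrightarrow> fls_X - fls_const y \<noteq> 0"
  using geo_inf[of y] geo_zero[of y] by (metis mult_zero_left zero_neq_one)+

text \<open>Each pole contributes a factor \<open>t\<close>, and these absorb the negative powers
  from the numerator. The quotient is a power series in \<open>t = 1/z\<close> with coefficients
  polynomial in the poles, which later gives both support and meromorphy.\<close>

lemma expand_at_infinity:
  assumes "finite I" "degree P \<le> card I"
  shows "fls_poly P fls_X_inv / (\<Prod>i\<in>I. fls_X_inv - fls_const (y i)) =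
    fps_to_fls (fps_reflect (card I) P * (\<Prod>i\<in>I. geo_inf (y i)))"
proof -
  have g: "fps_to_fls (\<Prod>i\<in>I. f i) = (\<Prod>i\<in>I. fps_to_fls (f i))" for f :: "_ \<Rightarrow> complex fps"
    using assms(1) by (induction I) (simp_all add: fls_times_fps_to_fls)
  have "(\<Prod>i\<in>I. fls_X_inv - fls_const (y i)) * (fls_X ^ card I * (\<Prod>i\<in>I. fps_to_fls (geo_inf (y i))))
      = (\<Prod>i\<in>I. (fls_X_inv - fls_const (y i)) * (fls_X * fps_to_fls (geo_inf (y i))))"
    by (simp add: prod.distrib)
  also have "\<dots> = 1" by (simp only: geo_inf prod.neutral_const)
  finally have "inverse (\<Prod>i\<in>I. fls_X_inv - fls_const (y i)) = fls_X ^ card I * (\<Prod>i\<in>I. fps_to_fls (geo_inf (y i)))"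
    by (rule inverse_unique)
  then show ?thesis
    using fls_X_inv_power_X_power[of "card I"]
    unfolding divide_inverse fls_poly_X_inv[OF assms(2)]
    by (simp add: g fls_times_fps_to_fls mult_ac)
qed

lemma expand_at_zero:
  assumes "finite I" "\<And>i. i \<in> I \<Longrightarrow> y i \<noteq> 0"
  shows "fls_poly P fls_X / (\<Prod>i\<in>I. fls_X - fls_const (y i)) =
    fps_to_fls (fps_of_poly P * (\<Prod>i\<in>I. geo_zero (y i)))"
proof -
  have g: "fps_to_fls (\<Prod>i\<in>I. f i) = (\<Prod>i\<in>I. fps_to_fls (f i))" for f :: "_ \<Rightarrow> complex fps"
    using assms(1) by (induction I) (simp_all add: fls_times_fps_to_fls)
  have "(\<Prod>i\<in>I. fls_X - fls_const (y i)) * (\<Prod>i\<in>I. fps_to_fls (geo_zero (y i)))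
      = (\<Prod>i\<in>I. (fls_X - fls_const (y i)) * fps_to_fls (geo_zero (y i)))"
    by (simp add: prod.distrib)
  also have "\<dots> = 1" using assms(2) by (simp add: geo_zero)
  finally have "inverse (\<Prod>i\<in>I. fls_X - fls_const (y i)) = (\<Prod>i\<in>I. fps_to_fls (geo_zero (y i)))"
    by (rule inverse_unique)
  then show ?thesis
    unfolding divide_inverse fls_poly_X by (simp add: g fls_times_fps_to_fls)
qed

lemma degree_linear_prod:
  fixes y :: "'b \<Rightarrow> complex"
  assumes "finite I"
  shows "degree (\<Prod>i\<in>I. [:- y i, 1:]) = card I" "coeff (\<Prod>i\<in>I. [:- y i, 1:]) (card I) = 1"
proof -
  show d: "degree (\<Prod>i\<in>I. [:- y i, 1:]) = card I"
    by (subst degree_prod_eq_sum_degree) (use assms in auto)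
  show "coeff (\<Prod>i\<in>I. [:- y i, 1:]) (card I) = 1"
    using lead_coeff_prod[of "\<lambda>i. [:- y i, 1:]" I] d by simp
qed

text \<open>The degree may equal the number of nodes, hence the extra multiple of the nodal
  polynomial. The difference of the two sides vanishes at all \<open>card I\<close> nodes, but its
  coefficient of degree \<open>card I\<close> is zero.\<close>

lemma lagrange_decomposition:
  fixes P :: "complex poly" and y :: "'b \<Rightarrow> complex"
  assumes I: "finite I" "inj_on y I" and deg: "degree P \<le> card I"
  defines "r \<equiv> (\<lambda>i. poly P (y i) / (\<Prod>j\<in>I - {i}. y i - y j))"
  shows "P = smult (coeff P (card I)) (\<Prod>i\<in>I. [:- y i, 1:]) + (\<Sum>i\<in>I. smult (r i) (\<Prod>j\<in>I - {i}. [:- y j, 1:]))"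
proof -
  define T where "T = smult (coeff P (card I)) (\<Prod>i\<in>I. [:- y i, 1:]) + (\<Sum>i\<in>I. smult (r i) (\<Prod>j\<in>I - {i}. [:- y j, 1:]))"
  have dS: "degree (\<Sum>i\<in>I. smult (r i) (\<Prod>j\<in>I - {i}. [:- y j, 1:])) \<le> card I - 1"
  proof (rule degree_sum_le[OF I(1)])
    fix i assume "i \<in> I"
    then show "degree (smult (r i) (\<Prod>j\<in>I - {i}. [:- y j, 1:])) \<le> card I - 1"
      using degree_linear_prod(1)[of "I - {i}" y] I(1) degree_smult_le[of "r i" "\<Prod>j\<in>I - {i}. [:- y j, 1:]"] by simp
  qed
  have "degree T \<le> card I"
    unfolding T_def using dS degree_linear_prod(1)[OF I(1), of y]
    by (intro degree_add_le) (use degree_smult_le[of "coeff P (card I)" "\<Prod>i\<in>I. [:- y i, 1:]"] in auto)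
  then have dle: "degree (P - T) \<le> card I"
    using deg by (rule degree_diff_le[rotated])
  have cT: "coeff T (card I) = coeff P (card I)"
  proof (cases "I = {}")
    case False
    then have "card I \<noteq> 0" using I(1) by simp
    then have "coeff (\<Sum>i\<in>I. smult (r i) (\<Prod>j\<in>I - {i}. [:- y j, 1:])) (card I) = 0"
      using dS by (intro coeff_eq_0) auto
    then show ?thesis by (simp add: T_def degree_linear_prod(2)[OF I(1)])
  qed (simp add: T_def)
  have root: "poly (P - T) (y i) = 0" if i: "i \<in> I" for i
  proof -
    have 1: "(\<Prod>j\<in>I. poly [:- y j, 1:] (y i)) = 0"
      using I(1) i by (intro prod_zero) auto
    have 2: "(\<Prod>j\<in>I - {i'}. poly [:- y j, 1:] (y i)) = 0" if "i' \<in> I" "i' \<noteq> i" for i'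
      using I(1) i that by (intro prod_zero) auto
    have 3: "(\<Prod>j\<in>I - {i}. y i - y j) \<noteq> 0"
      using I i by (auto simp: inj_on_def)
    have "poly T (y i) = (\<Sum>i'\<in>I. r i' * (\<Prod>j\<in>I - {i'}. poly [:- y j, 1:] (y i)))"
      using 1 by (simp add: T_def poly_sum poly_prod)
    also have "\<dots> = r i * (\<Prod>j\<in>I - {i}. poly [:- y j, 1:] (y i))"
      using 2 by (subst sum.remove[OF I(1) i]) simp
    also have "\<dots> = poly P (y i)"
      using 3 by (simp add: r_def)
    finally show ?thesis by simp
  qed
  have "P - T = 0"
  proof (rule ccontr)
    assume ne: "P - T \<noteq> 0"
    have "card I = card (y ` I)" using I(2) by (simp add: card_image)
    also have "\<dots> \<le> card {z. poly (P - T) z = 0}"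
      using root ne by (intro card_mono poly_roots_finite) auto
    also have "\<dots> \<le> degree (P - T)" using ne by (rule card_poly_roots_bound)
    finally have "degree (P - T) = card I" using dle by simp
    moreover have "coeff (P - T) (card I) = 0" using cT by simp
    ultimately have "lead_coeff (P - T) = 0" by (simp only:)
    then show False using ne by (simp only: leading_coeff_0_iff)
  qed
  then show ?thesis unfolding T_def by simp
qed

text \<open>The expansions of \<open>1/(z - y)\<close> at infinity and at zero differ by
  \<open>\<delta>(z/y) / y\<close>.\<close>

lemma pole_jump:
  fixes y :: complex
  assumes "y \<noteq> 0"
  shows "fls_nth (inverse (fls_X_inv - fls_const y)) (- n) - fls_nth (inverse (fls_X - fls_const y)) n = y powi (- n - 1)"
proof -
  have i: "inverse (fls_X_inv - fls_const y) = fls_X * fps_to_fls (geo_inf y)"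
    "inverse (fls_X - fls_const y) = fps_to_fls (geo_zero y)"
    using geo_inf[of y] geo_zero[OF assms] by (simp_all add: inverse_unique)
  show ?thesis
  proof (cases "n \<ge> 0")
    case True
    then have "y powi (- n - 1) = inverse y ^ Suc (nat n)"
      by (simp add: power_int_def nat_add_distrib)
    then show ?thesis using True
      unfolding i by (simp add: fls_X_times_conv_shift geo_inf_def geo_zero_def)
  next
    case False
    then show ?thesis
      unfolding i by (simp add: fls_X_times_conv_shift geo_inf_def geo_zero_def power_int_def)
  qed
qed

text \<open>In the partial fraction decomposition the constant has the same expansion at both
  points, so each pole contributes its residue times one delta function and nothing else
  remains.\<close>

lemma expansion_difference:
  fixes P :: "complex poly" and y :: "'b \<Rightarrow> complex"
  assumes I: "finite I" "inj_on y I" "\<And>i. i \<in> I \<Longrightarrow> y i \<noteq> 0" and deg: "degree P \<le> card I"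
  shows "fls_nth (fls_poly P fls_X_inv / (\<Prod>i\<in>I. fls_X_inv - fls_const (y i))) (- n) -
      fls_nth (fls_poly P fls_X / (\<Prod>i\<in>I. fls_X - fls_const (y i))) n =
    (\<Sum>i\<in>I. poly P (y i) / (\<Prod>j\<in>I - {i}. y i - y j) * y i powi (- n - 1))"
proof -
  define r where "r i = poly P (y i) / (\<Prod>j\<in>I - {i}. y i - y j)" for i
  have pf: "fls_poly P Z / (\<Prod>i\<in>I. Z - fls_const (y i)) =
      fls_const (coeff P (card I)) + (\<Sum>i\<in>I. fls_const (r i) * inverse (Z - fls_const (y i)))"
    if Z: "\<And>i. i \<in> I \<Longrightarrow> Z - fls_const (y i) \<noteq> 0" for Z
  proof -
    have lin: "fls_poly [:- c, 1:] Z = Z - fls_const c" for c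
      by (simp add: fls_poly_linear fls_const_uminus)
    let ?D = "\<Prod>i\<in>I. Z - fls_const (y i)"
    have D: "?D \<noteq> 0" using Z I(1) by simp
    have "fls_poly P Z = fls_const (coeff P (card I)) * ?D + (\<Sum>i\<in>I. fls_const (r i) * (\<Prod>j\<in>I - {i}. Z - fls_const (y j)))"
      by (subst lagrange_decomposition[OF I(1,2) deg])
         (simp add: fls_poly_add fls_poly_smult fls_poly_sum fls_poly_prod lin r_def)
    also have "\<dots> / ?D = fls_const (coeff P (card I)) + (\<Sum>i\<in>I. fls_const (r i) * (\<Prod>j\<in>I - {i}. Z - fls_const (y j)) / ?D)"
      using D by (simp add: add_divide_distrib sum_divide_distrib)
    also have "(\<Sum>i\<in>I. fls_const (r i) * (\<Prod>j\<in>I - {i}. Z - fls_const (y j)) / ?D) = (\<Sum>i\<in>I. fls_const (r i) * inverse (Z - fls_const (y i)))"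
    proof (rule sum.cong[OF refl])
      fix i assume i: "i \<in> I"
      have "?D = (Z - fls_const (y i)) * (\<Prod>j\<in>I - {i}. Z - fls_const (y j))"
        by (rule prod.remove[OF I(1) i])
      then show "fls_const (r i) * (\<Prod>j\<in>I - {i}. Z - fls_const (y j)) / ?D = fls_const (r i) * inverse (Z - fls_const (y i))"
        using D by (simp add: divide_inverse)
    qed
    finally show ?thesis .
  qed
  have pfX: "fls_poly P fls_X / (\<Prod>i\<in>I. fls_X - fls_const (y i)) =
      fls_const (coeff P (card I)) + (\<Sum>i\<in>I. fls_const (r i) * inverse (fls_X - fls_const (y i)))"
    by (rule pf, rule fls_pole_nonzero(2), rule I(3))
  have "fls_nth (fls_poly P fls_X_inv / (\<Prod>i\<in>I. fls_X_inv - fls_const (y i))) (- n) -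
      fls_nth (fls_poly P fls_X / (\<Prod>i\<in>I. fls_X - fls_const (y i))) n
    = (\<Sum>i\<in>I. r i * (fls_nth (inverse (fls_X_inv - fls_const (y i))) (- n) - fls_nth (inverse (fls_X - fls_const (y i))) n))"
    unfolding pf[of fls_X_inv, OF fls_pole_nonzero(1)] pfX
    by (simp add: fls_nth_sum sum_subtractf right_diff_distrib)
  also have "\<dots> = (\<Sum>i\<in>I. r i * y i powi (- n - 1))"
    by (intro sum.cong refl) (simp add: pole_jump I(3))
  finally show ?thesis by (simp add: r_def)
qed

section \<open>The rational function \<open>K_i(z)\<close>\<close>

definition K_num :: "nat \<Rightarrow> (nat \<Rightarrow> nat) \<Rightarrow> (nat \<Rightarrow> nat \<Rightarrow> int) \<Rightarrow> (nat \<Rightarrow> complex) \<Rightarrow> complex \<Rightarrow>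
    complex poly \<Rightarrow> nat \<Rightarrow> (nat \<Rightarrow> nat \<Rightarrow> complex) \<Rightarrow> complex poly" where
  "K_num l m a q c N i V =
     smult (c * (\<Prod>j=1..l. \<Prod>p=1..m j. V j p powi a j i))
       (N * (\<Prod>j\<in>{1..l} - {i}. \<Prod>r=1..nat (- a j i). \<Prod>p=1..m j.
          [:- (q j powi (a j i + 2 * int r) * V j p ^ 2), 1:]))"

text \<open>The flag separates the support points of \<open>E_i\<close> (\<open>False\<close>) from
  those of \<open>F_i\<close> (\<open>True\<close>).\<close>

definition K_pole :: "(nat \<Rightarrow> complex) \<Rightarrow> nat \<Rightarrow> (nat \<Rightarrow> nat \<Rightarrow> complex) \<Rightarrow> nat \<times> bool \<Rightarrow> complex" where
  "K_pole q i V = (\<lambda>(p, b). if b then q i ^ 2 * V i p ^ 2 else V i p ^ 2)"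

definition K_den :: "(nat \<Rightarrow> nat) \<Rightarrow> (nat \<Rightarrow> complex) \<Rightarrow> nat \<Rightarrow> complex fls \<Rightarrow> (nat \<Rightarrow> nat \<Rightarrow> complex) \<Rightarrow> complex fls" where
  "K_den m q i Z V = (\<Prod>t\<in>{1..m i} \<times> UNIV. Z - fls_const (K_pole q i V t))"

lemma K_den_eq:
  "K_den m q i Z V = (\<Prod>p=1..m i. (Z - fls_const (V i p ^ 2)) * (Z - fls_const (q i ^ 2 * V i p ^ 2)))"
  unfolding K_den_def
  by (simp add: prod.cartesian_product' UNIV_bool K_pole_def mult_ac)

lemma poly_K_num:
  assumes "i \<in> {1..l}" "a i i = 2"
  shows "poly (K_num l m a q c N i V) X = c * (\<Prod>p=1..m i. V i p) ^ 2 * poly N X *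
    (\<Prod>j\<in>{1..l} - {i}. \<Prod>p=1..m j. node_factor (q j) (a j i) X (V j p))"
proof -
  have 1: "(\<Prod>j=1..l. \<Prod>p=1..m j. V j p powi a j i) =
      (\<Prod>p=1..m i. V i p) ^ 2 * (\<Prod>j\<in>{1..l} - {i}. \<Prod>p=1..m j. V j p powi a j i)"
    using assms by (subst prod.remove[of _ i]) (auto simp: prod_power_distrib)
  have 3: "poly (K_num l m a q c N i V) X = c * (\<Prod>j=1..l. \<Prod>p=1..m j. V j p powi a j i) * (poly N X *
      (\<Prod>j\<in>{1..l} - {i}. \<Prod>r=1..nat (- a j i). \<Prod>p=1..m j. X - q j powi (a j i + 2 * int r) * V j p ^ 2))"
    by (simp add: K_num_def poly_prod)
  show ?thesis unfolding 3 1 prod_node_factor by (simp only: mult_ac)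
qed

lemma K_num_upd_other:
  assumes i: "i \<in> {1..l}" "a i i = 2" and j: "j \<in> {1..l}" "j \<noteq> i" "p \<in> {1..m j}"
    and eq: "\<And>X. node_factor (q j) (a j i) X (V j p) * (X - A * y) = node_factor (q j) (a j i) X (s * V j p) * (A * X - y)"
  shows "[:- (A * y), 1:] * K_num l m a q c N i V = [:- y, A:] * K_num l m a q c N i (upd V j p s)"
proof (rule poly_eq_poly_eq_iff[THEN iffD1], rule ext)
  fix X
  have u: "upd V j p s i = V i" using j by (auto simp: upd_def)
  define G where "G W = (\<Prod>j\<in>{1..l} - {i}. \<Prod>p=1..m j. node_factor (q j) (a j i) X (W j p))" for W
  have "G V * (X - A * y) = G (upd V j p s) * (A * X - y)"
    unfolding G_def by (rule prod_prod_upd[where f = "\<lambda>j. node_factor (q j) (a j i) X"]) (use j eq in auto)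
  moreover have "poly ([:- (A * y), 1:] * K_num l m a q c N i V) X =
      c * (\<Prod>p=1..m i. V i p) ^ 2 * poly N X * (G V * (X - A * y))"
    by (simp only: poly_mult poly_K_num[where a = a and i = i and l = l and q = q, OF i] G_def) (simp add: mult_ac)
  moreover have "poly ([:- y, A:] * K_num l m a q c N i (upd V j p s)) X =
      c * (\<Prod>p=1..m i. V i p) ^ 2 * poly N X * (G (upd V j p s) * (A * X - y))"
    by (simp only: poly_mult poly_K_num[where a = a and i = i and l = l and q = q, OF i] G_def u) (simp add: mult_ac)
  ultimately show "poly ([:- (A * y), 1:] * K_num l m a q c N i V) X = poly ([:- y, A:] * K_num l m a q c N i (upd V j p s)) X"
    by simp
qed

lemma K_num_upd_same:
  assumes i: "i \<in> {1..l}" "a i i = 2" and p: "p \<in> {1..m i}"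
  shows "K_num l m a q c N i (upd V i p s) = smult (s ^ 2) (K_num l m a q c N i V)"
proof (rule poly_eq_poly_eq_iff[THEN iffD1], rule ext)
  fix X
  have N: "(\<Prod>p'=1..m i. upd V i p s i p') = s * (\<Prod>p'=1..m i. V i p')"
    using p by (subst (1 2) prod.remove[of _ p]) (auto simp: upd_def intro!: prod.cong)
  have G: "(\<Prod>j\<in>{1..l} - {i}. \<Prod>p'=1..m j. node_factor (q j) (a j i) X (upd V i p s j p')) =
      (\<Prod>j\<in>{1..l} - {i}. \<Prod>p'=1..m j. node_factor (q j) (a j i) X (V j p'))"
    by (intro prod.cong refl) (auto simp: upd_def)
  show "poly (K_num l m a q c N i (upd V i p s)) X = poly (smult (s ^ 2) (K_num l m a q c N i V)) X"
    unfolding poly_smult poly_K_num[where a = a and i = i and l = l and q = q, OF i] N G power_mult_distrib by (simp only: mult_ac)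
qed

text \<open>Since \<open>s^2\<close> is \<open>q_i^2\<close> or its inverse, scaling moves one of
  the two poles of the variable onto the old place of the other; only one linear factor of the
  denominator changes.\<close>

lemma K_den_upd_same:
  assumes p: "p \<in> {1..m i}" and t: "t * s ^ 2 = 1"
    and y: "(t = q i ^ 2 \<and> y = V i p ^ 2) \<or> (t * q i ^ 2 = 1 \<and> y = q i ^ 2 * V i p ^ 2)"
  shows "K_den m q i Z (upd V i p s) * (Z - fls_const (t * y)) = K_den m q i Z V * (Z - fls_const (s ^ 2 * y))"
proof -
  define f where "f v = (Z - fls_const (v ^ 2)) * (Z - fls_const (q i ^ 2 * v ^ 2))" for v
  have t0: "t \<noteq> 0" using t by auto
  have u: "upd V i p s i = (V i)(p := s * V i p)" by (auto simp: upd_def)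
  have "f (V i p) * (Z - fls_const (s ^ 2 * y)) = f (s * V i p) * (Z - fls_const (t * y))"
    using y
  proof
    assume h: "t = q i ^ 2 \<and> y = V i p ^ 2"
    have "q i ^ 2 * (s * V i p) ^ 2 = (t * s ^ 2) * V i p ^ 2"
      using h by (simp add: power_mult_distrib)
    then have e: "q i ^ 2 * (s ^ 2 * V i p ^ 2) = V i p ^ 2" using t by (simp add: power_mult_distrib)
    show ?thesis using h unfolding f_def power_mult_distrib e by (simp only: mult_ac)
  next
    assume h: "t * q i ^ 2 = 1 \<and> y = q i ^ 2 * V i p ^ 2"
    then have s: "s ^ 2 = q i ^ 2" using t t0 by (metis mult_left_cancel)
    have ty: "t * y = V i p ^ 2" using h by (simp add: mult.assoc[symmetric])
    have y: "y = q i ^ 2 * V i p ^ 2" using h by simp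
    show ?thesis unfolding ty f_def s power_mult_distrib unfolding y by (simp only: mult_ac)
  qed
  then have "(\<Prod>p'=1..m i. f (V i p')) * (Z - fls_const (s ^ 2 * y)) =
      (\<Prod>p'=1..m i. f (((V i)(p := s * V i p)) p')) * (Z - fls_const (t * y))"
    by (intro prod_upd[where f = "\<lambda>_. f"]) (use p in auto)
  then show ?thesis by (simp add: K_den_eq f_def u)
qed

definition K_fls :: "nat \<Rightarrow> (nat \<Rightarrow> nat) \<Rightarrow> (nat \<Rightarrow> nat \<Rightarrow> int) \<Rightarrow> (nat \<Rightarrow> complex) \<Rightarrow> complex \<Rightarrow>
    complex poly \<Rightarrow> nat \<Rightarrow> complex fls \<Rightarrow> (nat \<Rightarrow> nat \<Rightarrow> complex) \<Rightarrow> complex fls" where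
  "K_fls l m a q c N i Z V = fls_poly (K_num l m a q c N i V) Z / K_den m q i Z V"

lemma K_fls_exchange_other:
  assumes i: "i \<in> {1..l}" "a i i = 2" and j: "j \<in> {1..l}" "j \<noteq> i" "p \<in> {1..m j}"
    and eq: "\<And>X. node_factor (q j) (a j i) X (V j p) * (X - A * y) = node_factor (q j) (a j i) X (s * V j p) * (A * X - y)"
  shows "(Z - fls_const (A * y)) * K_fls l m a q c N i Z V =
    (fls_const A * Z - fls_const y) * K_fls l m a q c N i Z (upd V j p s)"
proof -
  have d: "K_den m q i Z (upd V j p s) = K_den m q i Z V"
    using j by (simp add: K_den_eq upd_def)
  have "fls_poly ([:- (A * y), 1:] * K_num l m a q c N i V) Z = fls_poly ([:- y, A:] * K_num l m a q c N i (upd V j p s)) Z"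
    by (rule arg_cong[where f = "\<lambda>P. fls_poly P Z"], rule K_num_upd_other, (rule i j eq)+)
  then have "(Z - fls_const (A * y)) * fls_poly (K_num l m a q c N i V) Z =
      (fls_const A * Z - fls_const y) * fls_poly (K_num l m a q c N i (upd V j p s)) Z"
    unfolding fls_poly_mult fls_poly_linear by (simp add: mult.commute)
  then show ?thesis by (simp only: K_fls_def d times_divide_eq_right)
qed

lemma K_fls_exchange_same:
  assumes i: "i \<in> {1..l}" "a i i = 2" and p: "p \<in> {1..m i}" and t: "t * s ^ 2 = 1"
    and y: "(t = q i ^ 2 \<and> y = V i p ^ 2) \<or> (t * q i ^ 2 = 1 \<and> y = q i ^ 2 * V i p ^ 2)"
    and nz: "K_den m q i Z V \<noteq> 0" "K_den m q i Z (upd V i p s) \<noteq> 0"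
  shows "(Z - fls_const (t * y)) * K_fls l m a q c N i Z V =
    (fls_const t * Z - fls_const y) * K_fls l m a q c N i Z (upd V i p s)"
proof -
  define P where "P = fls_poly (K_num l m a q c N i V) Z"
  have ts: "fls_const t * fls_const (s ^ 2) = 1" using t by simp
  have "(fls_const t * Z - fls_const y) * fls_const (s ^ 2) = (fls_const t * fls_const (s ^ 2)) * Z - fls_const (s ^ 2) * fls_const y"
    by (simp only: left_diff_distrib, simp only: mult_ac)
  then have "(fls_const t * Z - fls_const y) * fls_const (s ^ 2) = Z - fls_const (s ^ 2 * y)"
    unfolding ts by simp
  then have 1: "(fls_const t * Z - fls_const y) * K_fls l m a q c N i Z (upd V i p s) =
      (Z - fls_const (s ^ 2 * y)) * P / K_den m q i Z (upd V i p s)"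
    unfolding K_fls_def K_num_upd_same[where a = a and i = i and m = m, OF i p] fls_poly_smult P_def
    by (simp only: mult.assoc[symmetric] times_divide_eq_right)
  have "x * P / A = z * P / B" if "B * x = A * z" "A \<noteq> 0" "B \<noteq> 0" for A B x z
  proof -
    have "x * P * B = z * P * A" using that(1) by (metis mult.assoc mult.commute)
    then show ?thesis using that by (simp add: frac_eq_eq)
  qed
  from this[OF K_den_upd_same[where m = m and i = i and q = q and V = V and Z = Z, OF p t y] nz] show ?thesis
    unfolding 1 by (simp add: K_fls_def P_def)
qed

text \<open>There are \<open>-a\<close> exponents, running from \<open>a + 2\<close> to
  \<open>-a\<close>, and their average is 1.\<close>

lemma prod_powi_arith:
  fixes q :: complex
  assumes "q \<noteq> 0" "a \<le> 0"
  shows "(\<Prod>r=1..nat (- a). q powi (a + 2 * int r)) = q powi (- a)"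
proof -
  \<comment> \<open>The start \<open>b\<close> is detached from the number of factors so that
    induction on the latter applies.\<close>
  have s: "(\<Prod>r=1..n. q powi (b + 2 * int r)) = q powi (int n * (b + int n + 1))" for n b
  proof (induction n)
    case (Suc n)
    have e: "int n * (b + int n + 1) + (b + 2 * int (Suc n)) = int (Suc n) * (b + int (Suc n) + 1)"
      by (simp add: algebra_simps)
    have "(\<Prod>r=1..Suc n. q powi (b + 2 * int r)) = q powi (int n * (b + int n + 1)) * q powi (b + 2 * int (Suc n))"
      using Suc.IH by simp
    then show ?case using assms(1) by (simp only: power_int_add[symmetric] simp_thms e)
  qed simp
  have "int (nat (- a)) * (a + int (nat (- a)) + 1) = - a" using assms(2) by simp
  then show ?thesis unfolding s by simp
qed

lemma prod_powi: "(\<Prod>i\<in>I. f i powi z) = (\<Prod>i\<in>I. f i :: complex) powi z"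
  by (induction I rule: infinite_finite_induct) (simp_all add: power_int_mult_distrib)

text \<open>The second fact says that the values at infinity and at zero of \<open>K_i(z)\<close>
  multiply to 1, so the leading coefficients of its two expansions are inverse to each other. The
  square of \<open>c\<close> is chosen to cancel the powers of \<open>q\<close> from the zeros and
  poles, and the signs cancel because the number of zeros is the even number
  \<open>2 * m i\<close>.\<close>

lemma K_num_facts:
  fixes w :: "nat \<Rightarrow> complex"
  assumes i: "i \<in> {1..l}" "a i i = 2" and off: "\<And>j. j \<in> {1..l} \<Longrightarrow> j \<noteq> i \<Longrightarrow> a j i \<le> 0"
    and q: "\<And>j. j \<in> {1..l} \<Longrightarrow> q j \<noteq> 0" and V: "\<And>j p. V j p \<noteq> 0"
    and c: "c ^ 2 = (\<Prod>j=1..l. q j powi (int (m j) * a j i))"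
    and w: "\<And>s. w s \<noteq> 0" and N: "N = (\<Prod>s=1..L. [:- w s, inverse (w s):])"
    and L: "int L = (\<Sum>j=1..l. int (m j) * a j i)"
  defines "P \<equiv> K_num l m a q c N i V"
  shows "degree P \<le> 2 * m i"
    and "coeff P (2 * m i) * (coeff P 0 * (\<Prod>t\<in>{1..m i} \<times> UNIV. - inverse (K_pole q i V t))) = 1"
proof -
  let ?J = "{1..l} - {i}"
  define n where "n j = nat (- a j i)" for j
  define u where "u j r p = q j powi (a j i + 2 * int r) * V j p ^ 2" for j r p
  define M where "M = (\<Prod>j\<in>?J. \<Prod>r=1..n j. \<Prod>p=1..m j. [:- u j r p, 1:])"
  define A where "A j = (\<Prod>p=1..m j. V j p)" for j
  define C where "C = c * (\<Prod>j=1..l. A j powi a j i)"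
  have powi_prod: "(\<Prod>p=1..m j. V j p powi z) = A j powi z" for j z
    unfolding A_def by (rule prod_powi)
  have P: "P = smult C (N * M)"
    unfolding P_def K_num_def C_def M_def n_def u_def powi_prod ..
  have dM: "degree M = (\<Sum>j\<in>?J. n j * m j)"
  proof -
    have "degree (\<Prod>p=1..m j. [:- u j r p, 1:]) = m j" for j r
      using degree_linear_prod(1)[of "{1..m j}" "u j r"] by simp
    moreover have nz: "(\<Prod>p=1..m j. [:- u j r p, 1:]) \<noteq> 0" for j r by auto
    ultimately have "degree (\<Prod>r=1..n j. \<Prod>p=1..m j. [:- u j r p, 1:]) = n j * m j" for j
      by (subst degree_prod_eq_sum_degree) auto
    then show ?thesis
      unfolding M_def by (subst degree_prod_eq_sum_degree) auto
  qed
  have lM: "lead_coeff M = 1"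
    unfolding M_def by (simp add: lead_coeff_prod)
  have dN: "degree N = L"
    unfolding N by (subst degree_prod_eq_sum_degree) (use w in auto)
  have lN: "lead_coeff N = (\<Prod>s=1..L. inverse (w s))"
    unfolding N lead_coeff_prod using w by simp
  \<comment> \<open>The summand \<open>j = i\<close> of \<open>L\<close> is \<open>2 m_i\<close>;
    the others are the negatives of the degrees in the remaining product.\<close>
  have sum: "L + (\<Sum>j\<in>?J. n j * m j) = 2 * m i"
  proof -
    have "int (\<Sum>j\<in>?J. n j * m j) = (\<Sum>j\<in>?J. - (int (m j) * a j i))"
      using off by (auto simp: n_def intro!: sum.cong)
    moreover have "int L = 2 * int (m i) + (\<Sum>j\<in>?J. int (m j) * a j i)"
      unfolding L using i by (subst sum.remove[of _ i]) auto
    ultimately have "int (L + (\<Sum>j\<in>?J. n j * m j)) = int (2 * m i)"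
      by (simp add: sum_negf)
    then show ?thesis by (simp only: of_nat_eq_iff)
  qed
  have NM0: "N \<noteq> 0" "M \<noteq> 0" using lM lN w by auto
  have dNM: "degree (N * M) = 2 * m i"
    using degree_mult_eq[OF NM0] unfolding dM dN sum .
  show "degree P \<le> 2 * m i"
    unfolding P using degree_smult_le[of C "N * M"] dNM by simp
  have top: "coeff P (2 * m i) = C * (\<Prod>s=1..L. inverse (w s))"
    using lead_coeff_mult[of N M] lM lN unfolding dNM P by simp
  have bot: "coeff P 0 = C * ((\<Prod>s=1..L. - w s) * (\<Prod>j\<in>?J. \<Prod>r=1..n j. \<Prod>p=1..m j. - u j r p))"
    unfolding P N M_def by (simp add: poly_0_coeff_0[symmetric] poly_prod)
  have pole: "(\<Prod>t\<in>{1..m i} \<times> UNIV. - inverse (K_pole q i V t)) = inverse (q i powi (2 * int (m i)) * A i ^ 4)"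
  proof -
    have "(\<Prod>t\<in>{1..m i} \<times> UNIV. - inverse (K_pole q i V t)) =
        (\<Prod>p=1..m i. inverse (q i ^ 2) * inverse (V i p) ^ 4)"
      unfolding prod.cartesian_product' K_pole_def
      by (intro prod.cong refl) (simp add: UNIV_bool power_inverse[symmetric] field_simps power_add[symmetric] eval_nat_numeral)
    also have "\<dots> = inverse (q i ^ 2) ^ m i * inverse (A i) ^ 4"
      by (simp add: prod.distrib A_def prod_power_distrib prod_inversef[symmetric])
    also have "inverse (q i ^ 2) ^ m i = inverse (q i powi (2 * int (m i)))"
      by (simp add: power_int_def nat_mult_distrib power_mult[symmetric] power_inverse)
    finally show ?thesis by (simp add: power_inverse)
  qed
  have uj: "(\<Prod>r=1..n j. \<Prod>p=1..m j. - u j r p) = (- 1) ^ (n j * m j) * q j powi (int (m j) * - a j i) * (A j powi (- a j i)) ^ 2"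
    if j: "j \<in> ?J" for j
  proof -
    have a0: "a j i \<le> 0" using off j by auto
    have "(\<Prod>p=1..m j. - u j r p) = (- 1) ^ m j * (q j powi (a j i + 2 * int r)) ^ m j * A j ^ 2" for r
    proof -
      have "- u j r p = (- 1) * q j powi (a j i + 2 * int r) * V j p ^ 2" for p
        by (simp add: u_def)
      then show ?thesis
        by (simp only: prod.distrib prod_constant card_atLeastAtMost A_def prod_power_distrib diff_Suc_1)
    qed
    then have "(\<Prod>r=1..n j. \<Prod>p=1..m j. - u j r p) =
        ((- 1) ^ m j) ^ n j * (\<Prod>r=1..n j. q j powi (a j i + 2 * int r)) ^ m j * (A j ^ 2) ^ n j"
      by (simp add: prod.distrib prod_power_distrib)
    also have "(\<Prod>r=1..n j. q j powi (a j i + 2 * int r)) ^ m j = q j powi (int (m j) * - a j i)"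
    proof -
      have "q j \<noteq> 0" using q j by blast
      then show ?thesis
        unfolding n_def prod_powi_arith[OF \<open>q j \<noteq> 0\<close> a0]
        by (simp only: power_int_of_nat[symmetric] power_int_mult[symmetric] mult.commute)
    qed
    also have "(A j ^ 2) ^ n j = (A j powi (- a j i)) ^ 2"
      using a0 by (simp add: power_int_def n_def power_mult[symmetric] mult.commute)
    also have "((- 1) ^ m j) ^ n j = (- 1 :: complex) ^ (n j * m j)"
      by (simp add: power_mult[symmetric] mult.commute)
    finally show ?thesis .
  qed
  have Anz: "A j \<noteq> 0" for j using V by (simp add: A_def)
  have c2: "c ^ 2 = q i powi (2 * int (m i)) * (\<Prod>j\<in>?J. q j powi (int (m j) * a j i))"
    unfolding c using i by (subst prod.remove[of _ i]) (auto simp: mult.commute)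
  have C2: "C ^ 2 = c ^ 2 * (A i ^ 4 * (\<Prod>j\<in>?J. (A j powi a j i) ^ 2))"
    unfolding C_def power_mult_distrib using i
    by (subst prod.remove[of _ i]) (auto simp: power_mult_distrib prod_power_distrib power_mult[symmetric])
  \<comment> \<open>For each \<open>j\<close> the powers of \<open>q j\<close> and of
    \<open>A j\<close> cancel separately, leaving one sign per zero.\<close>
  have jj: "(\<Prod>j\<in>?J. q j powi (int (m j) * a j i)) * (\<Prod>j\<in>?J. (A j powi a j i) ^ 2) *
      (\<Prod>j\<in>?J. \<Prod>r=1..n j. \<Prod>p=1..m j. - u j r p) = (- 1) ^ (\<Sum>j\<in>?J. n j * m j)"
    unfolding power_sum prod.distrib[symmetric]
  proof (intro prod.cong refl)
    fix j assume j: "j \<in> ?J"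
    have 1: "q j powi (int (m j) * a j i) * q j powi (int (m j) * - a j i) = 1"
      using q j by (simp add: power_int_add[symmetric])
    have 2: "A j powi a j i * A j powi (- a j i) = 1"
      using Anz by (simp add: power_int_add[symmetric])
    have "q j powi (int (m j) * a j i) * (A j powi a j i) ^ 2 * (\<Prod>r=1..n j. \<Prod>p=1..m j. - u j r p)
      = (- 1) ^ (n j * m j) * (q j powi (int (m j) * a j i) * q j powi (int (m j) * - a j i)) *
        (A j powi a j i * A j powi (- a j i)) ^ 2"
      unfolding uj[OF j] power_mult_distrib by (simp only: mult_ac)
    then show "q j powi (int (m j) * a j i) * (A j powi a j i) ^ 2 * (\<Prod>r=1..n j. \<Prod>p=1..m j. - u j r p)
      = (- 1) ^ (n j * m j)"
      unfolding 1 2 by simp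
  qed
  have ww: "(\<Prod>s=1..L. inverse (w s)) * (\<Prod>s=1..L. - w s) = (- 1) ^ L"
    using w by (simp add: prod.distrib[symmetric])
  have "coeff P (2 * m i) * (coeff P 0 * (\<Prod>t\<in>{1..m i} \<times> UNIV. - inverse (K_pole q i V t))) =
      C ^ 2 * ((\<Prod>s=1..L. inverse (w s)) * (\<Prod>s=1..L. - w s)) *
      (\<Prod>j\<in>?J. \<Prod>r=1..n j. \<Prod>p=1..m j. - u j r p) * inverse (q i powi (2 * int (m i)) * A i ^ 4)"
    unfolding top bot pole power2_eq_square by (simp only: mult_ac)
  also have "\<dots> = (- 1) ^ L * ((\<Prod>j\<in>?J. q j powi (int (m j) * a j i)) * (\<Prod>j\<in>?J. (A j powi a j i) ^ 2) *
      (\<Prod>j\<in>?J. \<Prod>r=1..n j. \<Prod>p=1..m j. - u j r p)) *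
      ((q i powi (2 * int (m i)) * A i ^ 4) * inverse (q i powi (2 * int (m i)) * A i ^ 4))"
    unfolding ww C2 c2 by (simp only: mult_ac)
  also have "\<dots> = (- 1) ^ (L + (\<Sum>j\<in>?J. n j * m j))"
  proof -
    have nz: "q i powi (2 * int (m i)) * A i ^ 4 \<noteq> 0" using Anz[of i] q[OF i(1)] by simp
    show ?thesis unfolding jj power_add right_inverse[OF nz] by simp
  qed
  also have "\<dots> = 1" unfolding sum by simp
  finally show "coeff P (2 * m i) * (coeff P 0 * (\<Prod>t\<in>{1..m i} \<times> UNIV. - inverse (K_pole q i V t))) = 1" .
qed

text \<open>Where the shifts cancel, the products of the coefficients of \<open>E_i\<close> and
  \<open>F_i\<close> are residues of \<open>K_i(z)\<close> at its two families of poles. The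
  denominator factor with equal indices is \<open>\<plusminus> x q_i (q_i - 1/q_i)\<close>. It and
  the power \<open>q_i^(2 (m_i - 1))\<close> from rescaling one product of differences explain the
  constant \<open>- q_i^(-2 m_i) / (q_i - 1/q_i)\<close> of \<open>F_i\<close>.\<close>

lemma coef_diagonal:
  fixes c :: complex
  assumes i: "i \<in> {1..l}" "a i i = 2" and k: "k \<in> {1..m i}"
    and q: "q i \<noteq> 0" "q i ^ 2 \<noteq> 1" and V: "V i k \<noteq> 0"
    and J: "J \<union> J' = {1..l} - {i}" "J \<inter> J' = {}" and N: "R * R' = N"
  defines "x \<equiv> V i k ^ 2"
  defines "cE \<equiv> c / (q i - inverse (q i))" and "cF \<equiv> - (q i powi (- 2 * int (m i)) / (q i - inverse (q i)))"
    and "P \<equiv> K_num l m a q c N i V"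
  shows "(cE * coef m a q J R 1 i k V) * (cF * coef m a q J' R' (q i ^ 2) i k (upd V i k (inverse (q i)))) =
      1 / (q i - inverse (q i)) * (poly P x / ((\<Prod>p\<in>{1..m i} - {k}. x - V i p ^ 2) *
        (\<Prod>p=1..m i. x - q i ^ 2 * V i p ^ 2)) * inverse x)"
    and "(cF * coef m a q J' R' (q i ^ 2) i k V) * (cE * coef m a q J R 1 i k (upd V i k (q i))) =
      - (1 / (q i - inverse (q i)) * (poly P (q i ^ 2 * x) / ((\<Prod>p=1..m i. q i ^ 2 * x - V i p ^ 2) *
        (\<Prod>p\<in>{1..m i} - {k}. q i ^ 2 * x - q i ^ 2 * V i p ^ 2)) * inverse (q i ^ 2 * x)))"
proof -
  define A where "A = (\<Prod>p=1..m i. V i p)"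
  define g where "g S X = (\<Prod>j\<in>S. \<Prod>p=1..m j. node_factor (q j) (a j i) X (V j p))" for S X
  define D1 where "D1 = (\<Prod>p\<in>{1..m i} - {k}. x - V i p ^ 2)"
  define D2 where "D2 = (\<Prod>p\<in>{1..m i} - {k}. x - q i ^ 2 * V i p ^ 2)"
  define D3 where "D3 = (\<Prod>p\<in>{1..m i} - {k}. q i ^ 2 * x - V i p ^ 2)"
  define Q where "Q = q i ^ (2 * (m i - 1))"
  have iJ: "i \<notin> J" "i \<notin> J'" "finite J" "finite J'" using J finite_subset[of _ "{1..l} - {i}"] by auto
  have x0: "x \<noteq> 0" using V by (simp add: x_def)
  have gg: "g J X * g J' X = (\<Prod>j\<in>{1..l} - {i}. \<Prod>p=1..m j. node_factor (q j) (a j i) X (V j p))" for X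
    unfolding g_def J(1)[symmetric] by (rule prod.union_disjoint[symmetric]) (use iJ J in auto)
  have P: "poly P X = c * A ^ 2 * (poly R X * poly R' X) * (g J X * g J' X)" for X
    unfolding P_def poly_K_num[where a = a and i = i and l = l and q = q, OF i] gg A_def N[symmetric] by simp
  have card: "card ({1..m i} - {k}) = m i - 1" using k by simp
  have Nu: "(\<Prod>p=1..m i. upd V i k s i p) = s * A" for s
    unfolding A_def using k by (subst (1 2) prod.remove[of _ k]) (auto simp: upd_def intro!: prod.cong)
  have gu: "(\<Prod>j\<in>S. \<Prod>p=1..m j. node_factor (q j) (a j i) X (upd V i k s j p)) = g S X" if "i \<notin> S" for S X s
    unfolding g_def using that by (intro prod.cong refl) (auto simp: upd_def)
  have uk: "upd V i k s i k = s * V i k" for s by (simp add: upd_def)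
  have Vm2: "V i k powi (- 2) = inverse x" "(s * V i k) powi (- 2) = inverse (s ^ 2 * x)" for s
    by (simp_all add: x_def power_int_minus power_mult_distrib)
  have Du: "(\<Prod>p\<in>{1..m i} - {k}. (s * V i k) ^ 2 - upd V i k s i p ^ 2) = (\<Prod>p\<in>{1..m i} - {k}. s ^ 2 * x - V i p ^ 2)" for s
    by (intro prod.cong refl) (auto simp: upd_def x_def power_mult_distrib)
  have Dinv: "(\<Prod>p\<in>{1..m i} - {k}. inverse (q i) ^ 2 * x - V i p ^ 2) = inverse Q * D2"
  proof -
    have "(\<Prod>p\<in>{1..m i} - {k}. inverse (q i) ^ 2 * x - V i p ^ 2) = (\<Prod>p\<in>{1..m i} - {k}. inverse (q i ^ 2) * (x - q i ^ 2 * V i p ^ 2))"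
      by (intro prod.cong refl) (use q(1) in \<open>simp add: field_simps\<close>)
    also have "\<dots> = inverse (q i ^ 2) ^ (m i - 1) * D2"
      by (simp only: prod.distrib prod_constant card D2_def)
    finally show ?thesis by (simp add: Q_def power_mult power_inverse)
  qed
  have E: "coef m a q J R 1 i k V = A * g J x * inverse x * poly R x / D1"
    unfolding coef_def g_def[symmetric] A_def[symmetric] mult_1 Vm2 x_def[symmetric] D1_def ..
  have F: "coef m a q J' R' (q i ^ 2) i k V = A * g J' (q i ^ 2 * x) * inverse x * poly R' (q i ^ 2 * x) / D1"
    unfolding coef_def g_def[symmetric] A_def[symmetric] mult_1 Vm2 x_def[symmetric] D1_def ..
  have qx: "q i ^ 2 * (inverse (q i) * V i k) ^ 2 = x" "(q i * V i k) ^ 2 = q i ^ 2 * x"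
    using q(1) by (simp_all add: x_def power_mult_distrib power_inverse)
  have Fu: "coef m a q J' R' (q i ^ 2) i k (upd V i k (inverse (q i))) =
      inverse (q i) * A * g J' x * inverse (inverse (q i) ^ 2 * x) * poly R' x / (inverse Q * D2)"
    unfolding coef_def uk qx gu[OF iJ(2)] Nu Vm2 Du Dinv ..
  have Eu: "coef m a q J R 1 i k (upd V i k (q i)) =
      q i * A * g J (q i ^ 2 * x) * inverse (q i ^ 2 * x) * poly R (q i ^ 2 * x) / D3"
    unfolding coef_def uk mult_1 qx(2) gu[OF iJ(1)] Nu Vm2 by (simp only: Du[of "q i", unfolded qx(2)] D3_def)
  have Qm: "q i powi (- 2 * int (m i)) = inverse (q i ^ 2 * Q)"
  proof -
    have "m i = Suc (m i - 1)" using k by auto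
    then have "q i ^ 2 * Q = q i ^ (2 * m i)"
      unfolding Q_def power_add[symmetric] by (metis mult_Suc_right)
    moreover have "q i powi (- 2 * int (m i)) = inverse (q i ^ (2 * m i))"
    proof -
      have e: "- 2 * int (m i) = - int (2 * m i)" by simp
      show ?thesis unfolding e power_int_minus power_int_of_nat ..
    qed
    ultimately show ?thesis by simp
  qed
  have d0: "q i - inverse (q i) \<noteq> 0" using q by (auto simp: field_simps power2_eq_square)
  have Q0: "Q \<noteq> 0" using q(1) by (simp add: Q_def)
  have full2: "(\<Prod>p=1..m i. x - q i ^ 2 * V i p ^ 2) = - (x * q i * (q i - inverse (q i))) * D2"
    unfolding D2_def using k q(1) by (subst prod.remove[of _ k]) (auto simp: x_def power2_eq_square field_simps)
  have full3: "(\<Prod>p=1..m i. q i ^ 2 * x - V i p ^ 2) = (x * q i * (q i - inverse (q i))) * D3"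
    unfolding D3_def using k q(1) by (subst prod.remove[of _ k]) (auto simp: x_def power2_eq_square field_simps)
  have scale: "(\<Prod>p\<in>{1..m i} - {k}. q i ^ 2 * x - q i ^ 2 * V i p ^ 2) = Q * D1"
    unfolding right_diff_distrib[symmetric] by (simp only: prod.distrib prod_constant card D1_def Q_def power_mult)
  define h where "h = q i - inverse (q i)"
  have h0: "h \<noteq> 0" using d0 by (simp add: h_def)
  have cancel: "q i * (inverse (q i) * y) = y" "Q * (inverse Q * y) = y" for y
    using q(1) Q0 by (simp_all add: mult.assoc[symmetric])
  show "(cE * coef m a q J R 1 i k V) * (cF * coef m a q J' R' (q i ^ 2) i k (upd V i k (inverse (q i)))) =
      1 / (q i - inverse (q i)) * (poly P x / ((\<Prod>p\<in>{1..m i} - {k}. x - V i p ^ 2) *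
        (\<Prod>p=1..m i. x - q i ^ 2 * V i p ^ 2)) * inverse x)"
    unfolding E Fu P cE_def cF_def full2 D1_def[symmetric] Qm h_def[symmetric]
    using x0 Q0 q(1) h0 by (simp add: divide_inverse power_inverse mult_ac power2_eq_square cancel)
  show "(cF * coef m a q J' R' (q i ^ 2) i k V) * (cE * coef m a q J R 1 i k (upd V i k (q i))) =
      - (1 / (q i - inverse (q i)) * (poly P (q i ^ 2 * x) / ((\<Prod>p=1..m i. q i ^ 2 * x - V i p ^ 2) *
        (\<Prod>p\<in>{1..m i} - {k}. q i ^ 2 * x - q i ^ 2 * V i p ^ 2)) * inverse (q i ^ 2 * x)))"
    unfolding F Eu P cE_def cF_def full3 scale Qm h_def[symmetric]
    using x0 Q0 q(1) h0 by (simp add: divide_inverse power_inverse mult_ac power2_eq_square cancel)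
qed

section \<open>The representation\<close>

text \<open>The analogue of \<open>exchange_shift_series\<close> for a current of multiplication
  operators, which is not a sum of delta functions and so is compared coefficient by
  coefficient.\<close>

lemma exchange_mult_shift:
  assumes mero: "\<And>n. meromorphic_sev (\<kappa> n)"
      "\<And>k. k \<in> {1..M} \<Longrightarrow> meromorphic_sev (\<psi> k)" "\<And>k. k \<in> {1..M} \<Longrightarrow> meromorphic_sev (Y k)"
    and nz: "\<And>k \<gamma>. Y k \<gamma> \<noteq> 0"
    and eq: "\<And>n j \<gamma>. j \<in> {1..M} \<Longrightarrow>
      \<kappa> (n - 1) \<gamma> - A * Y j \<gamma> * \<kappa> n \<gamma> = A * \<kappa> (n - 1) (\<gamma> + c j) - Y j \<gamma> * \<kappa> n (\<gamma> + c j)"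
  shows "exchange_relation A (\<lambda>n. mult_op (\<kappa> n)) (shift_series M \<psi> Y c)"
  unfolding exchange_relation_def times_linear_def
proof (intro ext)
  fix n r :: int
  define F where "F n = weighted_shift (\<kappa> n) 0" for n
  define G where "G e k = weighted_shift (\<lambda>\<gamma>. Y k \<gamma> powi (- e) * \<psi> k \<gamma>) (c k)" for e k
  have S: "shift_series M \<psi> Y c e = (\<Sum>j=1..M. G e j)" for e
    by (simp add: shift_series_def G_def)
  have FF: "mult_op (\<kappa> n) = F n" for n by (simp add: F_def weighted_shift_0)
  have trm: "1 *\<^sub>C (F (n - 1) * G r j) + (- A) *\<^sub>C (F n * G (r - 1) j) = A *\<^sub>C (G r j * F (n - 1)) + (- 1) *\<^sub>C (G (r - 1) j * F n)"
    if j: "j \<in> {1..M}" for j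
    unfolding F_def G_def
  proof (rule weighted_shift_exchange)
    have p1: "y powi (- (n - 1)) = y powi (- n) * y" if "y \<noteq> 0" for y :: complex and n
      using that power_int_add_1[of y "- n"] by simp
    show "\<forall>\<^sub>F \<gamma> in generic. 1 * (\<kappa> (n - 1) \<gamma> * (Y j (\<gamma> + 0) powi (- r) * \<psi> j (\<gamma> + 0))) +
         (- A) * (\<kappa> n \<gamma> * (Y j (\<gamma> + 0) powi (- (r - 1)) * \<psi> j (\<gamma> + 0))) =
         A * (Y j \<gamma> powi (- r) * \<psi> j \<gamma> * \<kappa> (n - 1) (\<gamma> + c j)) +
         (- 1) * (Y j \<gamma> powi (- (r - 1)) * \<psi> j \<gamma> * \<kappa> n (\<gamma> + c j))"
    proof (rule always_eventually, rule allI)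
      fix \<gamma>
      have "1 * (\<kappa> (n - 1) \<gamma> * (Y j (\<gamma> + 0) powi (- r) * \<psi> j (\<gamma> + 0))) +
         (- A) * (\<kappa> n \<gamma> * (Y j (\<gamma> + 0) powi (- (r - 1)) * \<psi> j (\<gamma> + 0))) =
        Y j \<gamma> powi (- r) * \<psi> j \<gamma> * (\<kappa> (n - 1) \<gamma> - A * Y j \<gamma> * \<kappa> n \<gamma>)"
        unfolding p1[OF nz] by (simp add: algebra_simps)
      also have "\<dots> = A * (Y j \<gamma> powi (- r) * \<psi> j \<gamma> * \<kappa> (n - 1) (\<gamma> + c j)) +
         (- 1) * (Y j \<gamma> powi (- (r - 1)) * \<psi> j \<gamma> * \<kappa> n (\<gamma> + c j))"
        unfolding p1[OF nz] eq[OF j] by (simp add: algebra_simps)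
      finally show "1 * (\<kappa> (n - 1) \<gamma> * (Y j (\<gamma> + 0) powi (- r) * \<psi> j (\<gamma> + 0))) +
         (- A) * (\<kappa> n \<gamma> * (Y j (\<gamma> + 0) powi (- (r - 1)) * \<psi> j (\<gamma> + 0))) =
         A * (Y j \<gamma> powi (- r) * \<psi> j \<gamma> * \<kappa> (n - 1) (\<gamma> + c j)) +
         (- 1) * (Y j \<gamma> powi (- (r - 1)) * \<psi> j \<gamma> * \<kappa> n (\<gamma> + c j))" .
    qed
  qed (use j in \<open>auto intro!: meromorphic_sev_mult meromorphic_sev_powi_nonzero mero nz\<close>)
  have "1 *\<^sub>C (F (n - 1) * shift_series M \<psi> Y c r) + (- A) *\<^sub>C (F n * shift_series M \<psi> Y c (r - 1))
    = (\<Sum>j=1..M. 1 *\<^sub>C (F (n - 1) * G r j) + (- A) *\<^sub>C (F n * G (r - 1) j))"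
    unfolding S sum_distrib_left scaleC_sum_right sum.distrib ..
  also have "\<dots> = (\<Sum>j=1..M. A *\<^sub>C (G r j * F (n - 1)) + (- 1) *\<^sub>C (G (r - 1) j * F n))"
    by (intro sum.cong refl trm)
  also have "\<dots> = A *\<^sub>C (shift_series M \<psi> Y c r * F (n - 1)) + (- 1) *\<^sub>C (shift_series M \<psi> Y c (r - 1) * F n)"
    unfolding S sum_distrib_right scaleC_sum_right sum.distrib ..
  finally show "1 *\<^sub>C (mult_op (\<kappa> (n - 1)) * shift_series M \<psi> Y c r) + (- A) *\<^sub>C (mult_op (\<kappa> n) * shift_series M \<psi> Y c (r - 1))
    = A *\<^sub>C (shift_series M \<psi> Y c r * mult_op (\<kappa> (n - 1))) + (- 1) *\<^sub>C (shift_series M \<psi> Y c (r - 1) * mult_op (\<kappa> n))"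
    unfolding FF .
qed

section \<open>Power series with meromorphic coefficients\<close>

definition meromorphic_fps :: "(complex ^ 'v::finite \<Rightarrow> complex fps) \<Rightarrow> bool" where
  "meromorphic_fps F \<longleftrightarrow> (\<forall>n. meromorphic_sev (\<lambda>\<gamma>. fps_nth (F \<gamma>) n))"

lemma meromorphic_fps_mult:
  "meromorphic_fps F \<Longrightarrow> meromorphic_fps G \<Longrightarrow> meromorphic_fps (\<lambda>\<gamma>. F \<gamma> * G \<gamma>)"
  unfolding meromorphic_fps_def fps_mult_nth
  by (auto intro!: meromorphic_sev_sum meromorphic_sev_mult)

lemma meromorphic_fps_const: "meromorphic_sev f \<Longrightarrow> meromorphic_fps (\<lambda>\<gamma>. fps_const (f \<gamma>))"
  unfolding meromorphic_fps_def
proof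
  fix n assume "meromorphic_sev f"
  then show "meromorphic_sev (\<lambda>\<gamma>. fps_nth (fps_const (f \<gamma>)) n)"
    by (cases "n = 0") (simp_all add: meromorphic_sev_const)
qed

lemma meromorphic_fps_fixed: "meromorphic_fps (\<lambda>\<gamma>. F)"
  unfolding meromorphic_fps_def by (auto intro: meromorphic_sev_const)

lemma meromorphic_fps_prod:
  "(\<And>i. i \<in> I \<Longrightarrow> meromorphic_fps (F i)) \<Longrightarrow> meromorphic_fps (\<lambda>\<gamma>. \<Prod>i\<in>I. F i \<gamma>)"
proof (induction I rule: infinite_finite_induct)
  case (insert i I)
  then show ?case by (simp add: meromorphic_fps_mult)
qed (simp_all add: meromorphic_fps_fixed)

lemma meromorphic_fps_linear:
  assumes "meromorphic_sev f"
  shows "meromorphic_fps (\<lambda>\<gamma>. fps_of_poly [:f \<gamma>, 1:])"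
  unfolding meromorphic_fps_def
proof
  fix n
  show "meromorphic_sev (\<lambda>\<gamma>. fps_nth (fps_of_poly [:f \<gamma>, 1:]) n)"
    using assms by (cases n) (auto simp: coeff_pCons intro: meromorphic_sev_const split: nat.split)
qed

lemma meromorphic_fps_geo:
  "meromorphic_sev f \<Longrightarrow> meromorphic_fps (\<lambda>\<gamma>. geo_inf (f \<gamma>))"
  "meromorphic_sev f \<Longrightarrow> (\<And>\<gamma>. f \<gamma> \<noteq> 0) \<Longrightarrow> meromorphic_fps (\<lambda>\<gamma>. geo_zero (f \<gamma>))"
  unfolding meromorphic_fps_def geo_inf_def geo_zero_def fps_nth_Abs_fps
  by (auto intro!: meromorphic_sev_power meromorphic_sev_uminus meromorphic_sev_inverse simp del: power_Suc)

section \<open>Uniform treatment of the currents \<open>E\<close> and \<open>F\<close>\<close>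

locale difference_rep =
  fixes l :: nat and a :: "nat \<Rightarrow> nat \<Rightarrow> int" and d m :: "nat \<Rightarrow> nat"
    and x :: "nat \<Rightarrow> nat \<Rightarrow> 'v::finite"
    and \<nu> :: "nat \<Rightarrow> nat \<Rightarrow> complex" and \<omega>1 \<omega>2 :: complex
    and Rp Rm :: "nat \<Rightarrow> complex poly"
  assumes diag: "\<And>i. i \<in> {1..l} \<Longrightarrow> a i i = 2"
    and off: "\<And>i j. i \<in> {1..l} \<Longrightarrow> j \<in> {1..l} \<Longrightarrow> i \<noteq> j \<Longrightarrow> a i j \<le> 0"
    and dpos: "\<And>i. i \<in> {1..l} \<Longrightarrow> d i > 0"
    and sym: "\<And>i j. i \<in> {1..l} \<Longrightarrow> j \<in> {1..l} \<Longrightarrow> int (d i) * a i j = int (d j) * a j i"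
    and lpos: "\<And>i. i \<in> {1..l} \<Longrightarrow> l_coeff l a m i \<ge> 0"
    and bij: "bij_betw (\<lambda>(i, k). x i k) (SIGMA i:{1..l}. {1..m i}) UNIV"
    and om: "\<omega>2 \<noteq> 0" and root: "\<And>n. n > 0 \<Longrightarrow> q_par \<omega>1 \<omega>2 ^ n \<noteq> 1"
    and RR: "\<And>i. i \<in> {1..l} \<Longrightarrow> Rp i * Rm i =
           (\<Prod>s=1..nat (l_coeff l a m i). [:- w_par \<omega>2 \<nu> i s, inverse (w_par \<omega>2 \<nu> i s):])"
begin

definition qn :: "nat \<Rightarrow> complex" where "qn = q_node d \<omega>1 \<omega>2"

text \<open>Outside the index range \<open>x\<close> need not be injective; the value 1 there makes a shift act on
  \<open>V\<close> as the update of a single entry.\<close>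

definition V :: "complex ^ 'v \<Rightarrow> nat \<Rightarrow> nat \<Rightarrow> complex" where
  "V \<gamma> j p = (if j \<in> {1..l} \<and> p \<in> {1..m j} then v_fun x \<omega>2 \<gamma> j p else 1)"

lemma V_eq: "j \<in> {1..l} \<Longrightarrow> p \<in> {1..m j} \<Longrightarrow> V \<gamma> j p = v_fun x \<omega>2 \<gamma> j p"
  by (simp add: V_def)

lemma V_nonzero: "V \<gamma> j p \<noteq> 0"
  by (simp add: V_def v_fun_nonzero)

lemma qn_nonzero: "qn i \<noteq> 0"
  by (simp add: qn_def q_node_def q_par_def)

lemma qn_root: "i \<in> {1..l} \<Longrightarrow> \<forall>n>0. qn i ^ n \<noteq> 1"
  using root dpos by (simp add: qn_def q_node_def power_mult[symmetric])

lemma qn_square: "i \<in> {1..l} \<Longrightarrow> qn i ^ 2 \<noteq> 1"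
  using qn_root by simp

lemma qn_diff: "i \<in> {1..l} \<Longrightarrow> qn i - inverse (qn i) \<noteq> 0"
  using qn_square[of i] qn_nonzero[of i] by (auto simp: power2_eq_square field_simps)

lemma qn_sym:
  assumes "i \<in> {1..l}" "j \<in> {1..l}"
  shows "qn i powi a i j = qn j powi a j i"
proof -
  have "qn i powi a i j = q_par \<omega>1 \<omega>2 powi (int (d i) * a i j)" for i j
    by (simp add: qn_def q_node_def power_int_mult)
  then show ?thesis using sym[OF assms] by simp
qed

lemma x_inj: "i \<in> {1..l} \<Longrightarrow> k \<in> {1..m i} \<Longrightarrow> j \<in> {1..l} \<Longrightarrow> p \<in> {1..m j} \<Longrightarrow> x i k = x j p \<Longrightarrow> i = j \<and> k = p"
  using inj_onD[OF bij_betw_imp_inj_on[OF bij], of "(i, k)" "(j, p)"] by simp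

text \<open>This links translations with \<open>q\<close>: moving a coordinate of node
  \<open>i\<close> by \<open>\<i> * \<omega>1 * d i\<close> multiplies its exponential by
  \<open>qn i\<close>.\<close>

lemma exp_shift: "exp (2 * of_real pi * (\<i> * \<omega>1 * of_nat (d i)) / \<omega>2) = qn i"
proof -
  have "2 * of_real pi * (\<i> * \<omega>1 * of_nat (d i)) / \<omega>2 = of_nat (d i) * (2 * of_real pi * \<i> * \<omega>1 / \<omega>2)"
    by (simp add: field_simps)
  then show ?thesis
    unfolding qn_def q_node_def q_par_def by (simp only: exp_of_nat_mult)
qed

lemma V_generic:
  assumes "i \<in> {1..l}" "k \<in> {1..m i}" "j \<in> {1..l}" "p \<in> {1..m j}" "(i, k) \<noteq> (j, p)" "c \<noteq> 0"
  shows "eventually (\<lambda>\<gamma>. c * V \<gamma> i k ^ 2 \<noteq> c' * V \<gamma> j p ^ 2) generic"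
proof -
  have "x i k \<noteq> x j p" using x_inj[OF assms(1-4)] assms(5) by blast
  from generic_v_fun_neq[of x i k j p \<omega>2 c c', OF this om assms(6)] show ?thesis
    unfolding V_eq[OF assms(1,2)] V_eq[OF assms(3,4)] .
qed

lemma meromorphic_V: "meromorphic_sev (\<lambda>\<gamma>. V \<gamma> j p)"
  unfolding V_def
  by (cases "j \<in> {1..l} \<and> p \<in> {1..m j}") (simp_all only: if_True if_False simp_thms meromorphic_v_fun meromorphic_sev_const)

text \<open>In the following \<open>b = True\<close> stands for \<open>E\<close> and \<open>b = False\<close> for \<open>F\<close>. The relations (5), (6)
  then have the same shape with \<open>q\<^sub>i\<close> replaced by \<open>P b i\<close>.\<close>

definition P :: "bool \<Rightarrow> nat \<Rightarrow> complex" where "P b i = (if b then qn i else inverse (qn i))"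
definition J :: "bool \<Rightarrow> nat \<Rightarrow> nat set" where "J b i = (if b then {i+1..l} else {1..<i})"
definition kap :: "bool \<Rightarrow> nat \<Rightarrow> complex" where "kap b i = (if b then 1 else qn i ^ 2)"
definition cst :: "bool \<Rightarrow> nat \<Rightarrow> complex" where
  "cst b i = (if b then c_coeff l a d m \<omega>1 \<omega>2 i / (qn i - inverse (qn i))
              else - (qn i powi (- 2 * int (m i)) / (qn i - inverse (qn i))))"
definition R :: "bool \<Rightarrow> nat \<Rightarrow> complex poly" where "R b i = (if b then Rp i else Rm i)"
definition Sh :: "bool \<Rightarrow> nat \<Rightarrow> nat \<Rightarrow> complex ^ 'v" where
  "Sh b i k = axis (x i k) (if b then - (\<i> * \<omega>1 * of_nat (d i)) else \<i> * \<omega>1 * of_nat (d i))"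
definition Phi :: "bool \<Rightarrow> nat \<Rightarrow> nat \<Rightarrow> complex ^ 'v \<Rightarrow> complex" where
  "Phi b i k \<gamma> = cst b i * coef m a qn (J b i) (R b i) (kap b i) i k (V \<gamma>)"
definition Xi :: "bool \<Rightarrow> nat \<Rightarrow> nat \<Rightarrow> complex ^ 'v \<Rightarrow> complex" where
  "Xi b i k \<gamma> = kap b i * V \<gamma> i k ^ 2"
definition S :: "bool \<Rightarrow> nat \<Rightarrow> int \<Rightarrow> 'v mero endo" where
  "S b i = shift_series (m i) (Phi b i) (Xi b i) (Sh b i)"

lemma V_shift:
  assumes "i \<in> {1..l}" "k \<in> {1..m i}"
  shows "V (\<gamma> + Sh b i k) = upd (V \<gamma>) i k (inverse (P b i))"
proof (intro ext)
  fix j p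
  have e: "exp (2 * of_real pi * (if b then - (\<i> * \<omega>1 * of_nat (d i)) else \<i> * \<omega>1 * of_nat (d i)) / \<omega>2) = inverse (P b i)"
    using exp_shift[of i] by (auto simp: P_def exp_minus)
  show "V (\<gamma> + Sh b i k) j p = upd (V \<gamma>) i k (inverse (P b i)) j p"
  proof (cases "j \<in> {1..l} \<and> p \<in> {1..m j}")
    case True
    have "x j p = x i k \<Longrightarrow> j = i \<and> p = k"
      by (rule x_inj[OF _ _ assms]) (simp_all only: True)
    then have "x j p = x i k \<longleftrightarrow> j = i \<and> p = k" by (rule iffI) simp_all
    then show ?thesis using True assms unfolding V_def upd_def Sh_def v_fun_shift e by auto
  next
    case False
    then have n: "\<not> (j = i \<and> p = k)" using assms by auto
    show ?thesis unfolding V_def upd_def using False n by (simp only: if_False)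
  qed
qed

lemma P_nonzero: "P b i \<noteq> 0" and kap_nonzero: "kap b i \<noteq> 0"
  using qn_nonzero by (auto simp: P_def kap_def)

lemma P_sym: "i \<in> {1..l} \<Longrightarrow> j \<in> {1..l} \<Longrightarrow> P b i powi a i j = P b j powi a j i"
  using qn_sym by (auto simp: P_def power_int_inverse)

lemma P_root: "i \<in> {1..l} \<Longrightarrow> \<forall>n>0. P b i ^ n \<noteq> 1"
  using qn_root by (auto simp: P_def power_inverse)

lemma Xi_nonzero: "Xi b i k \<gamma> \<noteq> 0"
  by (simp add: Xi_def kap_nonzero V_nonzero)

text \<open>The downward rule serves \<open>E\<close> and the upward rule \<open>F\<close>;
  \<open>kap\<close> absorbs the square of \<open>q\<close> that distinguishes their support
  points.\<close>

lemma node_factor_P: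
  assumes "a j i \<le> 0" "v \<noteq> 0"
  shows "node_factor (qn j) (a j i) X v * (X - P b j powi a j i * (kap b j * v ^ 2)) =
    node_factor (qn j) (a j i) X (inverse (P b j) * v) * (P b j powi a j i * X - kap b j * v ^ 2)"
proof (cases b)
  case True
  then show ?thesis using node_factor_shift_down[OF qn_nonzero assms(2,1)] by (simp add: P_def kap_def)
next
  case False
  have "inverse (qn j) powi a j i = qn j powi (- a j i)" by (simp add: power_int_inverse power_int_minus)
  then show ?thesis using False node_factor_shift_up[OF qn_nonzero assms(2,1), of j X] by (simp add: P_def kap_def)
qed

lemma V_generic': 
  assumes "i \<in> {1..l}" "k \<in> {1..m i}" "j \<in> {1..l}" "p \<in> {1..m j}" "i \<noteq> j \<or> k \<noteq> p" "c \<noteq> 0"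
  shows "eventually (\<lambda>\<gamma>. c * V \<gamma> i k ^ 2 \<noteq> V \<gamma> j p ^ 2) generic"
  using V_generic[OF assms(1-4) _ assms(6), of 1] assms(5) by auto

lemma V_generic1: 
  assumes "i \<in> {1..l}" "k \<in> {1..m i}" "p \<in> {1..m i}" "k \<noteq> p"
  shows "eventually (\<lambda>\<gamma>. V \<gamma> i k ^ 2 \<noteq> V \<gamma> i p ^ 2) generic"
  using V_generic'[OF assms(1,2,1,3), of 1] assms(4) by auto

lemma meromorphic_Xi: "meromorphic_sev (Xi b i k)"
  unfolding Xi_def by (intro meromorphic_sev_mult meromorphic_sev_const meromorphic_sev_power meromorphic_V)

lemma meromorphic_Phi:
  assumes "i \<in> {1..l}" "k \<in> {1..m i}"
  shows "meromorphic_sev (Phi b i k)"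
proof -
  have "eventually (\<lambda>\<gamma>. \<forall>p\<in>{1..m i} - {k}. V \<gamma> i k ^ 2 \<noteq> V \<gamma> i p ^ 2) generic"
    by (intro eventually_ball_finite ballI V_generic1) (use assms in auto)
  then have "eventually (\<lambda>\<gamma>. (\<Prod>p\<in>{1..m i} - {k}. V \<gamma> i k ^ 2 - V \<gamma> i p ^ 2) \<noteq> 0) generic"
    by eventually_elim auto
  then show ?thesis
    unfolding Phi_def coef_def node_factor_def
    by (intro meromorphic_sev_mult meromorphic_sev_divide meromorphic_sev_const meromorphic_sev_prod
        meromorphic_sev_diff meromorphic_sev_power meromorphic_sev_poly meromorphic_V
        meromorphic_sev_powi_nonzero V_nonzero)
qed

lemma J_facts:
  "i \<notin> J b i" "finite (J b i)" "j \<in> J b i \<Longrightarrow> j \<in> {1..l} \<and> j \<noteq> i" if "i \<in> {1..l}" for i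
  using that by (auto simp: J_def split: if_splits)

text \<open>Of two different nodes exactly one has coefficients involving the variables of the
  other, because the formulas use the order of the nodes.\<close>

lemma J_iff:
  assumes "i \<in> {1..l}" "j \<in> {1..l}" "i \<noteq> j"
  shows "j \<in> J b i \<longleftrightarrow> i \<notin> J b j"
  using assms by (auto simp: J_def)

lemma Xi_shift:
  assumes "i \<in> {1..l}" "k \<in> {1..m i}"
  shows "j \<noteq> i \<or> p \<noteq> k \<Longrightarrow> Xi b' j p (\<gamma> + Sh b i k) = Xi b' j p \<gamma>"
    and "P b i ^ 2 * Xi b' i k (\<gamma> + Sh b i k) = Xi b' i k \<gamma>"
proof -
  show "j \<noteq> i \<or> p \<noteq> k \<Longrightarrow> Xi b' j p (\<gamma> + Sh b i k) = Xi b' j p \<gamma>"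
    unfolding Xi_def V_shift[OF assms] by (auto simp: upd_def)
  have "P b i ^ 2 * inverse (P b i) ^ 2 = 1"
    using P_nonzero[of b i] by (simp add: power_mult_distrib[symmetric])
  moreover have "P b i ^ 2 * Xi b' i k (\<gamma> + Sh b i k) = (P b i ^ 2 * inverse (P b i) ^ 2) * Xi b' i k \<gamma>"
    unfolding Xi_def V_shift[OF assms] by (simp add: upd_def power_mult_distrib mult_ac)
  ultimately show "P b i ^ 2 * Xi b' i k (\<gamma> + Sh b i k) = Xi b' i k \<gamma>" by simp
qed

lemma Phi_self:
  assumes i: "i \<in> {1..l}" and kn: "k \<in> {1..m i}" "n \<in> {1..m i}" "k \<noteq> n"
  shows "eventually (\<lambda>\<gamma>. Phi b i k \<gamma> * Phi b i n (\<gamma> + Sh b i k) * (Xi b i k \<gamma> - P b i ^ 2 * Xi b i n \<gamma>) =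
    Phi b i n \<gamma> * Phi b i k (\<gamma> + Sh b i n) * (P b i ^ 2 * Xi b i k \<gamma> - Xi b i n \<gamma>)) generic"
proof -
  have p0: "P b i ^ 2 \<noteq> 0" using P_nonzero by simp
  have "eventually (\<lambda>\<gamma>. V \<gamma> i n ^ 2 \<noteq> V \<gamma> i k ^ 2) generic"
    "eventually (\<lambda>\<gamma>. P b i ^ 2 * V \<gamma> i n ^ 2 \<noteq> V \<gamma> i k ^ 2) generic"
    "eventually (\<lambda>\<gamma>. P b i ^ 2 * V \<gamma> i k ^ 2 \<noteq> V \<gamma> i n ^ 2) generic"
    using kn i p0 by (auto intro!: V_generic1 V_generic')
  then show ?thesis
  proof eventually_elim
    case (elim \<gamma>)
    have t: "P b i ^ 2 * inverse (P b i) ^ 2 = 1"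
      using P_nonzero[of b i] by (simp add: power_mult_distrib[symmetric])
    let ?c = "coef m a qn (J b i) (R b i) (kap b i) i"
    have "?c k (V \<gamma>) * ?c n (upd (V \<gamma>) i k (inverse (P b i))) * (V \<gamma> i k ^ 2 - P b i ^ 2 * V \<gamma> i n ^ 2) =
      ?c n (V \<gamma>) * ?c k (upd (V \<gamma>) i n (inverse (P b i))) * (P b i ^ 2 * V \<gamma> i k ^ 2 - V \<gamma> i n ^ 2)"
      by (rule coef_exchange_self, rule J_facts(1)[OF i], (rule kn t elim)+)
    moreover have "Xi b i k \<gamma> - P b i ^ 2 * Xi b i n \<gamma> = kap b i * (V \<gamma> i k ^ 2 - P b i ^ 2 * V \<gamma> i n ^ 2)"
      "P b i ^ 2 * Xi b i k \<gamma> - Xi b i n \<gamma> = kap b i * (P b i ^ 2 * V \<gamma> i k ^ 2 - V \<gamma> i n ^ 2)"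
      by (simp_all add: Xi_def algebra_simps)
    moreover have "(c * A) * (c * B) * (e * z) = (c * A') * (c * B') * (e * z')" if "A * B * z = A' * B' * z'"
      for c e A B z A' B' z' :: complex
      using arg_cong[OF that, of "\<lambda>y. c * c * e * y"] by (simp only: mult_ac)
    ultimately show ?case
      unfolding Phi_def V_shift[OF i kn(1)] V_shift[OF i kn(2)] by simp
  qed
qed

lemma coef_unrelated_shift:
  assumes "i \<in> {1..l}" "k \<in> {1..m i}" "i \<noteq> j" "i \<notin> J b j"
  shows "Phi b j p (\<gamma> + Sh b' i k) = Phi b j p \<gamma>"
  unfolding Phi_def V_shift[OF assms(1,2)] coef_upd_unrelated[OF assms(3,4)] ..

text \<open>The flags \<open>b\<close> and \<open>b'\<close> are independent, so the same rule
  covers the effect of \<open>F\<close> on coefficients of \<open>E\<close> and conversely.\<close>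

lemma coef_related_shift:
  assumes i: "i \<in> {1..l}" "k \<in> {1..m i}" and j: "j \<in> {1..l}" "j \<noteq> i" "j \<in> J b i" and p: "p \<in> {1..m j}"
  shows "Phi b i k \<gamma> * (Xi b i k \<gamma> - P b' j powi a j i * Xi b' j p \<gamma>) =
    Phi b i k (\<gamma> + Sh b' j p) * (P b' j powi a j i * Xi b i k \<gamma> - Xi b' j p \<gamma>)"
proof -
  have "coef m a qn (J b i) (R b i) (kap b i) i k (V \<gamma>) * (Xi b i k \<gamma> - P b' j powi a j i * Xi b' j p \<gamma>) =
    coef m a qn (J b i) (R b i) (kap b i) i k (upd (V \<gamma>) j p (inverse (P b' j))) *
      (P b' j powi a j i * Xi b i k \<gamma> - Xi b' j p \<gamma>)"
  proof (rule coef_upd_other, rule j(2), rule J_facts(2)[OF i(1)], rule j(3), rule p)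
    show "node_factor (qn j) (a j i) (kap b i * V \<gamma> i k ^ 2) (V \<gamma> j p) * (Xi b i k \<gamma> - P b' j powi a j i * Xi b' j p \<gamma>) =
      node_factor (qn j) (a j i) (kap b i * V \<gamma> i k ^ 2) (inverse (P b' j) * V \<gamma> j p) *
        (P b' j powi a j i * Xi b i k \<gamma> - Xi b' j p \<gamma>)"
      unfolding Xi_def by (rule node_factor_P[OF off[OF j(1) i(1) j(2)] V_nonzero])
  qed
  then show ?thesis unfolding Phi_def V_shift[OF j(1) p] by (simp only: mult.assoc)
qed

text \<open>By \<open>J_iff\<close> just one coefficient is changed by the shift of the other, and
  its transformation is the required exchange; \<open>P_sym\<close> translates between the exponents
  \<open>a i j\<close> and \<open>a j i\<close>.\<close>

lemma Phi_other:
  assumes i: "i \<in> {1..l}" "k \<in> {1..m i}" and j: "j \<in> {1..l}" "j \<noteq> i" "p \<in> {1..m j}"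
  shows "Phi b i k \<gamma> * Phi b j p (\<gamma> + Sh b i k) * (Xi b i k \<gamma> - P b i powi a i j * Xi b j p \<gamma>) =
    Phi b j p \<gamma> * Phi b i k (\<gamma> + Sh b j p) * (P b i powi a i j * Xi b i k \<gamma> - Xi b j p \<gamma>)"
proof (cases "j \<in> J b i")
  case True
  then have "i \<notin> J b j" using J_iff[OF i(1) j(1)] j(2) by blast
  then have 1: "Phi b j p (\<gamma> + Sh b i k) = Phi b j p \<gamma>"
    using j(2) by (intro coef_unrelated_shift[OF i]) auto
  show ?thesis
    using arg_cong[OF coef_related_shift[OF i j(1,2) True j(3), of \<gamma> b], of "\<lambda>z. Phi b j p \<gamma> * z"]
    unfolding 1 P_sym[OF i(1) j(1)] by (simp only: mult_ac)
next
  case False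
  then have iJ: "i \<in> J b j" using J_iff[OF i(1) j(1)] j(2) by blast
  have 1: "Phi b i k (\<gamma> + Sh b j p) = Phi b i k \<gamma>"
    by (rule coef_unrelated_shift[OF j(1,3,2) False])
  have "Phi b j p \<gamma> * (Xi b j p \<gamma> - P b i powi a i j * Xi b i k \<gamma>) =
    Phi b j p (\<gamma> + Sh b i k) * (P b i powi a i j * Xi b j p \<gamma> - Xi b i k \<gamma>)"
    by (rule coef_related_shift[OF j(1,3) i(1) _ iJ i(2)]) (use j(2) in auto)
  \<comment> \<open>Both linear factors change sign when the roles of \<open>i\<close> and
    \<open>j\<close> are swapped.\<close>
  from arg_cong[OF this, of "\<lambda>z. - (Phi b i k \<gamma> * z)"] show ?thesis
    unfolding 1 by (simp add: algebra_simps)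
qed

lemma exchange_SS:
  assumes i: "i \<in> {1..l}" and j: "j \<in> {1..l}"
  shows "exchange_relation (P b i powi a i j) (S b i) (S b j)"
  unfolding S_def
proof (rule exchange_shift_series)
  fix k p :: nat and e r :: int
  assume kp: "k \<in> {1..m i}" "p \<in> {1..m j}"
  show "\<forall>\<^sub>F \<gamma> in generic.
    Phi b i k \<gamma> * Phi b j p (\<gamma> + Sh b i k) * (Xi b i k \<gamma> powi e * Xi b j p (\<gamma> + Sh b i k) powi r) *
      (Xi b i k \<gamma> - P b i powi a i j * Xi b j p (\<gamma> + Sh b i k)) =
    Phi b j p \<gamma> * Phi b i k (\<gamma> + Sh b j p) * (Xi b i k (\<gamma> + Sh b j p) powi e * Xi b j p \<gamma> powi r) *
      (P b i powi a i j * Xi b i k (\<gamma> + Sh b j p) - Xi b j p \<gamma>)"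
  proof (cases "i = j \<and> k = p")
    \<comment> \<open>The two terms move the same variable, and \<open>Xi_shift\<close> makes the
      linear factors on both sides zero.\<close>
    case True
    then have A: "P b i powi a i j = P b i ^ 2" using diag[OF i] by simp
    show ?thesis
      using True Xi_shift(2)[OF i kp(1), of b b] unfolding A by simp
  next
    case False
    have X: "Xi b j p (\<gamma> + Sh b i k) = Xi b j p \<gamma>" "Xi b i k (\<gamma> + Sh b j p) = Xi b i k \<gamma>" for \<gamma>
      using False by (intro Xi_shift(1)[OF i kp(1)] Xi_shift(1)[OF j kp(2)]; auto)+
    have "eventually (\<lambda>\<gamma>. Phi b i k \<gamma> * Phi b j p (\<gamma> + Sh b i k) * (Xi b i k \<gamma> - P b i powi a i j * Xi b j p \<gamma>) =
      Phi b j p \<gamma> * Phi b i k (\<gamma> + Sh b j p) * (P b i powi a i j * Xi b i k \<gamma> - Xi b j p \<gamma>)) generic"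
    proof (cases "i = j")
      case True
      then have A: "P b i powi a i j = P b i ^ 2" using diag[OF i] by simp
      show ?thesis unfolding A using True False Phi_self[OF i kp(1), of p b] kp(2) by simp
    next
      case False
      show ?thesis by (rule always_eventually, rule allI, rule Phi_other[OF i kp(1) j _ kp(2)]) (use False in auto)
    qed
    then show ?thesis
    proof eventually_elim
      case (elim \<gamma>)
      from arg_cong[OF elim, of "\<lambda>z. (Xi b i k \<gamma> powi e * Xi b j p \<gamma> powi r) * z"]
      show ?case unfolding X by (simp only: mult_ac)
    qed
  qed
qed (use i j in \<open>auto intro: meromorphic_Phi meromorphic_Xi simp: Xi_nonzero\<close>)

lemma serre_SS:
  assumes i: "i \<in> {1..l}" and j: "j \<in> {1..l}" "i \<noteq> j"
  shows "serre_relation (qn i) (nat (1 - a i j)) (S b i) (S b j)"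
proof -
  define n where "n = nat (- a i j)"
  have an: "a i j = - int n" using off[OF i j] by (simp add: n_def)
  have mn: "nat (1 - a i j) = Suc n" using off[OF i j] by (simp add: n_def)
  have Q: "P b i powi a i j = inverse (P b i) ^ n"
    unfolding an by (simp add: power_int_minus power_inverse)
  have ji: "j \<noteq> i" using j(2) by simp
  show ?thesis
    unfolding S_def
  proof (rule serre_shift_series[where p = "P b i" and n = n and Q = "P b i powi a i j"])
    show "\<forall>n>0. P b i ^ n \<noteq> 1" by (rule P_root[OF i])
    show "P b i \<noteq> 0" by (rule P_nonzero)
    \<comment> \<open>For \<open>F\<close> the parameter is the inverse of \<open>qn i\<close>,
      under which the q-binomials are invariant.\<close>
    show "qbinom (qn i) (nat (1 - a i j)) k = qbinom (P b i) (nat (1 - a i j)) k" for k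
      by (simp add: P_def qbinom_inverse)
    show "\<forall>\<^sub>F \<gamma> in generic. P b i powi a i j * Xi b i k \<gamma> - Xi b j p \<gamma> \<noteq> 0"
      if "k \<in> {1..m i}" "p \<in> {1..m j}" for k p
    proof -
      have "P b i powi a i j * kap b i \<noteq> 0" using P_nonzero kap_nonzero by simp
      from V_generic[OF i that(1) j(1) that(2) _ this, of "kap b j"] j(2)
      show ?thesis by (auto simp: Xi_def mult.assoc)
    qed
    show "\<forall>\<^sub>F \<gamma> in generic. Phi b i k \<gamma> * Phi b j p (\<gamma> + Sh b i k) * (Xi b i k \<gamma> - P b i powi a i j * Xi b j p \<gamma>) =
      Phi b j p \<gamma> * Phi b i k (\<gamma> + Sh b j p) * (P b i powi a i j * Xi b i k \<gamma> - Xi b j p \<gamma>)"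
      if "k \<in> {1..m i}" "p \<in> {1..m j}" for k p
      by (rule always_eventually, rule allI, rule Phi_other[OF i that(1) j(1) ji that(2)])
    show "\<forall>\<^sub>F \<gamma> in generic. Phi b i k \<gamma> * Phi b i n (\<gamma> + Sh b i k) * (Xi b i k \<gamma> - (P b i)\<^sup>2 * Xi b i n \<gamma>) =
      Phi b i n \<gamma> * Phi b i k (\<gamma> + Sh b i n) * ((P b i)\<^sup>2 * Xi b i k \<gamma> - Xi b i n \<gamma>)"
      if "k \<in> {1..m i}" "n \<in> {1..m i}" "k \<noteq> n" for k n
      by (rule Phi_self[OF i that])
    show "Xi b i k (\<gamma> + Sh b i n) = Xi b i k \<gamma>" if "k \<in> {1..m i}" "n \<in> {1..m i}" "k \<noteq> n" for k n \<gamma>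
      using Xi_shift(1)[OF i that(2)] that(3) by blast
    show "(P b i)\<^sup>2 * Xi b i k (\<gamma> + Sh b i k) = Xi b i k \<gamma>" if "k \<in> {1..m i}" for k \<gamma>
      by (rule Xi_shift(2)[OF i that])
    show "Xi b i k (\<gamma> + Sh b j p) = Xi b i k \<gamma>" if "k \<in> {1..m i}" "p \<in> {1..m j}" for k p \<gamma>
      using Xi_shift(1)[OF j(1) that(2)] j(2) by blast
    show "Xi b j p (\<gamma> + Sh b i k) = Xi b j p \<gamma>" if "k \<in> {1..m i}" "p \<in> {1..m j}" for k p \<gamma>
      using Xi_shift(1)[OF i that(1)] ji by blast
  qed (rule mn Q meromorphic_Phi[OF i] meromorphic_Phi[OF j(1)] meromorphic_Xi Xi_nonzero; assumption)+
qed

section \<open>The currents \<open>K\<close> as expansions of one rational function\<close>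

definition NN :: "nat \<Rightarrow> complex poly" where "NN i = Rp i * Rm i"
definition cc :: "nat \<Rightarrow> complex" where "cc i = c_coeff l a d m \<omega>1 \<omega>2 i"
definition Kn :: "nat \<Rightarrow> complex ^ 'v \<Rightarrow> complex poly" where
  "Kn i \<gamma> = K_num l m a qn (cc i) (NN i) i (V \<gamma>)"
definition Kf :: "nat \<Rightarrow> complex fls \<Rightarrow> complex ^ 'v \<Rightarrow> complex fls" where
  "Kf i Z \<gamma> = K_fls l m a qn (cc i) (NN i) i Z (V \<gamma>)"

lemma K_rational_eq:
  assumes i: "i \<in> {1..l}"
  shows "K_rational l a d m x \<nu> \<omega>1 \<omega>2 i Z \<gamma> = Kf i Z \<gamma>"
proof -
  let ?v = "v_fun x \<omega>2 \<gamma>"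
  have lin: "fls_poly [:- u, 1:] Z = Z - fls_const u" "fls_poly [:- u, u':] Z = Z * fls_const u' - fls_const u" for u u'
    by (simp_all add: fls_poly_linear)
  have 1: "(\<Prod>j=1..l. \<Prod>p=1..m j. V \<gamma> j p powi a j i) = (\<Prod>j=1..l. \<Prod>p=1..m j. ?v j p powi a j i)"
    by (intro prod.cong refl) (simp only: V_eq)
  have 2: "(\<Prod>j\<in>{1..l} - {i}. \<Prod>r=1..nat (- a j i). \<Prod>p=1..m j. Z - fls_const (qn j powi (a j i + 2 * int r) * V \<gamma> j p ^ 2)) =
      (\<Prod>j\<in>{1..l} - {i}. \<Prod>r=1..nat (- a j i). \<Prod>p=1..m j. Z - fls_const (qn j powi (a j i + 2 * int r) * ?v j p ^ 2))"
    by (intro prod.cong refl) (simp only: V_eq Diff_iff)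
  have 3: "(\<Prod>p=1..m i. (Z - fls_const (V \<gamma> i p ^ 2)) * (Z - fls_const (qn i ^ 2 * V \<gamma> i p ^ 2))) =
      (\<Prod>p=1..m i. (Z - fls_const (?v i p ^ 2)) * (Z - fls_const (qn i ^ 2 * ?v i p ^ 2)))"
    by (intro prod.cong refl) (simp only: V_eq[OF i])
  have 4: "fls_poly (NN i) Z = (\<Prod>s=1..nat (l_coeff l a m i). Z * fls_const (inverse (w_par \<omega>2 \<nu> i s)) - fls_const (w_par \<omega>2 \<nu> i s))"
    unfolding NN_def RR[OF i] fls_poly_prod lin ..
  have 5: "fls_poly (Kn i \<gamma>) Z = fls_const (cc i * (\<Prod>j=1..l. \<Prod>p=1..m j. ?v j p powi a j i)) *
      (fls_poly (NN i) Z * (\<Prod>j\<in>{1..l} - {i}. \<Prod>r=1..nat (- a j i). \<Prod>p=1..m j. Z - fls_const (qn j powi (a j i + 2 * int r) * ?v j p ^ 2)))"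
    unfolding Kn_def K_num_def fls_poly_smult fls_poly_mult fls_poly_prod lin(1) 1 2 ..
  show ?thesis
    unfolding Kf_def K_fls_def Kn_def[symmetric] 5 K_den_eq 3 4
    unfolding K_rational_def Let_def qn_def[symmetric] cc_def
    by (simp only: times_divide_eq_right mult.assoc)
qed

lemma cc_square:
  assumes "i \<in> {1..l}"
  shows "cc i ^ 2 = (\<Prod>j=1..l. qn j powi (int (m j) * a j i))"
proof -
  have h: "q_half \<omega>1 \<omega>2 * q_half \<omega>1 \<omega>2 = q_par \<omega>1 \<omega>2"
    unfolding q_half_def q_par_def exp_add[symmetric] by (rule arg_cong[where f = exp]) (simp add: field_simps)
  have "(q_half \<omega>1 \<omega>2 powi z) ^ 2 = q_par \<omega>1 \<omega>2 powi z" for z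
    unfolding power2_eq_square power_int_mult_distrib[symmetric] h ..
  then have "cc i ^ 2 = (\<Prod>j=1..l. q_par \<omega>1 \<omega>2 powi (int (d j) * int (m j) * a j i))"
    unfolding cc_def c_coeff_def prod_power_distrib by simp
  also have "\<dots> = (\<Prod>j=1..l. qn j powi (int (m j) * a j i))"
    by (simp add: qn_def q_node_def power_int_mult mult.assoc)
  finally show ?thesis .
qed

lemma Kn_facts:
  assumes i: "i \<in> {1..l}"
  shows "degree (Kn i \<gamma>) \<le> 2 * m i"
    and "coeff (Kn i \<gamma>) (2 * m i) * (coeff (Kn i \<gamma>) 0 * (\<Prod>t\<in>{1..m i} \<times> UNIV. - inverse (K_pole qn i (V \<gamma>) t))) = 1"
proof -
  have L: "int (nat (l_coeff l a m i)) = (\<Sum>j=1..l. int (m j) * a j i)"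
    using lpos[OF i] by (simp add: l_coeff_def)
  have w: "w_par \<omega>2 \<nu> i s \<noteq> 0" for s by (simp add: w_par_def)
  note facts = K_num_facts[where l = l and a = a and i = i and m = m and q = qn and V = "V \<gamma>" and c = "cc i"
    and N = "NN i" and L = "nat (l_coeff l a m i)" and w = "w_par \<omega>2 \<nu> i"]
  show "degree (Kn i \<gamma>) \<le> 2 * m i"
    unfolding Kn_def
    by (rule facts(1)) (use i diag off qn_nonzero V_nonzero cc_square w RR L in \<open>simp_all add: NN_def\<close>)
  show "coeff (Kn i \<gamma>) (2 * m i) * (coeff (Kn i \<gamma>) 0 * (\<Prod>t\<in>{1..m i} \<times> UNIV. - inverse (K_pole qn i (V \<gamma>) t))) = 1"
    unfolding Kn_def
    by (rule facts(2)) (use i diag off qn_nonzero V_nonzero cc_square w RR L in \<open>simp_all add: NN_def\<close>)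
qed

lemma K_pole_nonzero: "K_pole qn i (V \<gamma>) t \<noteq> 0"
  by (cases t) (simp add: K_pole_def qn_nonzero V_nonzero)

lemma Kf_den_nonzero:
  "K_den m qn i fls_X_inv (V \<gamma>) \<noteq> 0" "K_den m qn i fls_X (V \<gamma>) \<noteq> 0"
proof -
  have "fls_X_inv - fls_const (K_pole qn i (V \<gamma>) t) \<noteq> 0" "fls_X - fls_const (K_pole qn i (V \<gamma>) t) \<noteq> 0" for t
    using fls_pole_nonzero K_pole_nonzero by blast+
  then show "K_den m qn i fls_X_inv (V \<gamma>) \<noteq> 0" "K_den m qn i fls_X (V \<gamma>) \<noteq> 0"
    unfolding K_den_def by (simp_all only: prod_zero_iff finite_cartesian_product finite_atLeastAtMost finite_class.finite_UNIV bex_simps, blast+)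
qed

lemma card_poles: "finite ({1..m i} \<times> (UNIV :: bool set))" "card ({1..m i} \<times> (UNIV :: bool set)) = 2 * m i"
  by (simp_all add: card_cartesian_product)

lemma Kf_expand:
  assumes i: "i \<in> {1..l}"
  shows "Kf i fls_X_inv \<gamma> = fps_to_fls (fps_reflect (2 * m i) (Kn i \<gamma>) * (\<Prod>t\<in>{1..m i} \<times> UNIV. geo_inf (K_pole qn i (V \<gamma>) t)))"
    and "Kf i fls_X \<gamma> = fps_to_fls (fps_of_poly (Kn i \<gamma>) * (\<Prod>t\<in>{1..m i} \<times> UNIV. geo_zero (K_pole qn i (V \<gamma>) t)))"
proof -
  show "Kf i fls_X_inv \<gamma> = fps_to_fls (fps_reflect (2 * m i) (Kn i \<gamma>) * (\<Prod>t\<in>{1..m i} \<times> UNIV. geo_inf (K_pole qn i (V \<gamma>) t)))"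
    unfolding Kf_def K_fls_def K_den_def Kn_def[symmetric]
    using expand_at_infinity[OF card_poles(1)[of i], of "Kn i \<gamma>" "K_pole qn i (V \<gamma>)"] Kn_facts(1)[OF i, of \<gamma>]
    unfolding card_poles by simp
  show "Kf i fls_X \<gamma> = fps_to_fls (fps_of_poly (Kn i \<gamma>) * (\<Prod>t\<in>{1..m i} \<times> UNIV. geo_zero (K_pole qn i (V \<gamma>) t)))"
    unfolding Kf_def K_fls_def K_den_def Kn_def[symmetric]
    by (rule expand_at_zero[OF card_poles(1)]) (rule K_pole_nonzero)
qed

definition Kp :: "nat \<Rightarrow> int \<Rightarrow> complex ^ 'v \<Rightarrow> complex" where
  "Kp i n \<gamma> = fls_nth (Kf i fls_X_inv \<gamma>) (- n)"
definition Km :: "nat \<Rightarrow> int \<Rightarrow> complex ^ 'v \<Rightarrow> complex" where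
  "Km i n \<gamma> = fls_nth (Kf i fls_X \<gamma>) n"

lemma K_plus_op_eq: "i \<in> {1..l} \<Longrightarrow> K_plus_op l a d m x \<nu> \<omega>1 \<omega>2 i n = mult_op (Kp i n)"
  and K_minus_op_eq: "i \<in> {1..l} \<Longrightarrow> K_minus_op l a d m x \<nu> \<omega>1 \<omega>2 i n = mult_op (Km i n)"
  unfolding K_plus_op_def K_minus_op_def Kp_def Km_def by (simp_all only: K_rational_eq)

lemma K_support:
  "i \<in> {1..l} \<Longrightarrow> n > 0 \<Longrightarrow> Kp i n \<gamma> = 0" "i \<in> {1..l} \<Longrightarrow> n < 0 \<Longrightarrow> Km i n \<gamma> = 0"
  by (simp_all add: Kp_def Km_def Kf_expand)

lemma fps_nth_0_prod: "fps_nth (\<Prod>i\<in>I. f i :: complex fps) 0 = (\<Prod>i\<in>I. fps_nth (f i) 0)"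
  by (induction I rule: infinite_finite_induct) simp_all

text \<open>Only the top and bottom coefficients of the numerator and the product of the poles enter
  the two constant terms.\<close>

lemma K_zero_inverse:
  assumes i: "i \<in> {1..l}"
  shows "Kp i 0 \<gamma> * Km i 0 \<gamma> = 1"
proof -
  have 1: "Kp i 0 \<gamma> = coeff (Kn i \<gamma>) (2 * m i)"
    unfolding Kp_def Kf_expand[OF i] by (simp add: fps_nth_0_prod geo_inf_def fps_reflect_def)
  have 2: "Km i 0 \<gamma> = coeff (Kn i \<gamma>) 0 * (\<Prod>t\<in>{1..m i} \<times> UNIV. - inverse (K_pole qn i (V \<gamma>) t))"
    unfolding Km_def Kf_expand[OF i] by (simp add: fps_nth_0_prod geo_zero_def)
  show ?thesis unfolding 1 2 by (rule Kn_facts(2)[OF i])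
qed

lemma meromorphic_K_pole: "meromorphic_sev (\<lambda>\<gamma>. K_pole qn i (V \<gamma>) t)"
  by (cases t, cases "snd t") (auto simp: K_pole_def
      intro!: meromorphic_sev_mult meromorphic_sev_const meromorphic_sev_power meromorphic_V)

text \<open>Viewing the numerator as a power series lets meromorphy of its coefficients pass through
  the products that define it.\<close>

lemma meromorphic_Kn: "meromorphic_fps (\<lambda>\<gamma>. fps_of_poly (Kn i \<gamma>))"
proof -
  have p: "fps_of_poly (\<Prod>i\<in>I. f i) = (\<Prod>i\<in>I. fps_of_poly (f i :: complex poly))" for I :: "nat set" and f
    by (induction I rule: infinite_finite_induct) (simp_all add: fps_of_poly_mult)
  show ?thesis
    unfolding Kn_def K_num_def fps_of_poly_smult fps_of_poly_mult p
    by (intro meromorphic_fps_mult meromorphic_fps_prod meromorphic_fps_const meromorphic_fps_fixed meromorphic_fps_linear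
        meromorphic_sev_mult meromorphic_sev_const meromorphic_sev_prod meromorphic_sev_uminus
        meromorphic_sev_power meromorphic_sev_powi_nonzero meromorphic_V V_nonzero)
qed

lemma meromorphic_K:
  assumes i: "i \<in> {1..l}"
  shows "meromorphic_sev (Kp i n)" "meromorphic_sev (Km i n)"
proof -
  have c: "meromorphic_sev (\<lambda>\<gamma>. coeff (Kn i \<gamma>) k)" for k
    using meromorphic_Kn[of i] by (simp add: meromorphic_fps_def)
  have "meromorphic_fps (\<lambda>\<gamma>. fps_reflect (2 * m i) (Kn i \<gamma>))"
    unfolding meromorphic_fps_def
  proof
    fix k show "meromorphic_sev (\<lambda>\<gamma>. fps_nth (fps_reflect (2 * m i) (Kn i \<gamma>)) k)"
      by (cases "k \<le> 2 * m i") (simp_all add: fps_reflect_def c meromorphic_sev_const)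
  qed
  then have 1: "meromorphic_fps (\<lambda>\<gamma>. fps_reflect (2 * m i) (Kn i \<gamma>) * (\<Prod>t\<in>{1..m i} \<times> UNIV. geo_inf (K_pole qn i (V \<gamma>) t)))"
    by (intro meromorphic_fps_mult meromorphic_fps_prod meromorphic_fps_geo meromorphic_K_pole)
  have 2: "meromorphic_fps (\<lambda>\<gamma>. fps_of_poly (Kn i \<gamma>) * (\<Prod>t\<in>{1..m i} \<times> UNIV. geo_zero (K_pole qn i (V \<gamma>) t)))"
    by (intro meromorphic_fps_mult meromorphic_fps_prod meromorphic_fps_geo meromorphic_K_pole K_pole_nonzero meromorphic_Kn)
  show "meromorphic_sev (Kp i n)"
    using 1 unfolding Kp_def[abs_def] Kf_expand[OF i] meromorphic_fps_def
    by (cases "- n < 0") (simp_all add: meromorphic_sev_const)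
  show "meromorphic_sev (Km i n)"
    using 2 unfolding Km_def[abs_def] Kf_expand[OF i] meromorphic_fps_def
    by (cases "n < 0") (simp_all add: meromorphic_sev_const)
qed

text \<open>For \<open>j = i\<close> the shift moves poles, for \<open>j \<noteq> i\<close> it moves
  zeros. In both cases the net change of \<open>K_i(z)\<close> is the quotient of the two linear
  factors of the relation.\<close>

lemma Kf_exchange:
  assumes i: "i \<in> {1..l}" and j: "j \<in> {1..l}" "p \<in> {1..m j}"
    and Z: "\<And>\<gamma>. K_den m qn i Z (V \<gamma>) \<noteq> 0"
  shows "(Z - fls_const (P b i powi a i j * Xi b j p \<gamma>)) * Kf i Z \<gamma> =
    (fls_const (P b i powi a i j) * Z - fls_const (Xi b j p \<gamma>)) * Kf i Z (\<gamma> + Sh b j p)"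
proof (cases "j = i")
  case True
  have A: "P b i powi a i i = P b i ^ 2" using diag[OF i] by simp
  have p: "p \<in> {1..m i}" using j True by simp
  have t: "P b i ^ 2 * inverse (P b i) ^ 2 = 1"
    using P_nonzero[of b i] by (simp add: power_mult_distrib[symmetric])
  have y: "(P b i ^ 2 = qn i ^ 2 \<and> Xi b i p \<gamma> = V \<gamma> i p ^ 2) \<or>
      (P b i ^ 2 * qn i ^ 2 = 1 \<and> Xi b i p \<gamma> = qn i ^ 2 * V \<gamma> i p ^ 2)"
    using qn_nonzero[of i] by (cases b) (simp_all add: P_def Xi_def kap_def power_mult_distrib[symmetric])
  have nz: "K_den m qn i Z (upd (V \<gamma>) i p (inverse (P b i))) \<noteq> 0"
    using Z[of "\<gamma> + Sh b i p"] unfolding V_shift[OF i p] .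
  show ?thesis
    unfolding True A Kf_def V_shift[OF i p]
    by (rule K_fls_exchange_same, rule i, rule diag[OF i], rule p, rule t, rule y, rule Z, rule nz)
next
  case False
  have eq: "node_factor (qn j) (a j i) X (V \<gamma> j p) * (X - P b i powi a i j * Xi b j p \<gamma>) =
      node_factor (qn j) (a j i) X (inverse (P b j) * V \<gamma> j p) * (P b i powi a i j * X - Xi b j p \<gamma>)" for X
    unfolding Xi_def P_sym[OF i j(1)] by (rule node_factor_P[OF off[OF j(1) i False] V_nonzero])
  show ?thesis
    unfolding Kf_def V_shift[OF j]
    by (rule K_fls_exchange_other, rule i, rule diag[OF i], rule j(1), rule False, rule j(2), rule eq)
qed

lemma exchange_KS:
  assumes i: "i \<in> {1..l}" and j: "j \<in> {1..l}"
  shows "exchange_relation (P b i powi a i j) (\<lambda>n. mult_op (Kp i n)) (S b j)"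
    and "exchange_relation (P b i powi a i j) (\<lambda>n. mult_op (Km i n)) (S b j)"
proof -
  have mm: "\<And>k. k \<in> {1..m j} \<Longrightarrow> meromorphic_sev (Phi b j k)" by (rule meromorphic_Phi[OF j])
  show "exchange_relation (P b i powi a i j) (\<lambda>n. mult_op (Kp i n)) (S b j)"
    unfolding S_def
  proof (rule exchange_mult_shift[OF meromorphic_K(1)[OF i] mm meromorphic_Xi Xi_nonzero])
    fix n p \<gamma> assume p: "p \<in> {1..m j}"
    \<comment> \<open>At infinity the coefficient of \<open>z^n\<close> is stored at
      \<open>-n\<close>, and multiplication by \<open>fls_X_inv\<close> replaces \<open>n\<close> by
      \<open>n - 1\<close>.\<close>
    have "fls_nth ((fls_X_inv - fls_const (P b i powi a i j * Xi b j p \<gamma>)) * Kf i fls_X_inv \<gamma>) (- n) =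
      fls_nth ((fls_const (P b i powi a i j) * fls_X_inv - fls_const (Xi b j p \<gamma>)) * Kf i fls_X_inv (\<gamma> + Sh b j p)) (- n)"
      by (rule arg_cong[where f = "\<lambda>F. fls_nth F (- n)"], rule Kf_exchange[OF i j p Kf_den_nonzero(1)])
    then show "Kp i (n - 1) \<gamma> - P b i powi a i j * Xi b j p \<gamma> * Kp i n \<gamma> =
      P b i powi a i j * Kp i (n - 1) (\<gamma> + Sh b j p) - Xi b j p \<gamma> * Kp i n (\<gamma> + Sh b j p)"
      unfolding left_diff_distrib mult.assoc by (simp add: Kp_def fls_X_inv_times_conv_shift(1) add.commute mult.assoc)
  qed
  show "exchange_relation (P b i powi a i j) (\<lambda>n. mult_op (Km i n)) (S b j)"
    unfolding S_def
  proof (rule exchange_mult_shift[OF meromorphic_K(2)[OF i] mm meromorphic_Xi Xi_nonzero])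
    fix n p \<gamma> assume p: "p \<in> {1..m j}"
    have "fls_nth ((fls_X - fls_const (P b i powi a i j * Xi b j p \<gamma>)) * Kf i fls_X \<gamma>) n =
      fls_nth ((fls_const (P b i powi a i j) * fls_X - fls_const (Xi b j p \<gamma>)) * Kf i fls_X (\<gamma> + Sh b j p)) n"
      by (rule arg_cong[where f = "\<lambda>F. fls_nth F n"], rule Kf_exchange[OF i j p Kf_den_nonzero(2)])
    then show "Km i (n - 1) \<gamma> - P b i powi a i j * Xi b j p \<gamma> * Km i n \<gamma> =
      P b i powi a i j * Km i (n - 1) (\<gamma> + Sh b j p) - Xi b j p \<gamma> * Km i n (\<gamma> + Sh b j p)"
      unfolding left_diff_distrib mult.assoc by (simp add: Km_def fls_X_times_conv_shift(1) mult.assoc)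
  qed
qed

section \<open>The given operators as series of weighted shifts\<close>

lemma E_op_eq:
  assumes i: "i \<in> {1..l}"
  shows "current (E_op l a d m x \<omega>1 \<omega>2 Rp i) = S True i"
proof
  fix e
  show "current (E_op l a d m x \<omega>1 \<omega>2 Rp i) e = S True i e"
    unfolding current_def E_op_def S_def shift_series_def Let_def
  proof (rule sum.cong[OF refl])
    fix k assume k: "k \<in> {1..m i}"
    have u: "u_inv_op d x \<omega>1 i k = shift_op (Sh True i k)"
      by (simp add: u_inv_op_def Sh_def)
    show "mult_op (\<lambda>\<gamma>. c_coeff l a d m \<omega>1 \<omega>2 i / (q_node d \<omega>1 \<omega>2 i - inverse (q_node d \<omega>1 \<omega>2 i)) *
          (\<Prod>p=1..m i. v_fun x \<omega>2 \<gamma> i p) * (\<Prod>j=i+1..l. \<Prod>p=1..m j. v_fun x \<omega>2 \<gamma> j p powi a j i) *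
          delta_coeff (v_fun x \<omega>2 \<gamma> i k ^ 2) (- e) * v_fun x \<omega>2 \<gamma> i k powi (- 2) * poly (Rp i) (v_fun x \<omega>2 \<gamma> i k ^ 2) *
          (\<Prod>j=i+1..l. \<Prod>r=1..nat (- a j i). \<Prod>p=1..m j.
             v_fun x \<omega>2 \<gamma> i k ^ 2 - q_node d \<omega>1 \<omega>2 j powi (a j i + 2 * int r) * v_fun x \<omega>2 \<gamma> j p ^ 2) /
          (\<Prod>p\<in>{1..m i} - {k}. v_fun x \<omega>2 \<gamma> i k ^ 2 - v_fun x \<omega>2 \<gamma> i p ^ 2)) * u_inv_op d x \<omega>1 i k =
        weighted_shift (\<lambda>\<gamma>. Xi True i k \<gamma> powi (- e) * Phi True i k \<gamma>) (Sh True i k)"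
      unfolding weighted_shift_def u
    proof (intro arg_cong2[where f = "(*)"] arg_cong[where f = mult_op] refl ext)
      fix \<gamma>
      let ?v = "v_fun x \<omega>2 \<gamma>"
      have V: "V \<gamma> i k = ?v i k" "(\<Prod>p=1..m i. V \<gamma> i p) = (\<Prod>p=1..m i. ?v i p)"
        "(\<Prod>p\<in>{1..m i} - {k}. V \<gamma> i k ^ 2 - V \<gamma> i p ^ 2) = (\<Prod>p\<in>{1..m i} - {k}. ?v i k ^ 2 - ?v i p ^ 2)"
        using k by (auto simp: V_eq[OF i] intro!: prod.cong)
      have N: "(\<Prod>j\<in>J True i. \<Prod>p=1..m j. node_factor (qn j) (a j i) X (V \<gamma> j p)) =
          (\<Prod>j=i+1..l. \<Prod>p=1..m j. ?v j p powi a j i) *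
          (\<Prod>j=i+1..l. \<Prod>r=1..nat (- a j i). \<Prod>p=1..m j. X - qn j powi (a j i + 2 * int r) * ?v j p ^ 2)" for X
        unfolding prod_node_factor J_def if_True
        by (intro arg_cong2[where f = "(*)"] prod.cong refl) (use i in \<open>simp_all add: V_def\<close>)
      show "c_coeff l a d m \<omega>1 \<omega>2 i / (q_node d \<omega>1 \<omega>2 i - inverse (q_node d \<omega>1 \<omega>2 i)) *
          (\<Prod>p=1..m i. ?v i p) * (\<Prod>j=i+1..l. \<Prod>p=1..m j. ?v j p powi a j i) *
          delta_coeff (?v i k ^ 2) (- e) * ?v i k powi (- 2) * poly (Rp i) (?v i k ^ 2) *
          (\<Prod>j=i+1..l. \<Prod>r=1..nat (- a j i). \<Prod>p=1..m j.
             ?v i k ^ 2 - q_node d \<omega>1 \<omega>2 j powi (a j i + 2 * int r) * ?v j p ^ 2) /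
          (\<Prod>p\<in>{1..m i} - {k}. ?v i k ^ 2 - ?v i p ^ 2) = Xi True i k \<gamma> powi (- e) * Phi True i k \<gamma>"
        unfolding Phi_def coef_def N V(2) unfolding V(3) unfolding V(1) Xi_def cst_def kap_def R_def if_True mult_1 delta_coeff_def
          qn_def[symmetric] by (simp only: V(1) times_divide_eq_right mult_ac times_divide_eq_left)
    qed
  qed
qed

lemma F_op_eq:
  assumes i: "i \<in> {1..l}"
  shows "current (F_op a d m x \<omega>1 \<omega>2 Rm i) = S False i"
proof
  fix e
  show "current (F_op a d m x \<omega>1 \<omega>2 Rm i) e = S False i e"
    unfolding current_def F_op_def S_def shift_series_def Let_def
  proof (rule sum.cong[OF refl])
    fix k assume k: "k \<in> {1..m i}"
    have u: "u_op d x \<omega>1 i k = shift_op (Sh False i k)"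
      by (simp add: u_op_def Sh_def)
    show "mult_op (\<lambda>\<gamma>. - (q_node d \<omega>1 \<omega>2 i powi (- 2 * int (m i)) / (q_node d \<omega>1 \<omega>2 i - inverse (q_node d \<omega>1 \<omega>2 i))) *
          (\<Prod>p=1..m i. v_fun x \<omega>2 \<gamma> i p) * (\<Prod>j=1..<i. \<Prod>p=1..m j. v_fun x \<omega>2 \<gamma> j p powi a j i) *
          delta_coeff (q_node d \<omega>1 \<omega>2 i ^ 2 * v_fun x \<omega>2 \<gamma> i k ^ 2) (- e) * v_fun x \<omega>2 \<gamma> i k powi (- 2) *
          poly (Rm i) (q_node d \<omega>1 \<omega>2 i ^ 2 * v_fun x \<omega>2 \<gamma> i k ^ 2) *
          (\<Prod>j=1..<i. \<Prod>r=1..nat (- a j i). \<Prod>p=1..m j.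
             q_node d \<omega>1 \<omega>2 i ^ 2 * v_fun x \<omega>2 \<gamma> i k ^ 2 - q_node d \<omega>1 \<omega>2 j powi (a j i + 2 * int r) * v_fun x \<omega>2 \<gamma> j p ^ 2) /
          (\<Prod>p\<in>{1..m i} - {k}. v_fun x \<omega>2 \<gamma> i k ^ 2 - v_fun x \<omega>2 \<gamma> i p ^ 2)) * u_op d x \<omega>1 i k =
        weighted_shift (\<lambda>\<gamma>. Xi False i k \<gamma> powi (- e) * Phi False i k \<gamma>) (Sh False i k)"
      unfolding weighted_shift_def u
    proof (intro arg_cong2[where f = "(*)"] arg_cong[where f = mult_op] refl ext)
      fix \<gamma>
      let ?v = "v_fun x \<omega>2 \<gamma>"
      have V: "V \<gamma> i k = ?v i k" "(\<Prod>p=1..m i. V \<gamma> i p) = (\<Prod>p=1..m i. ?v i p)"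
        "(\<Prod>p\<in>{1..m i} - {k}. V \<gamma> i k ^ 2 - V \<gamma> i p ^ 2) = (\<Prod>p\<in>{1..m i} - {k}. ?v i k ^ 2 - ?v i p ^ 2)"
        using k by (auto simp: V_eq[OF i] intro!: prod.cong)
      have N: "(\<Prod>j\<in>J False i. \<Prod>p=1..m j. node_factor (qn j) (a j i) X (V \<gamma> j p)) =
          (\<Prod>j=1..<i. \<Prod>p=1..m j. ?v j p powi a j i) *
          (\<Prod>j=1..<i. \<Prod>r=1..nat (- a j i). \<Prod>p=1..m j. X - qn j powi (a j i + 2 * int r) * ?v j p ^ 2)" for X
        unfolding prod_node_factor J_def if_False
        by (intro arg_cong2[where f = "(*)"] prod.cong refl) (use i in \<open>simp_all add: V_def\<close>)
      show "- (q_node d \<omega>1 \<omega>2 i powi (- 2 * int (m i)) / (q_node d \<omega>1 \<omega>2 i - inverse (q_node d \<omega>1 \<omega>2 i))) *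
          (\<Prod>p=1..m i. ?v i p) * (\<Prod>j=1..<i. \<Prod>p=1..m j. ?v j p powi a j i) *
          delta_coeff (q_node d \<omega>1 \<omega>2 i ^ 2 * ?v i k ^ 2) (- e) * ?v i k powi (- 2) *
          poly (Rm i) (q_node d \<omega>1 \<omega>2 i ^ 2 * ?v i k ^ 2) *
          (\<Prod>j=1..<i. \<Prod>r=1..nat (- a j i). \<Prod>p=1..m j.
             q_node d \<omega>1 \<omega>2 i ^ 2 * ?v i k ^ 2 - q_node d \<omega>1 \<omega>2 j powi (a j i + 2 * int r) * ?v j p ^ 2) /
          (\<Prod>p\<in>{1..m i} - {k}. ?v i k ^ 2 - ?v i p ^ 2) = Xi False i k \<gamma> powi (- e) * Phi False i k \<gamma>"
        unfolding Phi_def coef_def N V(2) unfolding V(3) unfolding V(1) Xi_def cst_def kap_def R_def if_False delta_coeff_def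
          qn_def[symmetric] by (simp only: V(1) times_divide_eq_right mult_ac times_divide_eq_left)
    qed
  qed
qed

text \<open>For \<open>i < j\<close> each coefficient involves the variables of the other node, and
  the two changes cancel; for \<open>i > j\<close> neither does. Thus the opposite orderings in
  \<open>E\<close> and \<open>F\<close> make them commute. For \<open>i = j\<close> the shifts act
  on different variables of one node and \<open>coef_commute_self\<close> applies.\<close>

lemma Phi_commute:
  assumes i: "i \<in> {1..l}" "k \<in> {1..m i}" and j: "j \<in> {1..l}" "p \<in> {1..m j}" and ne: "i \<noteq> j \<or> k \<noteq> p"
  shows "eventually (\<lambda>\<gamma>. Phi True i k \<gamma> * Phi False j p (\<gamma> + Sh True i k) =
    Phi False j p \<gamma> * Phi True i k (\<gamma> + Sh False j p)) generic"
proof (cases "i = j")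
  case True
  have kp: "k \<in> {1..m i}" "p \<in> {1..m i}" "k \<noteq> p" using i j ne True by auto
  have "qn i ^ 2 \<noteq> 0" using qn_nonzero by simp
  then have "eventually (\<lambda>\<gamma>. qn i ^ 2 * V \<gamma> i p ^ 2 \<noteq> V \<gamma> i k ^ 2) generic"
    using kp by (intro V_generic'[OF i(1) _ i(1)]) auto
  moreover have "eventually (\<lambda>\<gamma>. V \<gamma> i p ^ 2 \<noteq> V \<gamma> i k ^ 2) generic"
    using kp by (intro V_generic1[OF i(1)]) auto
  ultimately show ?thesis
  proof eventually_elim
    case (elim \<gamma>)
    have "V \<gamma> i p ^ 2 \<noteq> inverse (qn i) ^ 2 * V \<gamma> i k ^ 2"
      using elim(1) qn_nonzero[of i] by (auto simp: field_simps)
    then have "coef m a qn (J True i) (R True i) (kap True i) i k (V \<gamma>) *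
        coef m a qn (J False i) (R False i) (kap False i) i p (upd (V \<gamma>) i k (inverse (qn i))) =
      coef m a qn (J False i) (R False i) (kap False i) i p (V \<gamma>) *
        coef m a qn (J True i) (R True i) (kap True i) i k (upd (V \<gamma>) i p (inverse (inverse (qn i))))"
      using qn_nonzero[of i] elim(2) by (intro coef_commute_self J_facts(1)[OF i(1)] kp) auto
    then show ?case
      unfolding True[symmetric] Phi_def V_shift[OF i(1) kp(1)] V_shift[OF i(1) kp(2)] by (simp add: P_def)
  qed
next
  case False
  show ?thesis
  proof (cases "i < j")
    case True
    then have J: "j \<in> J True i" "i \<in> J False j" using i j by (auto simp: J_def)
    define Q where "Q = P True i powi a i j"
    \<comment> \<open>The shift of \<open>F\<close> scales in the opposite direction, so its
      exchange parameter is the inverse of that of \<open>E\<close>.\<close>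
    have Qj: "P False j powi a j i = inverse Q"
      unfolding Q_def P_sym[OF i(1) j(1)] by (simp add: P_def power_int_inverse)
    have Q0: "Q \<noteq> 0" using P_nonzero by (simp add: Q_def)
    have ge: "eventually (\<lambda>\<gamma>. Q * Xi False j p \<gamma> - Xi True i k \<gamma> \<noteq> 0) generic"
      "eventually (\<lambda>\<gamma>. inverse Q * Xi False j p \<gamma> - Xi True i k \<gamma> \<noteq> 0) generic"
    proof -
      have g: "eventually (\<lambda>\<gamma>. z * Xi False j p \<gamma> - Xi True i k \<gamma> \<noteq> 0) generic" if "z \<noteq> 0" for z
      proof -
        have "z * kap False j \<noteq> 0" using that kap_nonzero by simp
        from V_generic[OF j i _ this, of "kap True i"] False show ?thesis
          by (auto simp: Xi_def mult.assoc)
      qed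
      show "eventually (\<lambda>\<gamma>. Q * Xi False j p \<gamma> - Xi True i k \<gamma> \<noteq> 0) generic"
        "eventually (\<lambda>\<gamma>. inverse Q * Xi False j p \<gamma> - Xi True i k \<gamma> \<noteq> 0) generic"
        by (rule g, simp add: Q0)+
    qed
    then show ?thesis
    proof eventually_elim
      case (elim \<gamma>)
      let ?X = "Xi True i k \<gamma>" and ?Y = "Xi False j p \<gamma>"
      have 1: "Phi True i k \<gamma> * (?X - inverse Q * ?Y) = Phi True i k (\<gamma> + Sh False j p) * (inverse Q * ?X - ?Y)"
        unfolding Qj[symmetric] by (rule coef_related_shift[OF i j(1) _ J(1) j(2)]) (use False in auto)
      have 2: "Phi False j p \<gamma> * (?Y - Q * ?X) = Phi False j p (\<gamma> + Sh True i k) * (Q * ?Y - ?X)"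
        unfolding Q_def by (rule coef_related_shift[OF j i(1) False J(2) i(2)])
      \<comment> \<open>The two exchange quotients agree: scaling a linear factor by
        \<open>Q\<close> on one side is undone by \<open>inverse Q\<close> on the other.\<close>
      have 3: "(inverse Q * ?X - ?Y) * (?Y - Q * ?X) = (?X - inverse Q * ?Y) * (Q * ?Y - ?X)"
        using Q0 by (simp add: field_simps)
      have "(A * B') * (u * w') = (B * A') * (u * w')" if "A * u = A' * w" "B * u' = B' * w'" "w * u' = u * w'"
        for A A' B B' u u' w w' :: complex
      proof -
        have "(A * B') * (u * w') = (A * u) * (B' * w')" by (simp only: mult_ac)
        also have "\<dots> = (B * A') * (w * u')" unfolding that(1) that(2)[symmetric] by (simp only: mult_ac)
        finally show ?thesis unfolding that(3) .
      qed
      from this[OF 1 2 3] have "(Phi True i k \<gamma> * Phi False j p (\<gamma> + Sh True i k)) * ((?X - inverse Q * ?Y) * (Q * ?Y - ?X)) =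
          (Phi False j p \<gamma> * Phi True i k (\<gamma> + Sh False j p)) * ((?X - inverse Q * ?Y) * (Q * ?Y - ?X))"
        .
      moreover have "(?X - inverse Q * ?Y) * (Q * ?Y - ?X) \<noteq> 0" using elim by auto
      ultimately show ?case by (metis mult_right_cancel)
    qed
  next
    case nless: False
    have "j \<notin> J True i" "i \<notin> J False j" using nless False by (auto simp: J_def)
    then have "Phi False j p (\<gamma> + Sh True i k) = Phi False j p \<gamma>" "Phi True i k (\<gamma> + Sh False j p) = Phi True i k \<gamma>" for \<gamma>
      using False by (intro coef_unrelated_shift[OF i] coef_unrelated_shift[OF j]; auto)+
    then show ?thesis by (simp add: mult.commute)
  qed
qed


lemma poles_remove:
  assumes "k \<in> {1..n::nat}"
  shows "(\<Prod>t\<in>{1..n} \<times> UNIV - {(k, False)}. g t) = (\<Prod>p\<in>{1..n} - {k}. g (p, False)) * (\<Prod>p=1..n. g (p, True) :: complex)"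
    and "(\<Prod>t\<in>{1..n} \<times> UNIV - {(k, True)}. g t) = (\<Prod>p=1..n. g (p, False)) * (\<Prod>p\<in>{1..n} - {k}. g (p, True))"
proof -
  have e: "{1..n} \<times> UNIV - {(k, False)} = (\<lambda>p. (p, False)) ` ({1..n} - {k}) \<union> (\<lambda>p. (p, True)) ` {1..n}"
    "{1..n} \<times> UNIV - {(k, True)} = (\<lambda>p. (p, False)) ` {1..n} \<union> (\<lambda>p. (p, True)) ` ({1..n} - {k})"
    using assms by (auto simp: image_iff)
  show "(\<Prod>t\<in>{1..n} \<times> UNIV - {(k, False)}. g t) = (\<Prod>p\<in>{1..n} - {k}. g (p, False)) * (\<Prod>p=1..n. g (p, True) :: complex)"
    unfolding e by (subst prod.union_disjoint) (auto simp: prod.reindex inj_on_def)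
  show "(\<Prod>t\<in>{1..n} \<times> UNIV - {(k, True)}. g t) = (\<Prod>p=1..n. g (p, False)) * (\<Prod>p\<in>{1..n} - {k}. g (p, True))"
    unfolding e by (subst prod.union_disjoint) (auto simp: prod.reindex inj_on_def)
qed

text \<open>The products \<open>E F\<close> give the residues at \<open>v_{i,k}^2\<close> and the
  products \<open>F E\<close> those at \<open>q_i^2 v_{i,k}^2\<close>; together they exhaust the
  poles in \<open>expansion_difference\<close>.\<close>

lemma diagonal_terms:
  assumes i: "i \<in> {1..l}"
  shows "eventually (\<lambda>\<gamma>.
    (\<Sum>k=1..m i. (Xi True i k \<gamma> powi (- n) * Phi True i k \<gamma>) *
        (Xi False i k (\<gamma> + Sh True i k) powi (- r) * Phi False i k (\<gamma> + Sh True i k)) -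
      (Xi False i k \<gamma> powi (- r) * Phi False i k \<gamma>) *
        (Xi True i k (\<gamma> + Sh False i k) powi (- n) * Phi True i k (\<gamma> + Sh False i k))) =
    1 / (qn i - inverse (qn i)) * (Kp i (n + r) \<gamma> - Km i (n + r) \<gamma>)) generic"
proof -
  have "qn i ^ 2 \<noteq> 0" using qn_nonzero by simp
  then have "eventually (\<lambda>\<gamma>. \<forall>k\<in>{1..m i}. \<forall>p\<in>{1..m i} - {k}. qn i ^ 2 * V \<gamma> i k ^ 2 \<noteq> V \<gamma> i p ^ 2) generic"
    by (intro eventually_ball_finite ballI V_generic'[OF i _ i]) auto
  moreover have "eventually (\<lambda>\<gamma>. \<forall>k\<in>{1..m i}. \<forall>p\<in>{1..m i} - {k}. V \<gamma> i k ^ 2 \<noteq> V \<gamma> i p ^ 2) generic"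
    by (intro eventually_ball_finite ballI V_generic1[OF i]) auto
  ultimately show ?thesis
  proof eventually_elim
    case (elim \<gamma>)
    let ?y = "K_pole qn i (V \<gamma>)" and ?N = "n + r" and ?I = "{1..m i} \<times> (UNIV :: bool set)"
    \<comment> \<open>Partial fractions with simple poles require all \<open>2 m_i\<close> poles to
      be distinct, which is what the generic conditions ensure; the two poles of one variable differ
      because \<open>qn i ^ 2 \<noteq> 1\<close>.\<close>
    have inj: "inj_on ?y ?I"
    proof (rule inj_onI)
      fix s t assume st: "s \<in> ?I" "t \<in> ?I" "?y s = ?y t"
      obtain k b p b' where [simp]: "s = (k, b)" "t = (p, b')" by (cases s, cases t) auto
      show "s = t"
      proof (cases "k = p")
        case True
        then show ?thesis
          using st(3) qn_square[OF i] V_nonzero[of \<gamma> i p] by (cases b; cases b') (auto simp: K_pole_def)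
      next
        case False
        then have kp: "k \<in> {1..m i}" "p \<in> {1..m i} - {k}" "p \<in> {1..m i}" "k \<in> {1..m i} - {p}" using st by auto
        have "qn i ^ 2 * V \<gamma> i k ^ 2 \<noteq> V \<gamma> i p ^ 2" "qn i ^ 2 * V \<gamma> i p ^ 2 \<noteq> V \<gamma> i k ^ 2"
          "V \<gamma> i k ^ 2 \<noteq> V \<gamma> i p ^ 2"
          using elim kp by blast+
        then show ?thesis
          using st(3) qn_nonzero[of i] by (cases b; cases b') (auto simp: K_pole_def)
      qed
    qed
    have "Kp i ?N \<gamma> - Km i ?N \<gamma> = (\<Sum>t\<in>?I. poly (Kn i \<gamma>) (?y t) / (\<Prod>t'\<in>?I - {t}. ?y t - ?y t') * ?y t powi (- ?N - 1))"
      unfolding Kp_def Km_def Kf_def K_fls_def K_den_def Kn_def[symmetric]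
      by (rule expansion_difference[OF card_poles(1) inj K_pole_nonzero]) (simp only: card_poles(2) Kn_facts(1)[OF i])
    also have "\<dots> = (\<Sum>k=1..m i. \<Sum>b\<in>UNIV. poly (Kn i \<gamma>) (?y (k, b)) / (\<Prod>t'\<in>?I - {(k, b)}. ?y (k, b) - ?y t') * ?y (k, b) powi (- ?N - 1))"
      by (rule sum.cartesian_product')
    finally have K: "Kp i ?N \<gamma> - Km i ?N \<gamma> = (\<Sum>k=1..m i.
        poly (Kn i \<gamma>) (?y (k, False)) / (\<Prod>t'\<in>?I - {(k, False)}. ?y (k, False) - ?y t') * ?y (k, False) powi (- ?N - 1) +
        poly (Kn i \<gamma>) (?y (k, True)) / (\<Prod>t'\<in>?I - {(k, True)}. ?y (k, True) - ?y t') * ?y (k, True) powi (- ?N - 1))"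
      by (simp add: UNIV_bool add.commute)
    show ?case
      unfolding K sum_distrib_left
    proof (rule sum.cong[OF refl])
      fix k assume k: "k \<in> {1..m i}"
      let ?x = "V \<gamma> i k ^ 2"
      have x0: "?x \<noteq> 0" "qn i ^ 2 * ?x \<noteq> 0" using V_nonzero qn_nonzero by simp_all
      have J: "J True i \<union> J False i = {1..l} - {i}" "J True i \<inter> J False i = {}"
        using i by (auto simp: J_def)
      \<comment> \<open>The factor \<open>inverse y\<close> comes from \<open>pole_jump\<close>, the
        other two powers from the delta functions in \<open>z\<close> and in
        \<open>w\<close>.\<close>
      have pw: "y powi (- ?N - 1) = inverse y * (y powi (- n) * y powi (- r))" if "y \<noteq> 0" for y :: complex
      proof -
        have e: "- ?N - 1 = - 1 + (- n + - r)" by simp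
        show ?thesis unfolding e power_int_add[OF disjI1[OF that]] by (simp add: power_int_minus)
      qed
      have X: "Xi True i k \<gamma> = ?x" "Xi False i k (\<gamma> + Sh True i k) = ?x"
        "Xi False i k \<gamma> = qn i ^ 2 * ?x" "Xi True i k (\<gamma> + Sh False i k) = qn i ^ 2 * ?x"
        using qn_nonzero[of i] unfolding Xi_def V_shift[OF i k]
        by (simp_all add: kap_def upd_def P_def power_mult_distrib power_inverse)
      note cd = coef_diagonal[where c = "cc i" and i = i and l = l and m = m and a = a and q = qn and V = "V \<gamma>" and k = k
        and J = "J True i" and J' = "J False i" and R = "Rp i" and R' = "Rm i" and N = "NN i"]
      have "Phi True i k \<gamma> * Phi False i k (\<gamma> + Sh True i k) =
        1 / (qn i - inverse (qn i)) * (poly (Kn i \<gamma>) ?x / ((\<Prod>p\<in>{1..m i} - {k}. ?x - V \<gamma> i p ^ 2) *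
        (\<Prod>p=1..m i. ?x - qn i ^ 2 * V \<gamma> i p ^ 2)) * inverse ?x)"
        using cd(1)[OF i diag[OF i] k qn_nonzero qn_square[OF i] V_nonzero J NN_def[symmetric]]
        unfolding Phi_def V_shift[OF i k] Kn_def cst_def kap_def R_def P_def if_True if_False cc_def .
      moreover have "Phi False i k \<gamma> * Phi True i k (\<gamma> + Sh False i k) =
        - (1 / (qn i - inverse (qn i)) * (poly (Kn i \<gamma>) (qn i ^ 2 * ?x) / ((\<Prod>p=1..m i. qn i ^ 2 * ?x - V \<gamma> i p ^ 2) *
        (\<Prod>p\<in>{1..m i} - {k}. qn i ^ 2 * ?x - qn i ^ 2 * V \<gamma> i p ^ 2)) * inverse (qn i ^ 2 * ?x)))"
        using cd(2)[OF i diag[OF i] k qn_nonzero qn_square[OF i] V_nonzero J NN_def[symmetric]]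
        unfolding Phi_def V_shift[OF i k] Kn_def cst_def kap_def R_def P_def if_True if_False cc_def inverse_inverse_eq .
      moreover have "?y (k, False) = ?x" "?y (k, True) = qn i ^ 2 * ?x" "?y (p, False) = V \<gamma> i p ^ 2" "?y (p, True) = qn i ^ 2 * V \<gamma> i p ^ 2" for p
        by (simp_all add: K_pole_def)
      moreover have "(u1 * A) * (u2 * B) - (w1 * C) * (w2 * D) = h * (e1 * (z1 * (u1 * u2)) + e2 * (z2 * (w2 * w1)))"
        if "A * B = h * (e1 * z1)" "C * D = - (h * (e2 * z2))" for A B C D u1 u2 w1 w2 h e1 e2 z1 z2 :: complex
      proof -
        have "(u1 * A) * (u2 * B) - (w1 * C) * (w2 * D) = (A * B) * (u1 * u2) - (C * D) * (w1 * w2)" by (simp only: mult_ac)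
        then show ?thesis unfolding that by (simp add: algebra_simps)
      qed
      ultimately show "Xi True i k \<gamma> powi (- n) * Phi True i k \<gamma> *
            (Xi False i k (\<gamma> + Sh True i k) powi (- r) * Phi False i k (\<gamma> + Sh True i k)) -
          Xi False i k \<gamma> powi (- r) * Phi False i k \<gamma> *
            (Xi True i k (\<gamma> + Sh False i k) powi (- n) * Phi True i k (\<gamma> + Sh False i k)) =
        1 / (qn i - inverse (qn i)) *
          (poly (Kn i \<gamma>) (?y (k, False)) / (\<Prod>t'\<in>?I - {(k, False)}. ?y (k, False) - ?y t') * ?y (k, False) powi (- ?N - 1) +
           poly (Kn i \<gamma>) (?y (k, True)) / (\<Prod>t'\<in>?I - {(k, True)}. ?y (k, True) - ?y t') * ?y (k, True) powi (- ?N - 1))"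
        unfolding X poles_remove[OF k] by (simp only: pw[OF x0(1)] pw[OF x0(2)])
    qed
  qed
qed

text \<open>Terms moving different variables commute, so only \<open>k = p\<close> at the same node
  survives; there the two shifts are opposite and a multiplication operator is left.\<close>

lemma EF_commutator:
  assumes i: "i \<in> {1..l}" and j: "j \<in> {1..l}"
  shows "S True i n * S False j r - S False j r * S True i n =
    (if i = j then (1 / (qn i - inverse (qn i))) *\<^sub>C (mult_op (Kp i (n + r)) - mult_op (Km i (n + r))) else 0)"
proof -
  define f where "f k \<gamma> = Xi True i k \<gamma> powi (- n) * Phi True i k \<gamma>" for k \<gamma>
  define g where "g p \<gamma> = Xi False j p \<gamma> powi (- r) * Phi False j p \<gamma>" for p \<gamma>
  define F where "F k = weighted_shift (f k) (Sh True i k)" for k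
  define G where "G p = weighted_shift (g p) (Sh False j p)" for p
  have mf: "meromorphic_sev (f k)" if "k \<in> {1..m i}" for k
    unfolding f_def by (intro meromorphic_sev_mult meromorphic_sev_powi_nonzero meromorphic_Xi Xi_nonzero meromorphic_Phi i that)
  have mg: "meromorphic_sev (g p)" if "p \<in> {1..m j}" for p
    unfolding g_def by (intro meromorphic_sev_mult meromorphic_sev_powi_nonzero meromorphic_Xi Xi_nonzero meromorphic_Phi j that)
  have comm: "F k * G p = G p * F k" if k: "k \<in> {1..m i}" and p: "p \<in> {1..m j}" and ne: "i \<noteq> j \<or> k \<noteq> p" for k p
  proof -
    have X: "Xi False j p (\<gamma> + Sh True i k) = Xi False j p \<gamma>" "Xi True i k (\<gamma> + Sh False j p) = Xi True i k \<gamma>" for \<gamma>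
      using ne by (intro Xi_shift(1)[OF i k] Xi_shift(1)[OF j p]; auto)+
    have "1 *\<^sub>C (F k * G p) + 0 *\<^sub>C (F k * G p) = 1 *\<^sub>C (G p * F k) + 0 *\<^sub>C (G p * F k)"
      unfolding F_def G_def
    proof (rule weighted_shift_exchange)
      show "\<forall>\<^sub>F \<gamma> in generic. 1 * (f k \<gamma> * g p (\<gamma> + Sh True i k)) + 0 * (f k \<gamma> * g p (\<gamma> + Sh True i k)) =
          1 * (g p \<gamma> * f k (\<gamma> + Sh False j p)) + 0 * (g p \<gamma> * f k (\<gamma> + Sh False j p))"
        using Phi_commute[OF i k j p ne]
      proof eventually_elim
        case (elim \<gamma>)
        from arg_cong[OF elim, of "\<lambda>z. Xi True i k \<gamma> powi (- n) * Xi False j p \<gamma> powi (- r) * z"]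
        show ?case unfolding f_def g_def X by (simp only: mult_ac mult_1_left mult_zero_left)
      qed
    qed (rule mf[OF k] mg[OF p])+
    then show ?thesis by (simp add: scaleC_one)
  qed
  have S: "S True i n = (\<Sum>k=1..m i. F k)" "S False j r = (\<Sum>p=1..m j. G p)"
    by (simp_all add: S_def shift_series_def F_def G_def f_def[abs_def] g_def[abs_def])
  have "S True i n * S False j r - S False j r * S True i n = (\<Sum>k=1..m i. \<Sum>p=1..m j. F k * G p - G p * F k)"
    unfolding S sum_product sum_subtractf by (rule arg_cong2[where f = "(-)", OF refl sum.swap])
  also have "\<dots> = (if i = j then (1 / (qn i - inverse (qn i))) *\<^sub>C (mult_op (Kp i (n + r)) - mult_op (Km i (n + r))) else 0)"
  proof (cases "i = j")
    case False
    have "(\<Sum>k=1..m i. \<Sum>p=1..m j. F k * G p - G p * F k) = 0"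
      by (intro sum.neutral ballI) (simp only: comm False simp_thms right_minus_eq)
    then show ?thesis using False by simp
  next
    case True
    define D where "D k \<gamma> = f k \<gamma> * g k (\<gamma> + Sh True i k) - g k \<gamma> * f k (\<gamma> + Sh False i k)" for k \<gamma>
    have Sh0: "Sh True i k + Sh False i k = 0" for k
      by (simp add: Sh_def axis_def vec_eq_iff)
    have m: "meromorphic_sev (\<lambda>\<gamma>. f k \<gamma> * g k (\<gamma> + Sh True i k))" "meromorphic_sev (\<lambda>\<gamma>. g k \<gamma> * f k (\<gamma> + Sh False i k))"
      if "k \<in> {1..m i}" for k
      using mf[OF that] mg[of k] that True by (auto intro!: meromorphic_sev_mult meromorphic_sev_shift[of "g k"] meromorphic_sev_shift[of "f k"])
    have d: "F k * G k - G k * F k = mult_op (D k)" if k: "k \<in> {1..m i}" for k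
    proof -
      have kj: "k \<in> {1..m j}" using k True by simp
      have "F k * G k = weighted_shift (\<lambda>\<gamma>. f k \<gamma> * g k (\<gamma> + Sh True i k)) 0"
        unfolding F_def G_def True[symmetric] weighted_shift_mult[OF mf[OF k] mg[OF kj]] Sh0 ..
      moreover have "G k * F k = weighted_shift (\<lambda>\<gamma>. g k \<gamma> * f k (\<gamma> + Sh False i k)) 0"
        using Sh0[of k] unfolding F_def G_def True[symmetric] weighted_shift_mult[OF mg[OF kj] mf[OF k]] by (simp add: add.commute)
      ultimately show ?thesis
        unfolding D_def by (simp only: mult_op_diff[OF m[OF k]] weighted_shift_0)
    qed
    have mD: "meromorphic_sev (D k)" if "k \<in> {1..m i}" for k
      unfolding D_def by (rule meromorphic_sev_diff[OF m[OF that]])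
    have "(\<Sum>k=1..m i. \<Sum>p=1..m j. F k * G p - G p * F k) = (\<Sum>k=1..m i. mult_op (D k))"
    proof (rule sum.cong[OF refl])
      fix k assume k: "k \<in> {1..m i}"
      then have kj: "k \<in> {1..m j}" using True by simp
      have "(\<Sum>p=1..m j. F k * G p - G p * F k) = (F k * G k - G k * F k) + (\<Sum>p\<in>{1..m j} - {k}. F k * G p - G p * F k)"
        by (rule sum.remove[OF finite_atLeastAtMost kj])
      also have "(\<Sum>p\<in>{1..m j} - {k}. F k * G p - G p * F k) = 0"
        by (intro sum.neutral ballI) (use comm[OF k] in auto)
      finally show "(\<Sum>p=1..m j. F k * G p - G p * F k) = mult_op (D k)" using d[OF k] by simp
    qed
    also have "\<dots> = mult_op (\<lambda>\<gamma>. \<Sum>k=1..m i. D k \<gamma>)"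
      by (rule mult_op_sum[OF mD])
    also have "\<dots> = mult_op (\<lambda>\<gamma>. 1 / (qn i - inverse (qn i)) * (Kp i (n + r) \<gamma> - Km i (n + r) \<gamma>))"
    proof (rule mult_op_cong)
      show "\<forall>\<^sub>F \<gamma> in generic. (\<Sum>k=1..m i. D k \<gamma>) = 1 / (qn i - inverse (qn i)) * (Kp i (n + r) \<gamma> - Km i (n + r) \<gamma>)"
        using diagonal_terms[OF i, of n r] unfolding D_def f_def g_def True[symmetric] .
      show "meromorphic_sev (\<lambda>\<gamma>. \<Sum>k=1..m i. D k \<gamma>)"
        by (rule meromorphic_sev_sum[OF mD])
      show "meromorphic_sev (\<lambda>\<gamma>. 1 / (qn i - inverse (qn i)) * (Kp i (n + r) \<gamma> - Km i (n + r) \<gamma>))"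
        by (rule meromorphic_sev_mult[OF meromorphic_sev_const meromorphic_sev_diff[OF meromorphic_K[OF i]]])
    qed
    also have "\<dots> = (1 / (qn i - inverse (qn i))) *\<^sub>C (mult_op (Kp i (n + r)) - mult_op (Km i (n + r)))"
    proof -
      have "mult_op (Kp i (n + r)) - mult_op (Km i (n + r)) = mult_op (\<lambda>\<gamma>. Kp i (n + r) \<gamma> - Km i (n + r) \<gamma>)"
        by (rule mult_op_diff[OF meromorphic_K[OF i]])
      then show ?thesis
        by (simp only: mult_op_scaleC[OF meromorphic_sev_diff[OF meromorphic_K[OF i]]])
    qed
    finally show ?thesis using True by simp
  qed
  finally show ?thesis .
qed

section \<open>The Cartan generators and the defining relations\<close>

lemma K_ops_inverse:
  assumes i: "i \<in> {1..l}"
  shows "mult_op (Kp i 0) * mult_op (Km i 0) = 1" "mult_op (Km i 0) * mult_op (Kp i 0) = 1"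
proof -
  show "mult_op (Kp i 0) * mult_op (Km i 0) = 1"
    unfolding mult_op_mult[OF meromorphic_K[OF i]] K_zero_inverse[OF i] by (rule mult_op_1)
  then show "mult_op (Km i 0) * mult_op (Kp i 0) = 1"
    by (simp only: mult_op_commute)
qed

lemma cartan_generators_exist:
  assumes i: "i \<in> {1..l}"
  shows "\<exists>H. Kplus_series (qn i) (mult_op (Kp i 0)) H = (\<lambda>n. mult_op (Kp i n)) \<and>
    Kminus_series (qn i) (mult_op (Km i 0)) H = (\<lambda>n. mult_op (Km i n))"
proof (rule Kseries_exist[where p = "qn i" and Kp = "\<lambda>n. mult_op (Kp i n)" and Km = "\<lambda>n. mult_op (Km i n)",
      OF qn_diff[OF i] K_ops_inverse[OF i]])
  show "mult_op (Kp i n) = 0" if "n > 0" for n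
  proof -
    have "Kp i n = (\<lambda>\<gamma>. 0)" by (rule ext) (rule K_support(1)[OF i that])
    then show ?thesis by (simp only: mult_op_0)
  qed
  show "mult_op (Km i n) = 0" if "n < 0" for n
  proof -
    have "Km i n = (\<lambda>\<gamma>. 0)" by (rule ext) (rule K_support(2)[OF i that])
    then show ?thesis by (simp only: mult_op_0)
  qed
qed

end

theorem proposition3p1:
  fixes br :: "'g::complex_vector \<Rightarrow> 'g \<Rightarrow> 'g"
    and l :: nat and a :: "nat \<Rightarrow> nat \<Rightarrow> int" and d m :: "nat \<Rightarrow> nat"
    and x :: "nat \<Rightarrow> nat \<Rightarrow> 'v::finite"
    and \<nu> :: "nat \<Rightarrow> nat \<Rightarrow> complex" and \<omega>1 \<omega>2 :: complex
    and Rp Rm :: "nat \<Rightarrow> complex poly"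
  assumes "semisimple_lie_algebra br" and "cartan_matrix_of br l a"
    and "\<forall>i\<in>{1..l}. d i > 0"
    and "\<forall>i\<in>{1..l}. \<forall>j\<in>{1..l}. int (d i) * a i j = int (d j) * a j i"
    and "Gcd (d ` {1..l}) = 1"
    and "\<forall>i\<in>{1..l}. m i > 0" and "\<forall>i\<in>{1..l}. l_coeff l a m i \<ge> 0"
    and "bij_betw (\<lambda>(i, k). x i k) (SIGMA i:{1..l}. {1..m i}) UNIV"
    and "\<omega>2 \<noteq> 0" and "\<forall>n>0. q_par \<omega>1 \<omega>2 ^ n \<noteq> 1"
    and "\<forall>i\<in>{1..l}. Rp i * Rm i =
           (\<Prod>s=1..nat (l_coeff l a m i). [:- w_par \<omega>2 \<nu> i s, inverse (w_par \<omega>2 \<nu> i s):])"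
  shows "\<exists>H :: nat \<Rightarrow> int \<Rightarrow> 'v mero endo.
    (\<forall>i\<in>{1..l}.
       Kplus_series (q_node d \<omega>1 \<omega>2 i) (K_plus_op l a d m x \<nu> \<omega>1 \<omega>2 i 0) (H i)
         = K_plus_op l a d m x \<nu> \<omega>1 \<omega>2 i \<and>
       Kminus_series (q_node d \<omega>1 \<omega>2 i) (K_minus_op l a d m x \<nu> \<omega>1 \<omega>2 i 0) (H i)
         = K_minus_op l a d m x \<nu> \<omega>1 \<omega>2 i) \<and>
    Uq_relations l a d (q_par \<omega>1 \<omega>2)
      (\<lambda>i. K_plus_op l a d m x \<nu> \<omega>1 \<omega>2 i 0) (\<lambda>i. K_minus_op l a d m x \<nu> \<omega>1 \<omega>2 i 0) H
      (E_op l a d m x \<omega>1 \<omega>2 Rp) (F_op a d m x \<omega>1 \<omega>2 Rm)"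
proof -
  interpret difference_rep l a d m x \<nu> \<omega>1 \<omega>2 Rp Rm
    by unfold_locales
      (use assms(3,4,7-11) cartan_matrix_diag[OF assms(2)] cartan_matrix_off_diag[OF assms(1,2)] in blast)+
  have Kpl: "K_plus_op l a d m x \<nu> \<omega>1 \<omega>2 i = (\<lambda>n. mult_op (Kp i n))" if "i \<in> {1..l}" for i
    by (rule ext) (rule K_plus_op_eq[OF that])
  have Kmi: "K_minus_op l a d m x \<nu> \<omega>1 \<omega>2 i = (\<lambda>n. mult_op (Km i n))" if "i \<in> {1..l}" for i
    by (rule ext) (rule K_minus_op_eq[OF that])
  obtain H where H: "\<forall>i\<in>{1..l}. Kplus_series (qn i) (mult_op (Kp i 0)) (H i) = (\<lambda>n. mult_op (Kp i n)) \<and>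
      Kminus_series (qn i) (mult_op (Km i 0)) (H i) = (\<lambda>n. mult_op (Km i n))"
    using bchoice[of "{1..l}" "\<lambda>i H. Kplus_series (qn i) (mult_op (Kp i 0)) H = (\<lambda>n. mult_op (Kp i n)) \<and>
      Kminus_series (qn i) (mult_op (Km i 0)) H = (\<lambda>n. mult_op (Km i n))"] cartan_generators_exist by blast
  have qn: "q_par \<omega>1 \<omega>2 ^ d i = qn i" for i by (simp add: qn_def q_node_def)
  \<comment> \<open>The relations for \<open>F\<close> have parameter \<open>inverse (qn i)\<close>
    with exponent \<open>a i j\<close>; this rewrites it to the exponent \<open>- a i j\<close> of
    the defining relations.\<close>
  have inv: "inverse (qn i) powi z = qn i powi (- z)" for i z by (simp add: power_int_inverse power_int_minus)
  have "Uq_relations l a d (q_par \<omega>1 \<omega>2)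
      (\<lambda>i. K_plus_op l a d m x \<nu> \<omega>1 \<omega>2 i 0) (\<lambda>i. K_minus_op l a d m x \<nu> \<omega>1 \<omega>2 i 0) H
      (E_op l a d m x \<omega>1 \<omega>2 Rp) (F_op a d m x \<omega>1 \<omega>2 Rm)"
    unfolding Uq_relations_def Let_def qn
  proof (intro conjI ballI allI impI)
    fix i assume i: "i \<in> {1..l}"
    show "K_plus_op l a d m x \<nu> \<omega>1 \<omega>2 i 0 * K_minus_op l a d m x \<nu> \<omega>1 \<omega>2 i 0 = 1"
      "K_minus_op l a d m x \<nu> \<omega>1 \<omega>2 i 0 * K_plus_op l a d m x \<nu> \<omega>1 \<omega>2 i 0 = 1"
      unfolding Kpl[OF i] Kmi[OF i] by (rule K_ops_inverse[OF i])+
  next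
    fix i j assume i: "i \<in> {1..l}" and j: "j \<in> {1..l}"
    have K: "Kplus_series (qn i) (K_plus_op l a d m x \<nu> \<omega>1 \<omega>2 i 0) (H i) = (\<lambda>n. mult_op (Kp i n))"
      "Kminus_series (qn i) (K_minus_op l a d m x \<nu> \<omega>1 \<omega>2 i 0) (H i) = (\<lambda>n. mult_op (Km i n))" if "i \<in> {1..l}" for i
      unfolding Kpl[OF that] Kmi[OF that] using H that by blast+
    note rw = K[OF i] K[OF j] E_op_eq[OF i] E_op_eq[OF j] F_op_eq[OF i] F_op_eq[OF j]
    show "Kplus_series (qn i) (K_plus_op l a d m x \<nu> \<omega>1 \<omega>2 i 0) (H i) n * Kplus_series (qn j) (K_plus_op l a d m x \<nu> \<omega>1 \<omega>2 j 0) (H j) k =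
      Kplus_series (qn j) (K_plus_op l a d m x \<nu> \<omega>1 \<omega>2 j 0) (H j) k * Kplus_series (qn i) (K_plus_op l a d m x \<nu> \<omega>1 \<omega>2 i 0) (H i) n"
      "Kminus_series (qn i) (K_minus_op l a d m x \<nu> \<omega>1 \<omega>2 i 0) (H i) n * Kminus_series (qn j) (K_minus_op l a d m x \<nu> \<omega>1 \<omega>2 j 0) (H j) k =
      Kminus_series (qn j) (K_minus_op l a d m x \<nu> \<omega>1 \<omega>2 j 0) (H j) k * Kminus_series (qn i) (K_minus_op l a d m x \<nu> \<omega>1 \<omega>2 i 0) (H i) n"
      "Kplus_series (qn i) (K_plus_op l a d m x \<nu> \<omega>1 \<omega>2 i 0) (H i) n * Kminus_series (qn j) (K_minus_op l a d m x \<nu> \<omega>1 \<omega>2 j 0) (H j) k =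
      Kminus_series (qn j) (K_minus_op l a d m x \<nu> \<omega>1 \<omega>2 j 0) (H j) k * Kplus_series (qn i) (K_plus_op l a d m x \<nu> \<omega>1 \<omega>2 i 0) (H i) n"
      for n k
      unfolding rw by (rule mult_op_commute)+
    show "exchange_relation (qn i powi a i j) (Kplus_series (qn i) (K_plus_op l a d m x \<nu> \<omega>1 \<omega>2 i 0) (H i)) (current (E_op l a d m x \<omega>1 \<omega>2 Rp j))"
      "exchange_relation (qn i powi a i j) (Kminus_series (qn i) (K_minus_op l a d m x \<nu> \<omega>1 \<omega>2 i 0) (H i)) (current (E_op l a d m x \<omega>1 \<omega>2 Rp j))"
      "exchange_relation (qn i powi (- a i j)) (Kplus_series (qn i) (K_plus_op l a d m x \<nu> \<omega>1 \<omega>2 i 0) (H i)) (current (F_op a d m x \<omega>1 \<omega>2 Rm j))"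
      "exchange_relation (qn i powi (- a i j)) (Kminus_series (qn i) (K_minus_op l a d m x \<nu> \<omega>1 \<omega>2 i 0) (H i)) (current (F_op a d m x \<omega>1 \<omega>2 Rm j))"
      "exchange_relation (qn i powi a i j) (current (E_op l a d m x \<omega>1 \<omega>2 Rp i)) (current (E_op l a d m x \<omega>1 \<omega>2 Rp j))"
      "exchange_relation (qn i powi (- a i j)) (current (F_op a d m x \<omega>1 \<omega>2 Rm i)) (current (F_op a d m x \<omega>1 \<omega>2 Rm j))"
      unfolding rw using exchange_KS[OF i j, of True] exchange_KS[OF i j, of False] exchange_SS[OF i j, of True] exchange_SS[OF i j, of False]
      unfolding P_def if_True if_False inv by blast+
    show "current (E_op l a d m x \<omega>1 \<omega>2 Rp i) n * current (F_op a d m x \<omega>1 \<omega>2 Rm j) k -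
        current (F_op a d m x \<omega>1 \<omega>2 Rm j) k * current (E_op l a d m x \<omega>1 \<omega>2 Rp i) n =
      (if i = j then (1 / (qn i - inverse (qn i))) *\<^sub>C
        (Kplus_series (qn i) (K_plus_op l a d m x \<nu> \<omega>1 \<omega>2 i 0) (H i) (n + k) -
         Kminus_series (qn i) (K_minus_op l a d m x \<nu> \<omega>1 \<omega>2 i 0) (H i) (n + k)) else 0)" for n k
      unfolding rw by (rule EF_commutator[OF i j])
    assume "i \<noteq> j"
    then show "serre_relation (qn i) (nat (1 - a i j)) (current (E_op l a d m x \<omega>1 \<omega>2 Rp i)) (current (E_op l a d m x \<omega>1 \<omega>2 Rp j))"
      "serre_relation (qn i) (nat (1 - a i j)) (current (F_op a d m x \<omega>1 \<omega>2 Rm i)) (current (F_op a d m x \<omega>1 \<omega>2 Rm j))"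
      unfolding rw by (rule serre_SS[OF i j])+
  qed
  then show ?thesis
    using H Kpl Kmi by (intro exI[of _ H] conjI ballI) (simp_all add: qn_def[symmetric])
qed

end
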